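(* Let $R:\mathbb{R}^n\to\mathbb{Z}^n$ be a quantizer, let $L\in\mathbb{R}^{n\times n}$ be nonsingular, and let $T=R\circ L:\mathbb{Z}^n\to\mathbb{Z}^n$. Suppose the matrix $L$ is iteratively nonresonant. Then the quadruple $(\mathbb{Z}^n,\mathcal{Q}^+,\mathbf{F},T)$ satisfies the mixing property $$\lim_{k\to+\infty}\mathbf{F}\big(T^{-k}(A)\cap B\big)=\mathbf{F}(A)\,\mathbf{F}(B),\qquad A,B\in\mathcal{Q}^+.$$
   Context: Frequency. For $a\in\mathbb{Z}^n$ and $\ell\in\mathbb{N}^n$ let $P_{a,\ell}=\{x\in\mathbb{Z}^n:\ a_k\le x_k<a_k+\ell_k \text{ for all }1\le k\le n\}$, and for $N\in\mathbb{N}$ let $\mathcal{P}_N=\{P_{a,\ell}:\ a\in\mathbb{Z}^n,\ \ell\in\mathbb{N}^n,\ \min_k\ell_k\ge N\}$. For $A\subset\mathbb{Z}^n$ put $\mathbf{F}_*(A)=\sup_{N\ge1}\inf_{P\in\mathcal{P}_N}\frac{\#(A\cap P)}{\#P}$ and $\mathbf{F}^*(A)=\inf_{N\ge1}\sup_{P\in\mathcal{P}_N}\frac{\#(A\cap P)}{\#P}$. The set $A$ is frequency measurable if $\mathbf{F}_*(A)=\mathbf{F}^*(A)$; the common value is the frequency $\mathbf{F}(A)$. System. A quantizer is a map $R:\mathbb{R}^n\to\mathbb{Z}^n$ such that $R(u+z)=R(u)+z$ for all $u\in\mathbb{R}^n$, $z\in\mathbb{Z}^n$, and the set $R^{-1}(0)$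 is Jordan measurable (bounded with boundary of zero Lebesgue measure). $T^{-k}(A)$ is the preimage of $A$ under the $k$-th iterate of $T$. Forward algebra. For $m\in\mathbb{N}$, $G\subset\mathbb{R}^m$ and $\Lambda\in\mathbb{R}^{m\times n}$ let $Q_m(G,\Lambda)=\{x\in\mathbb{Z}^n:\ \Lambda x\in G+\mathbb{Z}^m\}$ and $\mathcal{Q}_m(\Lambda)=\{Q_m(G,\Lambda):\ G\subset[0,1)^m\text{ Jordan measurable}\}$. The forward algebra is $\mathcal{Q}^+=\bigcup_{N\ge1}\mathcal{Q}_{Nn}(\mathcal{L}_N^+)$, where $\mathcal{L}_N^+\in\mathbb{R}^{Nn\times n}$ is obtained by stacking $L,L^2,\ldots,L^N$. Nonresonance. $\Lambda\in\mathbb{R}^{m\times n}$ is nonresonant if the rows of $\begin{bmatrix}I_n\\ \Lambda\end{bmatrix}$ are linearly independent over the rationals. A nonsingular $L$ is iteratively nonresonant if every finite submatrix (formed from finitely many rows with distinct indices) of the infinite matrix obtained by stacking all nonzero integer powers $L^k$, $k\in\mathbb{Z}\setminus\{0\}$, is nonresonant. *)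

theory Defs
  imports "HOL-Analysis.Analysis"
begin

section \<open>Frequency of subsets of the integer lattice\<close>

definition lattice_box :: "int ^ 'n \<Rightarrow> nat ^ 'n \<Rightarrow> (int ^ 'n) set" where
  "lattice_box a l = {x. \<forall>k. a $ k \<le> x $ k \<and> x $ k < a $ k + int (l $ k)}"

definition lattice_boxes :: "nat \<Rightarrow> (int ^ 'n) set set" where
  "lattice_boxes N = {lattice_box a l | a l. N \<le> (MIN k. l $ k)}"

definition box_density :: "(int ^ 'n) set \<Rightarrow> (int ^ 'n) set \<Rightarrow> real" where
  "box_density A P = real (card (A \<inter> P)) / real (card P)"

definition lower_freq :: "(int ^ 'n) set \<Rightarrow> real" where
  "lower_freq A = (SUP N \<in> {1..}. INF P \<in> lattice_boxes N. box_density A P)"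

definition upper_freq :: "(int ^ 'n) set \<Rightarrow> real" where
  "upper_freq A = (INF N \<in> {1..}. SUP P \<in> lattice_boxes N. box_density A P)"

definition freq_measurable :: "(int ^ 'n) set \<Rightarrow> bool" where
  "freq_measurable A \<longleftrightarrow> lower_freq A = upper_freq A"

text \<open>Only meaningful for frequency measurable sets.\<close>
definition freq :: "(int ^ 'n) set \<Rightarrow> real" where
  "freq A = lower_freq A"

section \<open>Jordan measurability\<close>

definition jordan_measurable :: "'a::euclidean_space set \<Rightarrow> bool" where
  "jordan_measurable S \<longleftrightarrow> bounded S \<and> negligible (frontier S)"

text \<open>
  The same notion for the space of real vectors whose coordinates are indexed by a finite set
  \<open>I\<close>, represented by the extensional functions \<open>I \<rightarrow>\<^sub>E UNIV\<close>.  The boundary is taken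
  within that space, not within the full function type.  It is closed, hence Borel, so being
  Lebesgue null and being null for the product of \<open>lborel\<close> coincide.
\<close>
definition jordan_measurable_on :: "'i set \<Rightarrow> ('i \<Rightarrow> real) set \<Rightarrow> bool" where
  "jordan_measurable_on I G \<longleftrightarrow>
     G \<subseteq> (I \<rightarrow>\<^sub>E UNIV) \<and>
     (\<exists>c. \<forall>g\<in>G. \<forall>i\<in>I. \<bar>g i\<bar> \<le> c) \<and>
     product_topology (\<lambda>_. euclideanreal) I frontier_of G \<in> null_sets (Pi\<^sub>M I (\<lambda>_. lborel))"

section \<open>Discretized linear systems\<close>

definition real_vec :: "int ^ 'n \<Rightarrow> real ^ 'n" where
  "real_vec x = (\<chi> i. real_of_int (x $ i))"

definition quantizer :: "(real ^ 'n \<Rightarrow> int ^ 'n) \<Rightarrow> bool" where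
  "quantizer R \<longleftrightarrow>
     (\<forall>u z. R (u + real_vec z) = R u + z) \<and> jordan_measurable (R -` {0})"

definition discretization ::
    "(real ^ 'n \<Rightarrow> int ^ 'n) \<Rightarrow> real ^ 'n ^ 'n \<Rightarrow> int ^ 'n \<Rightarrow> int ^ 'n" where
  "discretization R L x = R (L *v real_vec x)"

text \<open>The power operation of HOL-Analysis on \<open>real ^ 'n ^ 'n\<close> would be entrywise.\<close>
definition mat_pow :: "real ^ 'n ^ 'n \<Rightarrow> nat \<Rightarrow> real ^ 'n ^ 'n" where
  "mat_pow L k = (((**) L) ^^ k) (mat 1)"

definition mat_powi :: "real ^ 'n ^ 'n \<Rightarrow> int \<Rightarrow> real ^ 'n ^ 'n" where
  "mat_powi L k = (if 0 \<le> k then mat_pow L (nat k) else mat_pow (matrix_inv L) (nat (- k)))"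

section \<open>Quasiperiodic sets and the forward algebra\<close>

text \<open>
  A real matrix with \<open>m\<close> rows and \<open>n\<close> columns is given by the family of its rows
  \<open>\<Lambda> :: 'i \<Rightarrow> real ^ 'n\<close>, restricted to a finite index set \<open>I\<close> of cardinality \<open>m\<close>.
\<close>
definition quasiperiodic_set ::
    "'i set \<Rightarrow> ('i \<Rightarrow> real) set \<Rightarrow> ('i \<Rightarrow> real ^ 'n) \<Rightarrow> (int ^ 'n) set" where
  "quasiperiodic_set I G \<Lambda> =
     {x. \<exists>g\<in>G. \<exists>z :: 'i \<Rightarrow> int. \<forall>i\<in>I. \<Lambda> i \<bullet> real_vec x = g i + real_of_int (z i)}"

definition quasiperiodic_sets :: "'i set \<Rightarrow> ('i \<Rightarrow> real ^ 'n) \<Rightarrow> (int ^ 'n) set set" where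
  "quasiperiodic_sets I \<Lambda> =
     {quasiperiodic_set I G \<Lambda> | G. G \<subseteq> (I \<rightarrow>\<^sub>E {0..<1}) \<and> jordan_measurable_on I G}"

text \<open>
  The row with index \<open>(k, i)\<close> of the stacked powers is row \<open>i\<close> of \<open>L\<^sup>k\<close>.
\<close>
definition stacked_powers :: "real ^ 'n ^ 'n \<Rightarrow> int \<times> 'n \<Rightarrow> real ^ 'n" where
  "stacked_powers L = (\<lambda>(k, i). row i (mat_powi L k))"

definition forward_algebra :: "real ^ 'n ^ 'n \<Rightarrow> (int ^ 'n) set set" where
  "forward_algebra L =
     (\<Union>N \<in> {1::nat..}. quasiperiodic_sets ({1..int N} \<times> UNIV) (stacked_powers L))"

section \<open>Nonresonance\<close>

text \<open>
  Linear independence over the rationals of a finite family of vectors; in particular,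
  a family with a repeated member is dependent.
\<close>
definition rat_independent :: "'i set \<Rightarrow> ('i \<Rightarrow> real ^ 'n) \<Rightarrow> bool" where
  "rat_independent I v \<longleftrightarrow>
     (\<forall>q :: 'i \<Rightarrow> rat. (\<Sum>i\<in>I. of_rat (q i) *\<^sub>R v i) = 0 \<longrightarrow> (\<forall>i\<in>I. q i = 0))"

text \<open>
  Stacking the identity matrix on top of \<open>\<Lambda>\<close> is expressed by a disjoint sum of index sets:
  \<open>Inl j\<close> indexes the rows of the identity, \<open>Inr i\<close> those of \<open>\<Lambda>\<close>.
\<close>
definition nonresonant :: "'i set \<Rightarrow> ('i \<Rightarrow> real ^ 'n) \<Rightarrow> bool" where
  "nonresonant I \<Lambda> \<longleftrightarrow>
     rat_independent ((UNIV :: 'n set) <+> I) (case_sum (\<lambda>j. row j (mat 1)) \<Lambda>)"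

definition iteratively_nonresonant :: "real ^ 'n ^ 'n \<Rightarrow> bool" where
  "iteratively_nonresonant L \<longleftrightarrow>
     invertible L \<and>
     (\<forall>I. finite I \<and> I \<subseteq> (- {0}) \<times> UNIV \<longrightarrow> nonresonant I (stacked_powers L))"

end

theory Submission
  imports Defs
begin

text \<open>
  Nonresonance makes the phases of \<open>L x, L\<^sup>2 x, \<dots>\<close> modulo 1 equidistributed and independent with
  respect to frequency (Weyl's criterion).  The quantization errors of the first \<open>k\<close> steps are
  functions of the first \<open>k\<close> phases only, so up to an exceptional set of small frequency, the lattice
  splits into finitely many cylinder sets over these phases, on each of which
  \<open>T\<^sup>k x \<approx> L\<^sup>k x - w\<close> with a constant \<open>w\<close>.  Hence \<open>T\<^sup>k x \<in> A\<close> depends on the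
  phases of \<open>L\<^bsup>k+1\<^esup> x, \<dots>, L\<^bsup>k+N\<^esup> x\<close> through a translate of the window defining \<open>A\<close>,
  and translation preserves the frequency.  If \<open>B\<close> is determined by the first \<open>M\<close> phases,
  independence gives \<open>F(T\<^sup>-\<^sup>k A \<inter> B) = F(A) F(B)\<close> exactly for all \<open>k \<ge> M\<close>.

  Jordan sets are only ever used through finite families of grid cells, which avoids measure theory
  for the merely Lebesgue measurable error functions.
\<close>

section \<open>Limits along growing boxes\<close>

text \<open>\<open>T^k x\<close> is only approximately \<open>L^k x - w\<close>, and the later
  powers \<open>L^a\<close> amplify the error, so a window can be tested only away from its
  boundary. Windows are therefore replaced by grid cells on whose enlargements membership is
  constant; few cells are lost because the boundary is closed, bounded and null. Translating a
  window amounts to moving the origin of the grid, and the frequency \<open>(1 / K) ^ m\<close> of a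
  cell does not depend on that origin. Hence the number of cells inside the window, not their
  position, decides the frequency, although \<open>w\<close> varies from one cylinder to the next.
  Tolerances are fixed backwards in time: the accuracy wanted after step \<open>k + 1\<close>
  dictates the one needed after step \<open>k\<close>. Frequency is only finitely additive and
  meaningful only for measurable sets, so all approximations are finite disjoint families of
  cylinders covering everything up to small frequency.\<close>

definition box_filter :: "(int ^ 'n) set filter" where
  "box_filter = (INF N \<in> {1..}. principal (lattice_boxes N))"

lemma lattice_boxes_iff: "P \<in> lattice_boxes N \<longleftrightarrow> (\<exists>a l. P = lattice_box a l \<and> (\<forall>k. N \<le> l $ k))"
  by (auto simp: lattice_boxes_def)

lemma lattice_boxes_antimono: "M \<le> N \<Longrightarrow> lattice_boxes N \<subseteq> lattice_boxes M"
  unfolding subset_iff lattice_boxes_iff by (metis order_trans)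

lemma lattice_boxes_nonempty: "lattice_boxes N \<noteq> ({} :: (int ^ 'n) set set)"
proof -
  have "lattice_box 0 (\<chi> k. N) \<in> (lattice_boxes N :: (int ^ 'n) set set)"
    unfolding lattice_boxes_iff by (intro exI[of _ 0] exI[of _ "\<chi> k. N"]) auto
  then show ?thesis by blast
qed

text \<open>Frequency measurability becomes convergence of \<open>box_density\<close> along
  \<open>box_filter\<close>, so limit theorems replace nested suprema and infima. The sets
  \<open>lattice_boxes N\<close> decrease in \<open>N\<close> and hence form a filter base.\<close>

lemma eventually_box_filter:
  "eventually Q box_filter \<longleftrightarrow> (\<exists>N\<ge>1. \<forall>P\<in>lattice_boxes N. Q P)"
proof -
  have "eventually Q box_filter \<longleftrightarrow> (\<exists>N\<in>{1..}. eventually Q (principal (lattice_boxes N)))"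
    unfolding box_filter_def
  proof (rule eventually_INF_base)
    fix a b :: nat assume "a \<in> {1..}" "b \<in> {1..}"
    then show "\<exists>x\<in>{1..}. principal (lattice_boxes x)
        \<le> inf (principal (lattice_boxes a)) (principal (lattice_boxes b :: (int ^ 'n) set set))"
      using lattice_boxes_antimono[of a "max a b"] lattice_boxes_antimono[of b "max a b"]
      by (intro bexI[of _ "max a b"]) auto
  qed auto
  then show ?thesis by (auto simp: eventually_principal)
qed

lemma box_filter_neq_bot [simp]: "box_filter \<noteq> bot"
  using lattice_boxes_nonempty
  by (auto simp: trivial_limit_def eventually_box_filter)

lemma bij_betw_lattice_box:
  "bij_betw vec_nth (lattice_box a l) (PiE UNIV (\<lambda>k. {a $ k..<a $ k + int (l $ k)}))"
  by (rule bij_betwI[where g = vec_lambda]) (auto simp: lattice_box_def PiE_UNIV_domain)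

text \<open>Later turns the sum of a character over a box into a product of one-dimensional
  geometric sums.\<close>

lemma sum_prod_lattice_box:
  fixes f :: "'n::finite \<Rightarrow> int \<Rightarrow> 'a::comm_semiring_1"
  shows "(\<Sum>x\<in>lattice_box a l. \<Prod>k\<in>UNIV. f k (x $ k))
    = (\<Prod>k\<in>UNIV. \<Sum>t\<in>{a $ k..<a $ k + int (l $ k)}. f k t)"
proof -
  have "(\<Sum>x\<in>lattice_box a l. \<Prod>k\<in>UNIV. f k (x $ k))
      = (\<Sum>g\<in>PiE UNIV (\<lambda>k. {a $ k..<a $ k + int (l $ k)}). \<Prod>k\<in>UNIV. f k (g k))"
    by (rule sum.reindex_bij_betw[OF bij_betw_lattice_box])
  also have "\<dots> = (\<Prod>k\<in>UNIV. \<Sum>t\<in>{a $ k..<a $ k + int (l $ k)}. f k t)"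
    by (subst prod_sum_PiE) auto
  finally show ?thesis .
qed

lemma finite_lattice_box [simp]: "finite (lattice_box a l)"
  by (simp add: bij_betw_finite[OF bij_betw_lattice_box] finite_PiE)

lemma card_lattice_box: "card (lattice_box a l) = (\<Prod>k\<in>UNIV. l $ k)"
  by (simp add: bij_betw_same_card[OF bij_betw_lattice_box] card_PiE)

lemma eventually_box_card_pos: "eventually (\<lambda>P. finite P \<and> card P > 0) box_filter"
  unfolding eventually_box_filter
  by (intro exI[of _ 1]) (force simp: lattice_boxes_iff card_lattice_box Suc_le_eq simp del: card_gt_0_iff)

section \<open>Frequency\<close>

lemma box_density_ge_0 [simp]: "0 \<le> box_density A P"
  by (simp add: box_density_def)

lemma box_density_le_1 [simp]: "box_density A P \<le> 1"
  by (cases "finite P") (auto simp: box_density_def divide_le_eq_1 card_mono)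

lemma box_density_mono: "finite P \<Longrightarrow> A \<subseteq> B \<Longrightarrow> box_density A P \<le> box_density B P"
  by (auto simp: box_density_def intro!: divide_right_mono card_mono)

lemma box_density_Un:
  "finite P \<Longrightarrow> A \<inter> B = {} \<Longrightarrow> box_density (A \<union> B) P = box_density A P + box_density B P"
  by (subst (1) box_density_def, subst Int_Un_distrib2, subst card_Un_disjoint)
    (auto simp: box_density_def add_divide_distrib)

lemma bdd_INF_density:
  fixes A :: "(int ^ 'n) set"
  shows "bdd_above ((\<lambda>N. INF P \<in> lattice_boxes N. box_density A P) ` {1..})"
proof (rule bdd_aboveI2)
  fix N
  obtain P :: "(int ^ 'n) set" where P: "P \<in> lattice_boxes N" using lattice_boxes_nonempty by blast
  have "(INF P \<in> lattice_boxes N. box_density A P) \<le> box_density A P"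
    by (rule cINF_lower[OF _ P]) (auto intro: bdd_belowI2[of _ 0])
  then show "(INF P \<in> lattice_boxes N. box_density A P) \<le> 1"
    using box_density_le_1 order_trans by blast
qed

lemma bdd_SUP_density:
  fixes A :: "(int ^ 'n) set"
  shows "bdd_below ((\<lambda>N. SUP P \<in> lattice_boxes N. box_density A P) ` {1..})"
proof (rule bdd_belowI2)
  fix N
  obtain P :: "(int ^ 'n) set" where P: "P \<in> lattice_boxes N" using lattice_boxes_nonempty by blast
  have "box_density A P \<le> (SUP P \<in> lattice_boxes N. box_density A P)"
    by (rule cSUP_upper[OF P]) (auto intro: bdd_aboveI2[of _ _ 1])
  then show "0 \<le> (SUP P \<in> lattice_boxes N. box_density A P)"
    using box_density_ge_0 order_trans by blast
qed

lemma lower_freq_ge: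
  assumes "eventually (\<lambda>P. a \<le> box_density A P) box_filter"
  shows "a \<le> lower_freq A"
proof -
  obtain N where N: "N \<ge> 1" "\<And>P. P \<in> lattice_boxes N \<Longrightarrow> a \<le> box_density A P"
    using assms by (auto simp: eventually_box_filter)
  have "a \<le> (INF P \<in> lattice_boxes N. box_density A P)"
    using N by (intro cINF_greatest lattice_boxes_nonempty) auto
  also have "\<dots> \<le> lower_freq A"
    unfolding lower_freq_def using N by (intro cSUP_upper bdd_INF_density) auto
  finally show ?thesis .
qed

lemma upper_freq_le:
  assumes "eventually (\<lambda>P. box_density A P \<le> a) box_filter"
  shows "upper_freq A \<le> a"
proof -
  obtain N where N: "N \<ge> 1" "\<And>P. P \<in> lattice_boxes N \<Longrightarrow> box_density A P \<le> a"
    using assms by (auto simp: eventually_box_filter)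
  have "upper_freq A \<le> (SUP P \<in> lattice_boxes N. box_density A P)"
    unfolding upper_freq_def using N by (intro cINF_lower bdd_SUP_density) auto
  also have "\<dots> \<le> a"
    using N by (intro cSUP_least lattice_boxes_nonempty) auto
  finally show ?thesis .
qed

lemma eventually_gt_lower_freq:
  assumes "a < lower_freq A"
  shows "eventually (\<lambda>P. a < box_density A P) box_filter"
proof -
  obtain N where N: "N \<ge> 1" "a < (INF P \<in> lattice_boxes N. box_density A P)"
    using assms less_cSUP_iff[OF _ bdd_INF_density[of A], of a]
    by (auto simp: lower_freq_def)
  then show ?thesis
    unfolding eventually_box_filter
    by (auto intro!: exI[of _ N] less_le_trans[OF N(2)] cINF_lower bdd_belowI2[of _ 0])
qed

lemma eventually_less_upper_freq:
  assumes "upper_freq A < a"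
  shows "eventually (\<lambda>P. box_density A P < a) box_filter"
proof -
  obtain N where N: "N \<ge> 1" "(SUP P \<in> lattice_boxes N. box_density A P) < a"
    using assms cINF_less_iff[OF _ bdd_SUP_density[of A], of a]
    by (auto simp: upper_freq_def)
  then show ?thesis
    unfolding eventually_box_filter
    by (auto intro!: exI[of _ N] le_less_trans[OF _ N(2)] cSUP_upper bdd_aboveI2[of _ _ 1])
qed

lemma lower_freq_le_upper_freq: "lower_freq A \<le> upper_freq A"
proof (rule ccontr)
  assume "\<not> ?thesis"
  then obtain c where "upper_freq A < c" "c < lower_freq A" by (meson dense not_le)
  then have "eventually (\<lambda>P. box_density A P < c \<and> c < box_density A P) box_filter"
    by (intro eventually_conj eventually_less_upper_freq eventually_gt_lower_freq)
  then have "eventually (\<lambda>P. False) (box_filter :: (int ^ 'a) set filter)"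
    by (rule eventually_mono) linarith
  then show False by simp
qed

lemma tendsto_freq: "freq_measurable A \<Longrightarrow> (box_density A \<longlongrightarrow> freq A) box_filter"
  by (rule order_tendstoI)
    (auto simp: freq_def freq_measurable_def intro: eventually_gt_lower_freq eventually_less_upper_freq)

text \<open>Gives measurability from two-sided approximation, before any candidate for the value of
  the frequency is known.\<close>

lemma freq_measurable_if_between:
  assumes "\<And>e. e > 0 \<Longrightarrow> \<exists>a b. b \<le> a + e \<and> eventually (\<lambda>P. a \<le> box_density A P) box_filter
    \<and> eventually (\<lambda>P. box_density A P \<le> b) box_filter"
  shows "freq_measurable A"
proof -
  have "upper_freq A \<le> lower_freq A + e" if e: "e > 0" for e
  proof -
    obtain a b where "b \<le> a + e" "a \<le> lower_freq A" "upper_freq A \<le> b"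
      using assms[OF e] lower_freq_ge upper_freq_le by blast
    then show ?thesis by linarith
  qed
  then have "upper_freq A \<le> lower_freq A"
    by (meson field_le_epsilon)
  then show ?thesis
    using lower_freq_le_upper_freq[of A] by (simp add: freq_measurable_def)
qed

text \<open>Together with \<open>tendsto_freq\<close> this makes \<open>freq\<close> and limits of
  \<open>box_density\<close> interchangeable; the rules for unions, differences and complements
  below are then rules for limits.\<close>

lemma freq_eqI:
  assumes "(box_density A \<longlongrightarrow> c) box_filter"
  shows "freq_measurable A" "freq A = c"
proof -
  have "\<exists>a b. b \<le> a + e \<and> eventually (\<lambda>P. a \<le> box_density A P) box_filter
    \<and> eventually (\<lambda>P. box_density A P \<le> b) box_filter" if "e > 0" for e
  proof (intro exI conjI)
    show "c + e/2 \<le> (c - e/2) + e" by simp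
    show "eventually (\<lambda>P. c - e/2 \<le> box_density A P) box_filter"
      using order_tendstoD(1)[OF assms, of "c - e/2"] that by (auto elim!: eventually_mono)
    show "eventually (\<lambda>P. box_density A P \<le> c + e/2) box_filter"
      using order_tendstoD(2)[OF assms, of "c + e/2"] that by (auto elim!: eventually_mono)
  qed
  then show *: "freq_measurable A" by (rule freq_measurable_if_between)
  show "freq A = c"
    using tendsto_unique[OF box_filter_neq_bot tendsto_freq[OF *] assms] .
qed

lemma eventually_finite_box: "eventually finite box_filter"
  using eventually_box_card_pos by (rule eventually_mono) auto

lemma freq_mono:
  assumes "freq_measurable A" "freq_measurable B" "A \<subseteq> B"
  shows "freq A \<le> freq B"
  using tendsto_freq[OF assms(2)] tendsto_freq[OF assms(1)]
  by (rule tendsto_le[OF box_filter_neq_bot])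
    (use eventually_finite_box box_density_mono[OF _ assms(3)] in \<open>auto elim: eventually_mono\<close>)

lemma freq_ge_0: "freq_measurable A \<Longrightarrow> 0 \<le> freq A"
  using tendsto_lowerbound[OF tendsto_freq, of A 0] by simp

lemma freq_le_1: "freq_measurable A \<Longrightarrow> freq A \<le> 1"
  using tendsto_upperbound[OF tendsto_freq, of A 1] by simp

lemma freq_Un:
  assumes "freq_measurable A" "freq_measurable B" "A \<inter> B = {}"
  shows "freq_measurable (A \<union> B)" "freq (A \<union> B) = freq A + freq B"
proof -
  have "(box_density (A \<union> B) \<longlongrightarrow> freq A + freq B) box_filter"
    using tendsto_add[OF tendsto_freq[OF assms(1)] tendsto_freq[OF assms(2)]]
    by (rule Lim_transform_eventually)
      (use eventually_finite_box box_density_Un[OF _ assms(3)] in \<open>auto elim: eventually_mono\<close>)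
  then show "freq_measurable (A \<union> B)" "freq (A \<union> B) = freq A + freq B" by (rule freq_eqI)+
qed

lemma freq_UNIV: "freq_measurable UNIV" "freq UNIV = 1"
proof -
  have "(box_density UNIV \<longlongrightarrow> 1) box_filter"
    by (rule tendsto_eventually)
      (use eventually_box_card_pos in \<open>auto simp: box_density_def elim!: eventually_mono\<close>)
  then show "freq_measurable UNIV" "freq UNIV = 1" by (rule freq_eqI)+
qed

lemma freq_empty: "freq_measurable {}" "freq {} = 0"
proof -
  have "(box_density {} \<longlongrightarrow> 0) box_filter"
    by (rule tendsto_eventually) (simp add: box_density_def)
  then show "freq_measurable {}" "freq {} = 0" by (rule freq_eqI)+
qed

lemma freq_Diff:
  assumes "freq_measurable A" "freq_measurable B" "B \<subseteq> A"
  shows "freq_measurable (A - B)" "freq (A - B) = freq A - freq B"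
proof -
  have "(box_density (A - B) \<longlongrightarrow> freq A - freq B) box_filter"
    using tendsto_diff[OF tendsto_freq[OF assms(1)] tendsto_freq[OF assms(2)]]
  proof (rule Lim_transform_eventually)
    have "box_density A P - box_density B P = box_density (A - B) P" if "finite P" for P
      using box_density_Un[OF that, of "A - B" B] assms(3) by (simp add: Diff_disjoint Un_absorb2 inf_commute)
    then show "\<forall>\<^sub>F P in box_filter. box_density A P - box_density B P = box_density (A - B) P"
      using eventually_finite_box by (auto elim: eventually_mono)
  qed
  then show "freq_measurable (A - B)" "freq (A - B) = freq A - freq B" by (rule freq_eqI)+
qed

lemma freq_Compl:
  assumes "freq_measurable A"
  shows "freq_measurable (- A)" "freq (- A) = 1 - freq A"
  using freq_Diff[OF freq_UNIV(1) assms] by (simp_all add: Compl_eq_Diff_UNIV freq_UNIV)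

lemma freq_UN_disjoint:
  assumes "finite J" "\<And>j. j \<in> J \<Longrightarrow> freq_measurable (X j)" "disjoint_family_on X J"
  shows "freq_measurable (\<Union>j\<in>J. X j) \<and> freq (\<Union>j\<in>J. X j) = (\<Sum>j\<in>J. freq (X j))"
  using assms
proof (induction J)
  case empty
  then show ?case by (simp add: freq_empty)
next
  case (insert j J)
  have "X j \<inter> (\<Union>j\<in>J. X j) = {}"
    using insert.hyps insert.prems(2) by (auto simp: disjoint_family_on_def)
  moreover have "disjoint_family_on X J"
    using insert.prems(2) by (auto simp: disjoint_family_on_def)
  ultimately show ?case
    using insert freq_Un[of "X j" "\<Union>j\<in>J. X j"] by simp
qed

section \<open>Equidistribution of characters\<close>

text \<open>A phase modulo 1 is encoded as a point of the unit circle: integer parts disappear, and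
  the circle is compact, as the Stone-Weierstrass theorem requires.\<close>

definition circle_exp :: "real \<Rightarrow> complex" where
  "circle_exp t = cis (2 * pi * t)"

lemma norm_circle_exp [simp]: "norm (circle_exp t) = 1"
  by (simp add: circle_exp_def)

lemma circle_exp_in_sphere [simp]: "circle_exp t \<in> sphere 0 1"
  by simp

lemma circle_exp_nonzero [simp]: "circle_exp t \<noteq> 0"
  by (metis norm_circle_exp norm_zero zero_neq_one)

lemma circle_exp_add: "circle_exp (s + t) = circle_exp s * circle_exp t"
  by (simp add: circle_exp_def cis_mult distrib_left)

lemma circle_exp_0 [simp]: "circle_exp 0 = 1"
  by (simp add: circle_exp_def)

lemma circle_exp_powi: "circle_exp t powi m = circle_exp (of_int m * t)"
  by (simp add: circle_exp_def cis_power_int mult_ac)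

lemma circle_exp_of_nat_mult: "circle_exp (of_nat m * t) = circle_exp t ^ m"
  by (simp add: circle_exp_def Complex.DeMoivre mult_ac)

lemma circle_exp_eq_1_iff: "circle_exp t = 1 \<longleftrightarrow> t \<in> \<int>"
proof -
  have "circle_exp t = 1 \<longleftrightarrow> (\<exists>n::int. 2 * pi * t = of_int n * (2 * pi))"
    by (auto simp: circle_exp_def cis_conv_exp exp_eq_1 algebra_simps)
  also have "\<dots> \<longleftrightarrow> (\<exists>n::int. t = of_int n)"
  proof -
    have "2 * pi * t = of_int n * (2 * pi) \<longleftrightarrow> t = of_int n" for n :: int by auto
    then show ?thesis by presburger
  qed
  finally show ?thesis by (auto elim: Ints_cases)
qed

lemma circle_exp_eq_iff: "circle_exp s = circle_exp t \<longleftrightarrow> s - t \<in> \<int>"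
proof -
  have "circle_exp s = circle_exp (s - t) * circle_exp t"
    by (simp flip: circle_exp_add)
  then show ?thesis
    by (simp flip: circle_exp_eq_1_iff)
qed

lemma continuous_on_circle_exp [continuous_intros]:
  "continuous_on A f \<Longrightarrow> continuous_on A (\<lambda>x. circle_exp (f x))"
  unfolding circle_exp_def cis_conv_exp by (intro continuous_intros)

lemma surj_circle_exp:
  assumes "z \<in> sphere 0 1"
  shows "\<exists>t. z = circle_exp t"
proof -
  have "z = cis (Arg z)"
    using assms by (subst cis_Arg) (auto simp: sgn_div_norm)
  then show ?thesis by (intro exI[of _ "Arg z / (2 * pi)"]) (simp add: circle_exp_def)
qed

section \<open>Box means of characters\<close>

definition box_mean :: "(int ^ 'n \<Rightarrow> complex) \<Rightarrow> (int ^ 'n) set \<Rightarrow> complex" where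
  "box_mean f P = (\<Sum>x\<in>P. f x) / of_nat (card P)"

lemma box_mean_add: "box_mean (\<lambda>x. f x + g x) P = box_mean f P + box_mean g P"
  by (simp add: box_mean_def sum.distrib add_divide_distrib)

lemma box_mean_diff: "box_mean (\<lambda>x. f x - g x) P = box_mean f P - box_mean g P"
  by (simp add: box_mean_def sum_subtractf diff_divide_distrib)

lemma box_mean_cmult: "box_mean (\<lambda>x. c * f x) P = c * box_mean f P"
  by (simp add: box_mean_def flip: sum_distrib_left)

lemma norm_box_mean_le:
  assumes "\<And>x. norm (f x) \<le> b" "b \<ge> 0"
  shows "norm (box_mean f P) \<le> b"
proof (cases "card P = 0")
  case False
  then have "norm (\<Sum>x\<in>P. f x) \<le> of_nat (card P) * b"
    by (intro sum_norm_bound assms)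
  then show ?thesis
    using False by (simp add: box_mean_def norm_divide divide_le_eq mult.commute)
qed (use assms in \<open>simp add: box_mean_def\<close>)

text \<open>A geometric sum whose ratio differs from 1; the bound depends neither on the position
  nor on the length of the interval.\<close>

lemma sum_circle_exp_interval:
  fixes a :: int
  assumes "\<theta> \<notin> \<int>"
  shows "norm (\<Sum>t\<in>{a..<a + int l}. circle_exp (\<theta> * of_int t)) \<le> 2 / norm (1 - circle_exp \<theta>)"
proof -
  have ne: "circle_exp \<theta> \<noteq> 1" using assms by (simp add: circle_exp_eq_1_iff)
  have "(\<Sum>t\<in>{a..<a + int l}. circle_exp (\<theta> * of_int t))
      = (\<Sum>m<l. circle_exp (\<theta> * of_int (a + int m)))"
    by (rule sum.reindex_bij_witness[of _ "\<lambda>m. a + int m" "\<lambda>t. nat (t - a)"]) auto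
  also have "\<dots> = circle_exp (\<theta> * of_int a) * (\<Sum>m<l. circle_exp \<theta> ^ m)"
    by (simp add: sum_distrib_left distrib_left circle_exp_add mult.commute[of \<theta>] circle_exp_of_nat_mult)
  also have "norm \<dots> = norm (1 - circle_exp \<theta> ^ l) / norm (1 - circle_exp \<theta>)"
    using ne by (simp add: norm_mult sum_gp_strict norm_divide)
  also have "\<dots> \<le> 2 / norm (1 - circle_exp \<theta>)"
    by (intro divide_right_mono order_trans[OF norm_triangle_ineq4]) (auto simp: norm_power)
  finally show ?thesis .
qed

lemma circle_exp_inner_real_vec:
  "circle_exp (\<theta> \<bullet> real_vec x) = (\<Prod>k\<in>UNIV. circle_exp (\<theta> $ k * of_int (x $ k)))"
proof -
  have "circle_exp (\<Sum>k\<in>A. g k) = (\<Prod>k\<in>A. circle_exp (g k))" if "finite A" for A and g :: "'a \<Rightarrow> real"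
    using that by (induction A) (auto simp: circle_exp_add)
  then show ?thesis by (simp add: inner_vec_def real_vec_def)
qed

text \<open>One nonintegral coordinate suffices: its one-dimensional mean is at most
  \<open>C / l\<close>, and the remaining factors are means of numbers of modulus 1.\<close>

lemma box_mean_character:
  fixes \<theta> :: "real ^ 'n"
  assumes "\<theta> $ j \<notin> \<int>"
  shows "(box_mean (\<lambda>x. circle_exp (\<theta> \<bullet> real_vec x)) \<longlongrightarrow> 0) box_filter"
proof (rule tendstoI)
  fix e :: real assume e: "e > 0"
  define C where "C = 2 / norm (1 - circle_exp (\<theta> $ j))"
  obtain N :: nat where N: "N > C / e" using reals_Archimedean2 by blast
  have C: "C \<ge> 0" by (simp add: C_def)
  \<comment> \<open>\<open>Suc N\<close> instead of \<open>N\<close> keeps the side lengths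
    positive.\<close>
  have "norm (box_mean (\<lambda>x. circle_exp (\<theta> \<bullet> real_vec x)) P) < e" if P: "P \<in> lattice_boxes (Suc N)" for P
  proof -
    obtain a l where al: "P = lattice_box a l" "\<And>k. Suc N \<le> l $ k"
      using P by (auto simp: lattice_boxes_iff)
    define s where "s k = (\<Sum>t\<in>{a $ k..<a $ k + int (l $ k)}. circle_exp (\<theta> $ k * of_int t))" for k
    have "norm (box_mean (\<lambda>x. circle_exp (\<theta> \<bullet> real_vec x)) P) = norm (\<Prod>k\<in>UNIV. s k / of_nat (l $ k))"
      unfolding box_mean_def al card_lattice_box circle_exp_inner_real_vec
      by (subst sum_prod_lattice_box) (simp add: s_def prod_dividef)
    also have "\<dots> = norm (s j / of_nat (l $ j)) * (\<Prod>k\<in>UNIV-{j}. norm (s k / of_nat (l $ k)))"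
      by (subst prod.remove[of UNIV j]) (simp_all only: norm_mult prod_norm finite UNIV_I)
    also have "\<dots> \<le> (C / of_nat (l $ j)) * 1"
    proof (intro mult_mono prod_le_1 conjI)
      show "norm (s j / of_nat (l $ j)) \<le> C / of_nat (l $ j)"
        unfolding norm_divide norm_of_nat s_def C_def
        by (intro divide_right_mono sum_circle_exp_interval assms) simp
      fix k
      have "norm (s k) \<le> of_nat (card {a $ k..<a $ k + int (l $ k)}) * 1"
        unfolding s_def by (rule sum_norm_bound) simp
      then show "norm (s k / of_nat (l $ k)) \<le> 1"
        by (simp add: norm_divide divide_le_eq)
    qed (use C in \<open>auto intro: prod_nonneg\<close>)
    also have "\<dots> \<le> C / real (Suc N)"
      using al(2)[of j] C by (auto intro!: divide_left_mono simp del: of_nat_Suc)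
    also have "\<dots> < e"
    proof -
      have "C < e * real N" using N e by (simp add: field_simps)
      also have "\<dots> \<le> e * real (Suc N)" using e by simp
      finally show ?thesis by (simp add: field_simps)
    qed
    finally show ?thesis .
  qed
  then show "\<forall>\<^sub>F P in box_filter. dist (box_mean (\<lambda>x. circle_exp (\<theta> \<bullet> real_vec x)) P) 0 < e"
    unfolding eventually_box_filter by (intro exI[of _ "Suc N"]) auto
qed

text \<open>If all coordinates were integers \<open>z j\<close>, the coefficients \<open>- z\<close>
  on the identity rows and \<open>g\<close> on the rows of \<open>\<Lambda>\<close> would form a
  rational relation. This supplies the hypothesis of \<open>box_mean_character\<close> for every
  nontrivial integer combination of rows.\<close>

lemma nonresonant_imp_non_integer:
  fixes \<Lambda> :: "'i \<Rightarrow> real ^ 'n" and g :: "'i \<Rightarrow> int"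
  assumes "finite I" "nonresonant I \<Lambda>" "i \<in> I" "g i \<noteq> 0"
  shows "\<exists>j. (\<Sum>i\<in>I. of_int (g i) *\<^sub>R \<Lambda> i) $ j \<notin> \<int>"
proof (rule ccontr)
  let ?v = "\<Sum>i\<in>I. of_int (g i) *\<^sub>R \<Lambda> i"
  assume "\<not> ?thesis"
  then have "\<forall>j. \<exists>z::int. ?v $ j = of_int z" by (auto elim!: Ints_cases)
  then obtain z :: "'n \<Rightarrow> int" where z: "\<And>j. ?v $ j = of_int (z j)" by metis
  define q :: "'n + 'i \<Rightarrow> rat" where "q = case_sum (\<lambda>j. - of_int (z j)) (\<lambda>i. of_int (g i))"
  have *: "(\<Sum>j\<in>UNIV. of_int (z j) *\<^sub>R row j (mat 1 :: real ^ 'n ^ 'n)) = ?v"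
    by (simp add: vec_eq_iff row_def mat_def z[symmetric] if_distrib sum.delta cong: if_cong)
  have "(\<Sum>k\<in>UNIV <+> I. of_rat (q k) *\<^sub>R case_sum (\<lambda>j. row j (mat 1)) \<Lambda> k)
      = (\<Sum>j\<in>UNIV. - (of_int (z j) *\<^sub>R row j (mat 1 :: real ^ 'n ^ 'n))) + ?v"
    using assms(1) by (subst sum.Plus) (auto simp: q_def of_rat_minus)
  also have "\<dots> = 0"
    by (subst sum_negf) (simp only: *, simp)
  finally have "\<forall>k\<in>UNIV <+> I. q k = 0"
    using assms(2) unfolding nonresonant_def rat_independent_def by blast
  then have "q (Inr i) = 0" using assms(3) by blast
  then show False using assms(4) by (simp add: q_def)
qed

section \<open>Equidistribution of continuous functions\<close>

text \<open>The integral against normalised arc length, pulled back to one period of the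
  line.\<close>

definition circle_integral :: "(complex \<Rightarrow> 'a) \<Rightarrow> 'a::real_normed_vector" where
  "circle_integral f = integral {0..1} (\<lambda>t. f (circle_exp t))"

lemma continuous_on_circle_comp:
  "continuous_on (sphere 0 1) f \<Longrightarrow> continuous_on A (\<lambda>t. f (circle_exp t))"
  by (rule continuous_on_compose2[of "sphere 0 1" f]) (auto intro!: continuous_intros)

lemma circle_integrable:
  fixes f :: "complex \<Rightarrow> 'a::banach"
  shows "continuous_on (sphere 0 1) f \<Longrightarrow> (\<lambda>t. f (circle_exp t)) integrable_on {0..1}"
  by (intro integrable_continuous_interval continuous_on_circle_comp)

lemma circle_integral_powi:
  "circle_integral (\<lambda>z. z powi m) = (if m = 0 then 1 else 0)"
proof (cases "m = 0")
  case False
  define c :: complex where "c = 2 * pi * \<i> * of_int m"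
  have c: "c \<noteq> 0" using False by (simp add: c_def)
  have 1: "((\<lambda>t. exp (c * of_real t) / c) has_vector_derivative exp (c * of_real t)) (at t within {0..1})" for t
    unfolding has_real_derivative_iff_has_vector_derivative[symmetric]
    using c by (auto intro!: derivative_eq_intros has_vector_derivative_real_field simp: field_simps)
  have "((\<lambda>t. exp (c * of_real t)) has_integral (exp (c * of_real 1) / c - exp (c * of_real 0) / c)) {0..1}"
    by (rule fundamental_theorem_of_calculus) (use 1 in auto)
  moreover have "exp (c * of_real 1) = 1"
    by (auto simp: c_def exp_eq_1)
  moreover have "circle_exp t powi m = exp (c * of_real t)" for t
    unfolding circle_exp_powi by (simp add: circle_exp_def cis_conv_exp c_def mult_ac)
  ultimately show ?thesis
    using False by (simp add: circle_integral_def integral_unique)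
qed (simp add: circle_integral_def)

section \<open>Trigonometric polynomials and their density\<close>

inductive trig_poly :: "(complex \<Rightarrow> complex) \<Rightarrow> bool" where
  monom: "trig_poly (\<lambda>z. c * z powi m)"
| add: "trig_poly f \<Longrightarrow> trig_poly g \<Longrightarrow> trig_poly (\<lambda>z. f z + g z)"

text \<open>Agreement is claimed on the circle only, since exponents of \<open>powi\<close> need not
  add at \<open>z = 0\<close>.\<close>

lemma trig_poly_monom_mult:
  assumes "trig_poly g"
  shows "\<exists>h. trig_poly h \<and> (\<forall>z\<in>sphere 0 1. h z = c * z powi m * g z)"
  using assms
proof induction
  case (monom c' m')
  show ?case
    by (intro exI[of _ "\<lambda>z. c * c' * z powi (m + m')"] conjI trig_poly.monom ballI)
      (subst power_int_add, auto)
next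
  case (add f g)
  then obtain h k where "trig_poly h" "trig_poly k" 
    "\<forall>z\<in>sphere 0 1. h z = c * z powi m * f z" "\<forall>z\<in>sphere 0 1. k z = c * z powi m * g z" by blast
  then show ?case
    by (intro exI[of _ "\<lambda>z. h z + k z"] conjI trig_poly.add) (auto simp: distrib_left)
qed

lemma trig_poly_mult:
  assumes "trig_poly f" "trig_poly g"
  shows "\<exists>h. trig_poly h \<and> (\<forall>z\<in>sphere 0 1. h z = f z * g z)"
  using assms
proof induction
  case (monom c m)
  then show ?case by (rule trig_poly_monom_mult)
next
  case (add f1 f2)
  then obtain h k where "trig_poly h" "trig_poly k" 
    "\<forall>z\<in>sphere 0 1. h z = f1 z * g z" "\<forall>z\<in>sphere 0 1. k z = f2 z * g z" by blast
  then show ?case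
    by (intro exI[of _ "\<lambda>z. h z + k z"] conjI trig_poly.add) (auto simp: distrib_right)
qed

text \<open>On the circle the conjugate of \<open>z\<close> is \<open>z powi (-1)\<close>, so real
  and imaginary parts are Laurent polynomials. This makes the real Stone-Weierstrass theorem
  applicable to trigonometric polynomials.\<close>

lemma real_polynomial_trig_poly:
  fixes p :: "complex \<Rightarrow> real"
  assumes "real_polynomial_function p"
  shows "\<exists>h. trig_poly h \<and> (\<forall>z\<in>sphere 0 1. h z = of_real (p z))"
  using assms
proof induction
  case (linear f)
  define a b where "a = f 1" and "b = f \<i>"
  have f: "f z = a * Re z + b * Im z" for z
  proof -
    interpret bounded_linear f by fact
    have "f z = f (Re z *\<^sub>R 1 + Im z *\<^sub>R \<i>)"
      by (rule arg_cong[of _ _ f]) (simp add: complex_eq_iff)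
    also have "\<dots> = a * Re z + b * Im z" by (simp only: add scaleR a_def b_def) simp
    finally show ?thesis .
  qed
  \<comment> \<open>Obtained from \<open>a * Re z + b * Im z\<close> by writing \<open>Re z\<close>
    and \<open>Im z\<close> through \<open>z\<close> and its conjugate.\<close>
  let ?h = "\<lambda>z. ((of_real a - \<i> * of_real b) / 2) * z powi 1 + ((of_real a + \<i> * of_real b) / 2) * z powi (-1)"
  have "?h z = of_real (f z)" if z: "z \<in> sphere 0 1" for z
  proof -
    have "z * cnj z = 1"
      using z by (simp add: complex_mult_cnj flip: cmod_power2)
    then have "z powi (-1) = cnj z"
      by (simp add: power_int_minus inverse_unique)
    then show ?thesis by (simp add: f complex_eq_iff algebra_simps add_divide_distrib diff_divide_distrib)
  qed
  then show ?case
    by (intro exI[of _ ?h] conjI trig_poly.add trig_poly.monom) blast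
next
  case (const c)
  show ?case
    using trig_poly.monom[of "of_real c" 0] by auto
next
  case (add f g)
  then obtain h k where "trig_poly h" "trig_poly k" 
    "\<forall>z\<in>sphere 0 1. h z = of_real (f z)" "\<forall>z\<in>sphere 0 1. k z = of_real (g z)" by blast
  then show ?case
    by (intro exI[of _ "\<lambda>z. h z + k z"] conjI trig_poly.add) auto
next
  case (mult f g)
  then obtain h k where "trig_poly h" "trig_poly k" and
    *: "\<forall>z\<in>sphere 0 1. h z = of_real (f z)" "\<forall>z\<in>sphere 0 1. k z = of_real (g z)" by blast
  then obtain l where "trig_poly l" "\<forall>z\<in>sphere 0 1. l z = h z * k z"
    using trig_poly_mult by blast
  then show ?case using * by (intro exI[of _ l]) auto
qed

lemma trig_poly_dense:
  fixes f :: "complex \<Rightarrow> real"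
  assumes "continuous_on (sphere 0 1) f" "e > 0"
  shows "\<exists>h. trig_poly h \<and> (\<forall>z\<in>sphere 0 1. norm (of_real (f z) - h z) < e)"
proof -
  obtain p where p: "real_polynomial_function p" "\<And>z. z \<in> sphere 0 1 \<Longrightarrow> \<bar>f z - p z\<bar> < e"
    by (rule Stone_Weierstrass_real_polynomial_function[OF _ assms]) auto
  obtain h where h: "trig_poly h" "\<forall>z\<in>sphere 0 1. h z = of_real (p z)"
    using real_polynomial_trig_poly[OF p(1)] by blast
  have "norm (of_real (f z) - h z) < e" if "z \<in> sphere 0 1" for z
    using h(2) p(2)[OF that] that by (metis norm_of_real of_real_diff)
  then show ?thesis using h(1) by blast
qed

lemma trig_poly_continuous: "trig_poly f \<Longrightarrow> continuous_on (sphere 0 1) f"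
proof (induction rule: trig_poly.induct)
  case (monom c m)
  then show ?case by (intro continuous_intros) auto
qed (rule continuous_on_add)

text \<open>\<open>J\<close> marks the factors that are arbitrary continuous functions, while the
  others are still powers of \<open>z\<close>. Induction on \<open>J\<close> exchanges one factor at
  a time, so approximation on the circle is enough and none on the torus is required.\<close>

lemma weyl_product_aux:
  fixes \<Lambda> :: "'i \<Rightarrow> real ^ 'n" and f :: "'i \<Rightarrow> complex \<Rightarrow> complex"
  assumes I: "finite I" and nr: "nonresonant I \<Lambda>"
  assumes "finite J" "J \<subseteq> I"
    and "\<And>i. i \<in> J \<Longrightarrow> \<exists>g::complex \<Rightarrow> real. continuous_on (sphere 0 1) g \<and> f i = (\<lambda>z. of_real (g z))"
    and "\<And>i. i \<in> I - J \<Longrightarrow> \<exists>m::int. f i = (\<lambda>z. z powi m)"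
  shows "(box_mean (\<lambda>x. \<Prod>i\<in>I. f i (circle_exp (\<Lambda> i \<bullet> real_vec x)))
    \<longlongrightarrow> (\<Prod>i\<in>I. circle_integral (f i))) box_filter"
  using assms(3-)
proof (induction J arbitrary: f)
  case empty
  then have "\<forall>i\<in>I. \<exists>m::int. f i = (\<lambda>z. z powi m)" by simp
  then obtain g :: "'i \<Rightarrow> int" where g: "\<And>i. i \<in> I \<Longrightarrow> f i = (\<lambda>z. z powi g i)" by metis
  have "(\<Prod>i\<in>I. circle_exp (\<Lambda> i \<bullet> v) powi g i) = circle_exp ((\<Sum>i\<in>I. of_int (g i) *\<^sub>R \<Lambda> i) \<bullet> v)" for v
    using I by induction (auto simp: circle_exp_powi circle_exp_add inner_add_left)
  then have eq: "(\<Prod>i\<in>I. f i (circle_exp (\<Lambda> i \<bullet> v))) = circle_exp ((\<Sum>i\<in>I. of_int (g i) *\<^sub>R \<Lambda> i) \<bullet> v)" for v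
    using g by simp
  show ?case
  \<comment> \<open>The product of characters is a single character. The trivial one has mean 1 on
    nonempty boxes; any other has a nonintegral coordinate by nonresonance, so its mean tends to 0,
    as does the product of integrals because of a factor with \<open>g i \<noteq> 0\<close>.\<close>
  proof (cases "\<forall>i\<in>I. g i = 0")
    case True
    then have 1: "(\<Prod>i\<in>I. circle_integral (f i)) = 1"
      using circle_integral_powi[of 0] by (intro prod.neutral) (simp add: g)
    have 2: "eventually (\<lambda>P. 1 = box_mean (\<lambda>x. \<Prod>i\<in>I. f i (circle_exp (\<Lambda> i \<bullet> real_vec x))) P) box_filter"
      using eventually_box_card_pos by (rule eventually_mono) (use True in \<open>auto simp: eq box_mean_def\<close>)
    show ?thesis unfolding 1 by (rule Lim_transform_eventually[OF tendsto_const 2])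
  next
    case False
    then obtain i where i: "i \<in> I" "g i \<noteq> 0" by blast
    then have "circle_integral (f i) = 0" by (simp add: g circle_integral_powi)
    with i have 0: "(\<Prod>i\<in>I. circle_integral (f i)) = 0"
      by (intro prod_zero[OF I] bexI[of _ i])
    obtain j where "(\<Sum>i\<in>I. of_int (g i) *\<^sub>R \<Lambda> i) $ j \<notin> \<int>"
      using nonresonant_imp_non_integer[OF I nr i(1), of g] i(2) by blast
    then show ?thesis unfolding 0 eq by (rule box_mean_character)
  qed
next
  case (insert j J)
  have j: "j \<in> I" using insert.prems(1) by simp
  define F where "F x = (\<Prod>i\<in>I - {j}. f i (circle_exp (\<Lambda> i \<bullet> real_vec x)))" for x
  define C where "C = (\<Prod>i\<in>I - {j}. circle_integral (f i))"
  \<comment> \<open>The claim with the factor \<open>j\<close> replaced by \<open>h\<close>. It is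
    linear in \<open>h\<close>, so it extends from powers of \<open>z\<close> to
    \<open>trig_poly\<close>, and uniform approximation then reaches \<open>f j\<close>.\<close>
  define Q where "Q h \<longleftrightarrow> (box_mean (\<lambda>x. h (circle_exp (\<Lambda> j \<bullet> real_vec x)) * F x)
    \<longlongrightarrow> circle_integral h * C) box_filter" for h
  have Q_upd: "Q h \<longleftrightarrow> (box_mean (\<lambda>x. \<Prod>i\<in>I. (f(j := h)) i (circle_exp (\<Lambda> i \<bullet> real_vec x)))
    \<longlongrightarrow> (\<Prod>i\<in>I. circle_integral ((f(j := h)) i))) box_filter" for h
    unfolding Q_def F_def C_def by (simp add: prod.remove[OF I j])
  have Q_powi: "Q (\<lambda>z. z powi m)" for m
    unfolding Q_upd
  proof (rule insert.IH)
    fix i assume "i \<in> J"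
    then show "\<exists>g::complex \<Rightarrow> real. continuous_on (sphere 0 1) g \<and> (f(j := \<lambda>z. z powi m)) i = (\<lambda>z. of_real (g z))"
      using insert.prems(2)[of i] insert.hyps by auto
  next
    fix i assume "i \<in> I - J"
    then show "\<exists>m'. (f(j := \<lambda>z. z powi m)) i = (\<lambda>z. z powi m')"
      using insert.prems(3)[of i] by auto
  qed (use insert.prems(1) in auto)
  have Q_trig: "Q h" if "trig_poly h" for h
    using that
  proof induction
    case (monom c m)
    show ?case
      using tendsto_mult_left[OF Q_powi[of m, unfolded Q_def], of c]
      unfolding Q_def box_mean_cmult[symmetric] by (simp add: circle_integral_def mult.assoc)
  next
    case (add h k)
    have "circle_integral (\<lambda>z. h z + k z) = circle_integral h + circle_integral k"
      unfolding circle_integral_def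
      by (intro integral_add circle_integrable trig_poly_continuous add.hyps)
    then show ?case
      using tendsto_add[OF add.IH[unfolded Q_def]]
      unfolding Q_def box_mean_add[symmetric] by (simp add: distrib_right)
  qed
  obtain g :: "complex \<Rightarrow> real" where g: "continuous_on (sphere 0 1) g" "f j = (\<lambda>z. of_real (g z))"
    using insert.prems(2)[of j] by blast
  have "\<exists>b. \<forall>z\<in>sphere 0 1. norm (f i z) \<le> b" if i: "i \<in> I - {j}" for i
  proof (cases "i \<in> J")
    case True
    then obtain g :: "complex \<Rightarrow> real" where g: "continuous_on (sphere 0 1) g" "f i = (\<lambda>z. of_real (g z))"
      using insert.prems(2)[of i] by blast
    have "bounded (g ` sphere 0 1)"
      by (intro compact_imp_bounded compact_continuous_image g) auto
    then show ?thesis by (auto simp: bounded_iff g)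
  next
    case False
    then obtain m where "f i = (\<lambda>z. z powi m)" using insert.prems(3)[of i] i False by blast
    then show ?thesis by (intro exI[of _ 1]) (auto simp: norm_power_int)
  qed
  then have "\<forall>i\<in>I - {j}. \<exists>b. \<forall>z\<in>sphere 0 1. norm (f i z) \<le> b" by blast
  then obtain b where b: "\<forall>i\<in>I - {j}. \<forall>z\<in>sphere 0 1. norm (f i z) \<le> b i"
    by (rule bchoice[THEN exE])
  \<comment> \<open>A common bound for \<open>F\<close> and \<open>C\<close>; the summand 1 makes it
    positive, so that it may be divided by in \<open>d\<close>.\<close>
  define B where "B = 1 + \<bar>\<Prod>i\<in>I - {j}. b i\<bar> + norm C"
  have B: "norm (F x) \<le> B" "norm C \<le> B" "B > 0" for x
  proof -
    have "norm (F x) \<le> (\<Prod>i\<in>I - {j}. b i)"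
      unfolding F_def prod_norm[symmetric] by (intro prod_mono) (use b in auto)
    then show "norm (F x) \<le> B" using norm_ge_zero[of C] unfolding B_def by linarith
    show "norm C \<le> B" by (simp add: B_def)
    show "B > 0" using norm_ge_zero[of C] unfolding B_def by linarith
  qed
  have "Q (f j)"
    unfolding Q_def
  proof (rule tendstoI)
    fix e :: real assume e: "e > 0"
    \<comment> \<open>Three errors of at most \<open>e / 3\<close>: replacing \<open>f j\<close> by
      \<open>h\<close> in the mean, replacing it in the integral, and the convergence for
      \<open>h\<close>.\<close>
    define d where "d = e / (3 * B)"
    have d: "d > 0" "d * B = e / 3" using e B by (auto simp: d_def)
    obtain h where h: "trig_poly h" "\<And>z. z \<in> sphere 0 1 \<Longrightarrow> norm (f j z - h z) < d"
      using trig_poly_dense[OF g(1) d(1)] g(2) by auto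
    have cont: "continuous_on (sphere 0 1) (f j)"
      unfolding g(2) by (intro continuous_intros g)
    have "norm (circle_integral (f j) - circle_integral h) = norm (integral {0..1} (\<lambda>t. f j (circle_exp t) - h (circle_exp t)))"
      unfolding circle_integral_def by (subst integral_diff) (use cont h in \<open>auto intro: circle_integrable trig_poly_continuous\<close>)
    also have "\<dots> \<le> d * (1 - 0)"
    proof (rule integral_bound)
      show "continuous_on {0..1} (\<lambda>t. f j (circle_exp t) - h (circle_exp t))"
        by (intro continuous_on_diff continuous_on_circle_comp cont trig_poly_continuous[OF h(1)])
      show "norm (f j (circle_exp t) - h (circle_exp t)) \<le> d" for t
        by (rule less_imp_le[OF h(2)]) simp
    qed simp
    finally have "norm (circle_integral (f j) - circle_integral h) \<le> d" by simp
    then have "norm (circle_integral (f j) - circle_integral h) * norm C \<le> d * B"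
      by (rule mult_mono[OF _ B(2)]) (use d(1) in simp_all)
    then have *: "norm (circle_integral (f j) * C - circle_integral h * C) \<le> e / 3"
      unfolding left_diff_distrib[symmetric] norm_mult d(2) .
    have **: "norm (box_mean (\<lambda>x. f j (circle_exp (\<Lambda> j \<bullet> real_vec x)) * F x) P
        - box_mean (\<lambda>x. h (circle_exp (\<Lambda> j \<bullet> real_vec x)) * F x) P) \<le> e / 3" for P
      unfolding box_mean_diff[symmetric] left_diff_distrib[symmetric]
    proof (rule norm_box_mean_le)
      fix x
      show "norm ((f j (circle_exp (\<Lambda> j \<bullet> real_vec x)) - h (circle_exp (\<Lambda> j \<bullet> real_vec x))) * F x) \<le> e / 3"
        unfolding norm_mult d(2)[symmetric] by (intro mult_mono less_imp_le[OF h(2)] B) (use d in auto)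
    qed (use e in auto)
    have three: "dist u c < e" if "dist v c' < e / 3" "norm (c - c') \<le> e / 3" "norm (u - v) \<le> e / 3"
      for u v c c' :: complex
      using that dist_triangle[of u c v] dist_triangle[of v c c']
      by (simp add: dist_norm norm_minus_commute)
    have "\<forall>\<^sub>F P in box_filter. dist (box_mean (\<lambda>x. h (circle_exp (\<Lambda> j \<bullet> real_vec x)) * F x) P) (circle_integral h * C) < e / 3"
      by (rule tendstoD[OF Q_trig[OF h(1), unfolded Q_def]]) (use e in auto)
    then show "\<forall>\<^sub>F P in box_filter. dist (box_mean (\<lambda>x. f j (circle_exp (\<Lambda> j \<bullet> real_vec x)) * F x) P) (circle_integral (f j) * C) < e"
    proof (rule eventually_mono)
      fix P
      assume "dist (box_mean (\<lambda>x. h (circle_exp (\<Lambda> j \<bullet> real_vec x)) * F x) P) (circle_integral h * C) < e / 3"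
      then show "dist (box_mean (\<lambda>x. f j (circle_exp (\<Lambda> j \<bullet> real_vec x)) * F x) P) (circle_integral (f j) * C) < e"
        by (rule three[OF _ * **])
    qed
  qed
  then show ?case unfolding Q_upd fun_upd_triv .
qed

lemma weyl_product:
  fixes \<Lambda> :: "'i \<Rightarrow> real ^ 'n" and f :: "'i \<Rightarrow> complex \<Rightarrow> real"
  assumes I: "finite I" and nr: "nonresonant I \<Lambda>"
    and f: "\<And>i. i \<in> I \<Longrightarrow> continuous_on (sphere 0 1) (f i)"
  shows "((\<lambda>P. (\<Sum>x\<in>P. \<Prod>i\<in>I. f i (circle_exp (\<Lambda> i \<bullet> real_vec x))) / real (card P))
    \<longlongrightarrow> (\<Prod>i\<in>I. circle_integral (f i))) box_filter"
proof -
  have int: "circle_integral (\<lambda>z. complex_of_real (f i z)) = of_real (circle_integral (f i))" if "i \<in> I" for i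
    unfolding circle_integral_def
    by (rule integral_unique has_integral_of_real integrable_integral circle_integrable f that)+
  have "(box_mean (\<lambda>x. \<Prod>i\<in>I. complex_of_real (f i (circle_exp (\<Lambda> i \<bullet> real_vec x))))
    \<longlongrightarrow> (\<Prod>i\<in>I. circle_integral (\<lambda>z. complex_of_real (f i z)))) box_filter"
    by (rule weyl_product_aux[OF I nr I, of "\<lambda>i z. of_real (f i z)"]) (use f in auto)
  also have "(\<Prod>i\<in>I. circle_integral (\<lambda>z. complex_of_real (f i z))) = of_real (\<Prod>i\<in>I. circle_integral (f i))"
    using int by simp
  also have "box_mean (\<lambda>x. \<Prod>i\<in>I. complex_of_real (f i (circle_exp (\<Lambda> i \<bullet> real_vec x))))
      = (\<lambda>P. complex_of_real ((\<Sum>x\<in>P. \<Prod>i\<in>I. f i (circle_exp (\<Lambda> i \<bullet> real_vec x))) / real (card P)))"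
    by (rule ext) (simp add: box_mean_def)
  finally show ?thesis by (simp only: tendsto_of_real_iff)
qed

section \<open>Jordan sets on the circle\<close>

text \<open>The intersection of the two closures is the boundary relative to the circle. Nullity is
  demanded of its periodic preimage in the line, so no measure on the circle has to be
  constructed.\<close>

definition circle_jordan :: "complex set \<Rightarrow> bool" where
  "circle_jordan E \<longleftrightarrow>
     E \<subseteq> sphere 0 1 \<and> negligible {t. circle_exp t \<in> closure E \<inter> closure (sphere 0 1 - E)}"

definition circle_measure :: "complex set \<Rightarrow> real" where
  "circle_measure E = circle_integral (indicat_real E)"

lemma circle_jordan_sphere: "circle_jordan (sphere 0 1)"
  by (simp add: circle_jordan_def)

lemma circle_jordan_compl: "circle_jordan E \<Longrightarrow> circle_jordan (sphere 0 1 - E)"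
  by (auto simp: circle_jordan_def double_diff Int_commute)

lemma circle_jordan_Int:
  assumes "circle_jordan E" "circle_jordan F"
  shows "circle_jordan (E \<inter> F)"
proof -
  have "closure (sphere 0 1 - E \<inter> F) = closure (sphere 0 1 - E) \<union> closure (sphere 0 1 - F)"
    by (simp add: Diff_Int closure_Un)
  moreover have "closure (E \<inter> F) \<subseteq> closure E" "closure (E \<inter> F) \<subseteq> closure F"
    by (simp_all add: closure_mono)
  ultimately have "{t. circle_exp t \<in> closure (E \<inter> F) \<inter> closure (sphere 0 1 - E \<inter> F)} \<subseteq>
      {t. circle_exp t \<in> closure E \<inter> closure (sphere 0 1 - E)} \<union>
      {t. circle_exp t \<in> closure F \<inter> closure (sphere 0 1 - F)}"
    by blast
  then show ?thesis
    using assms unfolding circle_jordan_def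
    by (meson Int_lower1 negligible_Un negligible_subset order_trans)
qed

text \<open>The functions \<open>g n\<close> equal 1 on \<open>E\<close> and drop to 0 ever more
  steeply with the distance from it. Off the null set \<open>N\<close> they converge to the
  indicator, and dominated convergence yields both its integrability and the limit of the
  integrals.\<close>

lemma circle_upper_approx:
  assumes "circle_jordan E"
  obtains g :: "nat \<Rightarrow> complex \<Rightarrow> real"
  where "\<And>n. continuous_on (sphere 0 1) (g n)"
    "\<And>n z. indicat_real E z \<le> g n z" "\<And>n z. g n z \<le> 1"
    "(\<lambda>t. indicat_real E (circle_exp t)) integrable_on {0..1}"
    "(\<lambda>n. circle_integral (g n)) \<longlonglongrightarrow> circle_measure E"
\<comment> \<open>\<open>infdist\<close> to the empty set is 0, so the functions used below would be
  constantly 1 there.\<close>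
proof (cases "E = {}")
  case True
  then show thesis
    by (intro that[of "\<lambda>_ _. 0"]) (auto simp: circle_measure_def circle_integral_def)
next
  case False
  define g where "g n z = 1 - min 1 (real n * infdist z E)" for n z
  define N where "N = {t. circle_exp t \<in> closure E \<inter> closure (sphere 0 1 - E)}"
  have N: "negligible N" using assms by (simp add: N_def circle_jordan_def)
  have cont: "continuous_on A (g n)" for A n
    unfolding g_def by (intro continuous_intros)
  have g01: "0 \<le> g n z" "g n z \<le> 1" for n z
    by (auto simp: g_def infdist_nonneg)
  have gE: "indicat_real E z \<le> g n z" for n z
    using g01[of n z] by (auto simp: indicator_def) (simp add: g_def)
  have lim: "(\<lambda>n. g n (circle_exp t)) \<longlonglongrightarrow> indicat_real E (circle_exp t)" if "t \<notin> N" for t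
  proof (cases "circle_exp t \<in> E")
    case True
    then show ?thesis by (simp add: g_def)
  next
    case nE: False
    then have "circle_exp t \<in> closure (sphere 0 1 - E)"
      using closure_subset[of "sphere 0 1 - E"] by auto
    then have "circle_exp t \<notin> closure E" using that by (simp add: N_def)
    then have pos: "infdist (circle_exp t) E > 0"
      using False infdist_nonneg[of "circle_exp t" E] in_closure_iff_infdist_zero[OF False, of "circle_exp t"] by simp
    obtain n0 :: nat where n0: "1 / infdist (circle_exp t) E < n0" using reals_Archimedean2 by blast
    have "g n (circle_exp t) = 0" if "n \<ge> n0" for n
    proof -
      have "1 / infdist (circle_exp t) E \<le> n" using n0 that by simp
      then have "1 \<le> n * infdist (circle_exp t) E" using pos by (simp add: divide_le_eq)
      then show ?thesis by (simp add: g_def)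
    qed
    then show ?thesis
      using nE by (intro tendsto_eventually) (auto simp: eventually_sequentially intro!: exI[of _ n0])
  qed
  have int_g: "(\<lambda>t. g n (circle_exp t)) integrable_on ({0..1} - N)" for n
  proof -
    have "(\<lambda>t. g n (circle_exp t)) integrable_on {0..1}" by (rule circle_integrable[OF cont])
    then show ?thesis
      by (rule integrable_spike_set) (auto intro: negligible_subset[OF N])
  qed
  have dom: "(\<lambda>t. indicat_real E (circle_exp t)) integrable_on ({0..1} - N)"
    "(\<lambda>n. integral ({0..1} - N) (\<lambda>t. g n (circle_exp t)))
      \<longlonglongrightarrow> integral ({0..1} - N) (\<lambda>t. indicat_real E (circle_exp t))"
  proof -
    have one: "(\<lambda>t. 1::real) integrable_on ({0..1} - N)"
      by (rule integrable_spike_set[of _ "{0..1}"]) (auto intro: negligible_subset[OF N])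
    have bd: "\<And>n t. t \<in> {0..1} - N \<Longrightarrow> norm (g n (circle_exp t)) \<le> 1"
      using g01 by simp
    have l: "\<And>t. t \<in> {0..1} - N \<Longrightarrow> (\<lambda>n. g n (circle_exp t)) \<longlonglongrightarrow> indicat_real E (circle_exp t)"
      using lim by simp
    show "(\<lambda>t. indicat_real E (circle_exp t)) integrable_on ({0..1} - N)"
      "(\<lambda>n. integral ({0..1} - N) (\<lambda>t. g n (circle_exp t)))
        \<longlonglongrightarrow> integral ({0..1} - N) (\<lambda>t. indicat_real E (circle_exp t))"
      using dominated_convergence[of "\<lambda>n t. g n (circle_exp t)" "{0..1} - N", OF int_g one bd l] by blast+
  qed
  have spike: "integral ({0..1} - N) h = integral {0..1} h" for h :: "real \<Rightarrow> real"
    by (rule integral_spike_set) (auto intro: negligible_subset[OF N])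
  show thesis
  proof (rule that[of g])
    show "(\<lambda>t. indicat_real E (circle_exp t)) integrable_on {0..1}"
      by (rule integrable_spike_set[OF dom(1)]) (auto intro: negligible_subset[OF N])
    show "(\<lambda>n. circle_integral (g n)) \<longlonglongrightarrow> circle_measure E"
      using dom(2) by (simp add: circle_integral_def circle_measure_def spike)
  qed (use cont gE g01 in auto)
qed

text \<open>Upper approximants of the complement, subtracted from 1.\<close>

lemma circle_lower_approx:
  assumes "circle_jordan E"
  obtains g :: "nat \<Rightarrow> complex \<Rightarrow> real"
  where "\<And>n. continuous_on (sphere 0 1) (g n)" "\<And>n z. 0 \<le> g n z"
    "\<And>n z. z \<in> sphere 0 1 \<Longrightarrow> g n z \<le> indicat_real E z"
    "(\<lambda>n. circle_integral (g n)) \<longlonglongrightarrow> circle_measure E"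
proof -
  obtain h :: "nat \<Rightarrow> complex \<Rightarrow> real" where h: "\<And>n. continuous_on (sphere 0 1) (h n)"
    "\<And>n z. indicat_real (sphere 0 1 - E) z \<le> h n z" "\<And>n z. h n z \<le> 1"
    "(\<lambda>t. indicat_real (sphere 0 1 - E) (circle_exp t)) integrable_on {0..1}"
    "(\<lambda>n. circle_integral (h n)) \<longlonglongrightarrow> circle_measure (sphere 0 1 - E)"
    by (rule circle_upper_approx[OF circle_jordan_compl[OF assms]]) blast
  have 1: "circle_integral (\<lambda>z. 1 - h n z) = 1 - circle_integral (h n)" for n
    unfolding circle_integral_def by (subst integral_diff) (auto intro: circle_integrable h)
  have "indicat_real E (circle_exp t) = 1 - indicat_real (sphere 0 1 - E) (circle_exp t)" for t
    by (simp add: indicator_def)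
  then have 2: "circle_measure E = 1 - circle_measure (sphere 0 1 - E)"
    unfolding circle_measure_def circle_integral_def using h(4) by (simp only: integral_diff[OF _ h(4)]) (subst integral_diff, auto)
  show thesis
  proof (rule that[of "\<lambda>n z. 1 - h n z"])
    show "(\<lambda>n. circle_integral (\<lambda>z. 1 - h n z)) \<longlonglongrightarrow> circle_measure E"
      unfolding 1 2 by (intro tendsto_intros h)
    fix n z assume "z \<in> sphere (0::complex) 1"
    then show "1 - h n z \<le> indicat_real E z"
      using h(2)[of z n] h(3)[of n z] by (auto simp: indicator_def split: if_splits)
  qed (use h in \<open>auto intro!: continuous_intros\<close>)
qed

section \<open>Arcs\<close>

text \<open>Half-open, so that the arcs of a grid are disjoint and a floor recovers their
  index.\<close>

definition circle_arc :: "real \<Rightarrow> real \<Rightarrow> complex set" where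
  "circle_arc a l = circle_exp ` {a..<a + l}"

lemma circle_arc_iff:
  "circle_exp t \<in> circle_arc a l \<longleftrightarrow> (\<exists>z::int. a \<le> t - of_int z \<and> t - of_int z < a + l)"
proof
  assume "circle_exp t \<in> circle_arc a l"
  then obtain s where s: "a \<le> s" "s < a + l" "circle_exp t = circle_exp s"
    by (auto simp: circle_arc_def)
  then obtain z :: int where "t - s = of_int z" by (auto simp: circle_exp_eq_iff elim: Ints_cases)
  then show "\<exists>z::int. a \<le> t - of_int z \<and> t - of_int z < a + l"
    using s by (intro exI[of _ z]) auto
next
  assume "\<exists>z::int. a \<le> t - of_int z \<and> t - of_int z < a + l"
  then obtain z :: int where z: "a \<le> t - of_int z" "t - of_int z < a + l" by blast
  have "circle_exp t = circle_exp (t - of_int z)" by (simp add: circle_exp_eq_iff)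
  then show "circle_exp t \<in> circle_arc a l"
    unfolding circle_arc_def using z by (intro image_eqI[of _ _ "t - of_int z"]) auto
qed

lemma circle_arc_shift: "circle_arc (a + of_int m) l = circle_arc a l"
proof -
  have imp: "circle_exp t \<in> circle_arc (a + of_int m) l" if t: "circle_exp t \<in> circle_arc a l"
    for t a and m :: int
  proof -
    obtain z :: int where "a \<le> t - of_int z" "t - of_int z < a + l"
      using t by (auto simp: circle_arc_iff)
    then show ?thesis unfolding circle_arc_iff by (intro exI[of _ "z - m"]) simp
  qed
  have "circle_exp t \<in> circle_arc (a + of_int m) l \<longleftrightarrow> circle_exp t \<in> circle_arc a l" for t
    using imp[of t a m] imp[of t "a + of_int m" "- m"] by auto
  moreover have "circle_arc a l \<subseteq> range circle_exp" for a by (auto simp: circle_arc_def)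
  ultimately show ?thesis by blast
qed

lemma circle_exp_range_unit_interval: "z \<in> sphere 0 1 \<Longrightarrow> \<exists>t\<in>{a..<a + 1}. z = circle_exp t"
proof -
  assume "z \<in> sphere 0 1"
  then obtain t where t: "z = circle_exp t" using surj_circle_exp by blast
  let ?t = "t - of_int \<lfloor>t - a\<rfloor>"
  have "?t \<in> {a..<a + 1}" by simp linarith
  moreover have "z = circle_exp ?t" by (simp add: t circle_exp_eq_iff)
  ultimately show ?thesis by blast
qed

text \<open>The closures of the arc and of its complement lie in the images of
  \<open>{a..a + l}\<close> and \<open>{a + l..a + 1}\<close>. These meet only in the images of the
  end points, so the boundary pulls back to a countable set.\<close>

lemma circle_jordan_arc:
  assumes "0 < l" "l \<le> 1"
  shows "circle_jordan (circle_arc a l)"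
  unfolding circle_jordan_def
proof
  show "circle_arc a l \<subseteq> sphere 0 1" by (auto simp: circle_arc_def)
  have closed: "closed (circle_exp ` {b..c})" for b c
    by (intro compact_imp_closed compact_continuous_image continuous_intros) auto
  have "sphere 0 1 - circle_arc a l \<subseteq> circle_exp ` {a + l..a + 1}"
  proof
    fix z assume z: "z \<in> sphere 0 1 - circle_arc a l"
    then obtain t where "t \<in> {a..<a + 1}" "z = circle_exp t"
      using circle_exp_range_unit_interval by blast
    then show "z \<in> circle_exp ` {a + l..a + 1}" using z by (force simp: circle_arc_def)
  qed
  then have 1: "closure (sphere 0 1 - circle_arc a l) \<subseteq> circle_exp ` {a + l..a + 1}"
    by (rule closure_minimal[OF _ closed])
  have 2: "closure (circle_arc a l) \<subseteq> circle_exp ` {a..a + l}"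
    by (rule closure_minimal[OF _ closed]) (auto simp: circle_arc_def)
  have "{t. circle_exp t \<in> closure (circle_arc a l) \<inter> closure (sphere 0 1 - circle_arc a l)}
    \<subseteq> range (\<lambda>z::int. a + of_int z) \<union> range (\<lambda>z::int. a + l + of_int z)" (is "?N \<subseteq> ?R")
  proof
    fix t assume "t \<in> ?N"
    then obtain r s where rs: "circle_exp t = circle_exp r" "circle_exp t = circle_exp s"
      "a \<le> r" "r \<le> a + l" "a + l \<le> s" "s \<le> a + 1" using 1 2 by fastforce
    have "circle_exp s = circle_exp r" using rs by simp
    then obtain z :: int where z: "s - r = of_int z" by (auto simp: circle_exp_eq_iff elim: Ints_cases)
    have "0 \<le> z" "z \<le> 1" using z rs by linarith+
    then consider "z = 0" | "z = 1" by linarith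
    then have "r = a \<or> r = a + l" using z rs by cases auto
    moreover obtain y :: int where "t - r = of_int y" using rs(1) by (auto simp: circle_exp_eq_iff elim: Ints_cases)
    then have "t = r + of_int y" by simp
    ultimately show "t \<in> ?R" by blast
  qed
  moreover have "negligible ?R"
    by (intro negligible_Un) (simp_all add: negligible_iff_null_sets countable_imp_null_set_lborel null_sets_completionI)
  ultimately show "negligible ?N" using negligible_subset by blast
qed

lemma circle_measure_arc:
  assumes "0 < l" "l \<le> 1"
  shows "circle_measure (circle_arc a l) = l"
proof -
  define b where "b = frac a"
  have b: "0 \<le> b" "b < 1" by (auto simp: b_def frac_lt_1)
  have "circle_arc a l = circle_arc b l"
    using circle_arc_shift[of b "\<lfloor>a\<rfloor>" l] by (simp add: b_def frac_def)
  moreover have "((\<lambda>t. indicat_real (circle_arc b l) (circle_exp t)) has_integral l) {0..1}"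
  proof -
    \<comment> \<open>The arc may wrap past 1: \<open>{b..m}\<close> is the part before 1 and
      \<open>{0..n}\<close> the part carried over. Without wrapping \<open>n = 0\<close>, and the
      finite exceptional set below absorbs the end points.\<close>
    define m where "m = min 1 (b + l)"
    have m: "b \<le> m" "m \<le> 1" using b assms by (auto simp: m_def)
    define n where "n = max 0 (b + l - 1)"
    have n: "0 \<le> n" "n \<le> 1" "n \<le> b" using b assms by (auto simp: n_def)
    have 1: "((\<lambda>t. if t \<in> {b..m} then 1 else 0) has_integral (m - b)) {0..1::real}"
      using has_integral_const_real[of "1::real" b m] m b by (subst has_integral_restrict) auto
    have 2: "((\<lambda>t. if t \<in> {0..n} then 1 else 0) has_integral n) {0..1::real}"
      using has_integral_const_real[of "1::real" 0 n] n by (subst has_integral_restrict) auto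
    have "((\<lambda>t. (if t \<in> {b..m} then 1 else 0) + (if t \<in> {0..n} then 1 else 0)) has_integral (m - b + n)) {0..1::real}"
      by (rule has_integral_add[OF 1 2])
    then have "((\<lambda>t. indicat_real (circle_arc b l) (circle_exp t)) has_integral (m - b + n)) {0..1}"
    proof (rule has_integral_spike_finite[of "{0, 1, b, m, n}", rotated 2])
      fix t assume t: "t \<in> {0..1} - {0, 1, b, m, n}"
      then have t01: "0 < t" "t < 1" by auto
      have *: "circle_exp t \<in> circle_arc b l \<longleftrightarrow> (b \<le> t \<and> t < b + l) \<or> t < b + l - 1"
      proof
        assume "circle_exp t \<in> circle_arc b l"
        then obtain z :: int where z: "b \<le> t - of_int z" "t - of_int z < b + l" by (auto simp: circle_arc_iff)
        then have "of_int z < (1::real)" "of_int z > (-2::real)" using t01 b assms by linarith+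
        then have "z = 0 \<or> z = -1" by linarith
        then show "(b \<le> t \<and> t < b + l) \<or> t < b + l - 1" using z by auto
      next
        assume "(b \<le> t \<and> t < b + l) \<or> t < b + l - 1"
        then show "circle_exp t \<in> circle_arc b l"
        proof
          assume "b \<le> t \<and> t < b + l"
          then show ?thesis unfolding circle_arc_iff by (intro exI[of _ 0]) auto
        next
          assume "t < b + l - 1"
          then show ?thesis unfolding circle_arc_iff using t01 b by (intro exI[of _ "-1"]) auto
        qed
      qed
      show "indicat_real (circle_arc b l) (circle_exp t) =
         (if t \<in> {b..m} then 1 else 0) + (if t \<in> {0..n} then 1 else 0)"
        unfolding indicator_def * using t t01 b n assms by (auto simp: m_def n_def min_def max_def split: if_splits)
    qed simp
    moreover have "m - b + n = l" by (auto simp: m_def n_def)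
    ultimately show ?thesis by simp
  qed
  ultimately show ?thesis
    by (simp add: circle_measure_def circle_integral_def integral_unique)
qed

section \<open>Cylinder sets\<close>

definition cylinder :: "('i \<Rightarrow> real ^ 'n) \<Rightarrow> 'i set \<Rightarrow> ('i \<Rightarrow> complex set) \<Rightarrow> (int ^ 'n) set" where
  "cylinder \<Lambda> I E = {x. \<forall>i\<in>I. circle_exp (\<Lambda> i \<bullet> real_vec x) \<in> E i}"

text \<open>The indicator of the cylinder is squeezed between products of continuous minorants and
  majorants, to which Weyl's criterion applies. Nonnegativity of the minorants makes the products
  monotone in the factors.\<close>

lemma cylinder_freq:
  fixes \<Lambda> :: "'i \<Rightarrow> real ^ 'n"
  assumes I: "finite I" and nr: "nonresonant I \<Lambda>" and E: "\<And>i. circle_jordan (E i)"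
  shows "freq_measurable (cylinder \<Lambda> I E)" "freq (cylinder \<Lambda> I E) = (\<Prod>i\<in>I. circle_measure (E i))"
proof -
  let ?C = "cylinder \<Lambda> I E"
  have ind: "(\<Prod>i\<in>I. indicat_real (E i) (circle_exp (\<Lambda> i \<bullet> real_vec x))) = indicat_real ?C x" for x
    using I by (cases "x \<in> ?C") (auto simp: cylinder_def indicator_def intro!: prod.neutral)
  have dens: "box_density ?C P = (\<Sum>x\<in>P. indicat_real ?C x) / card P" if "finite P" for P
    using that sum_indicator_eq_card[of P ?C] by (simp add: box_density_def Int_commute indicator_def)
  have "\<exists>g. (\<forall>n. continuous_on (sphere 0 1) (g n)) \<and> (\<forall>n z. indicat_real (E i) z \<le> g n z) \<and>
    (\<lambda>n. circle_integral (g n)) \<longlonglongrightarrow> circle_measure (E i)" for i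
    by (rule circle_upper_approx[OF E[of i]]) blast
  then obtain g :: "'i \<Rightarrow> nat \<Rightarrow> complex \<Rightarrow> real" where g: "\<And>i n. continuous_on (sphere 0 1) (g i n)"
    "\<And>i n z. indicat_real (E i) z \<le> g i n z"
    "\<And>i. (\<lambda>n. circle_integral (g i n)) \<longlonglongrightarrow> circle_measure (E i)"
    by metis
  have "\<exists>f. (\<forall>n. continuous_on (sphere 0 1) (f n)) \<and> (\<forall>n z. 0 \<le> f n z) \<and>
    (\<forall>n. \<forall>z\<in>sphere 0 1. f n z \<le> indicat_real (E i) z) \<and>
    (\<lambda>n. circle_integral (f n)) \<longlonglongrightarrow> circle_measure (E i)" for i
    by (rule circle_lower_approx[OF E[of i]]) blast
  then obtain f :: "'i \<Rightarrow> nat \<Rightarrow> complex \<Rightarrow> real" where f: "\<And>i n. continuous_on (sphere 0 1) (f i n)"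
    "\<And>i n z. 0 \<le> f i n z" "\<And>i n z. z \<in> sphere 0 1 \<Longrightarrow> f i n z \<le> indicat_real (E i) z"
    "\<And>i. (\<lambda>n. circle_integral (f i n)) \<longlonglongrightarrow> circle_measure (E i)"
    by metis
  have "(box_density ?C \<longlongrightarrow> (\<Prod>i\<in>I. circle_measure (E i))) box_filter"
  proof (rule order_tendstoI)
    fix a assume a: "a < (\<Prod>i\<in>I. circle_measure (E i))"
    have "(\<lambda>n. \<Prod>i\<in>I. circle_integral (f i n)) \<longlonglongrightarrow> (\<Prod>i\<in>I. circle_measure (E i))"
      by (intro tendsto_prod f)
    from order_tendstoD(1)[OF this a] obtain n where n: "a < (\<Prod>i\<in>I. circle_integral (f i n))"
      by (auto simp: eventually_sequentially)
    have "\<forall>\<^sub>F P in box_filter. a < (\<Sum>x\<in>P. \<Prod>i\<in>I. f i n (circle_exp (\<Lambda> i \<bullet> real_vec x))) / real (card P)"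
      by (rule order_tendstoD(1)[OF weyl_product[OF I nr] n]) (rule f)
    then show "\<forall>\<^sub>F P in box_filter. a < box_density ?C P"
      using eventually_finite_box
    proof eventually_elim
      case (elim P)
      have "(\<Sum>x\<in>P. \<Prod>i\<in>I. f i n (circle_exp (\<Lambda> i \<bullet> real_vec x))) / real (card P) \<le> box_density ?C P"
        unfolding dens[OF elim(2)] ind[symmetric]
        by (intro divide_right_mono sum_mono prod_mono) (auto simp: f)
      then show ?case using elim(1) by linarith
    qed
  next
    fix a assume a: "(\<Prod>i\<in>I. circle_measure (E i)) < a"
    have "(\<lambda>n. \<Prod>i\<in>I. circle_integral (g i n)) \<longlonglongrightarrow> (\<Prod>i\<in>I. circle_measure (E i))"
      by (intro tendsto_prod g)
    from order_tendstoD(2)[OF this a] obtain n where n: "(\<Prod>i\<in>I. circle_integral (g i n)) < a"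
      by (auto simp: eventually_sequentially)
    have "\<forall>\<^sub>F P in box_filter. (\<Sum>x\<in>P. \<Prod>i\<in>I. g i n (circle_exp (\<Lambda> i \<bullet> real_vec x))) / real (card P) < a"
      by (rule order_tendstoD(2)[OF weyl_product[OF I nr] n]) (rule g)
    then show "\<forall>\<^sub>F P in box_filter. box_density ?C P < a"
      using eventually_finite_box
    proof eventually_elim
      case (elim P)
      have "box_density ?C P \<le> (\<Sum>x\<in>P. \<Prod>i\<in>I. g i n (circle_exp (\<Lambda> i \<bullet> real_vec x))) / real (card P)"
        unfolding dens[OF elim(2)] ind[symmetric]
        by (intro divide_right_mono sum_mono prod_mono) (auto simp: g)
      then show ?case using elim(1) by linarith
    qed
  qed
  then show "freq_measurable ?C" "freq ?C = (\<Prod>i\<in>I. circle_measure (E i))" by (rule freq_eqI)+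
qed

definition cylinders :: "('i \<Rightarrow> real ^ 'n) \<Rightarrow> 'i set \<Rightarrow> (int ^ 'n) set set" where
  "cylinders \<Lambda> I = {cylinder \<Lambda> I E | E. \<forall>i. circle_jordan (E i)}"

lemma cylinders_freq_measurable:
  "finite I \<Longrightarrow> nonresonant I \<Lambda> \<Longrightarrow> C \<in> cylinders \<Lambda> I \<Longrightarrow> freq_measurable C"
  by (auto simp: cylinders_def intro: cylinder_freq)

lemma cylinders_Int: "C \<in> cylinders \<Lambda> I \<Longrightarrow> D \<in> cylinders \<Lambda> I \<Longrightarrow> C \<inter> D \<in> cylinders \<Lambda> I"
proof -
  assume "C \<in> cylinders \<Lambda> I" "D \<in> cylinders \<Lambda> I"
  then obtain E F where "C = cylinder \<Lambda> I E" "D = cylinder \<Lambda> I F" "\<And>i. circle_jordan (E i)" "\<And>i. circle_jordan (F i)"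
    by (auto simp: cylinders_def)
  then show ?thesis
    unfolding cylinders_def
    by (intro CollectI exI[of _ "\<lambda>i. E i \<inter> F i"]) (auto simp: cylinder_def circle_jordan_Int)
qed

lemma cylinders_mono: "I \<subseteq> J \<Longrightarrow> cylinders \<Lambda> I \<subseteq> cylinders \<Lambda> J"
proof
  fix C assume "I \<subseteq> J" "C \<in> cylinders \<Lambda> I"
  then obtain E where "C = cylinder \<Lambda> I E" "\<And>i. circle_jordan (E i)" by (auto simp: cylinders_def)
  then show "C \<in> cylinders \<Lambda> J"
    unfolding cylinders_def using \<open>I \<subseteq> J\<close>
    by (intro CollectI exI[of _ "\<lambda>i. if i \<in> I then E i else sphere 0 1"])
      (auto simp: cylinder_def circle_jordan_sphere split: if_splits)
qed

lemma UNIV_in_cylinders: "UNIV \<in> cylinders \<Lambda> {}"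
  unfolding cylinders_def using circle_jordan_sphere by (auto simp: cylinder_def intro!: exI[of _ "\<lambda>i. sphere 0 1"])

text \<open>Conditions on disjoint sets of rows merge into one cylinder on the union, whose
  frequency is a product over all rows and therefore factorises. All independence used later comes
  from here.\<close>

lemma cylinders_independent:
  fixes \<Lambda> :: "'i \<Rightarrow> real ^ 'n"
  assumes "C \<in> cylinders \<Lambda> I" "D \<in> cylinders \<Lambda> J" "I \<inter> J = {}" "finite I" "finite J"
    "nonresonant I \<Lambda>" "nonresonant J \<Lambda>" "nonresonant (I \<union> J) \<Lambda>"
  shows "C \<inter> D \<in> cylinders \<Lambda> (I \<union> J)" "freq (C \<inter> D) = freq C * freq D"
proof -
  obtain E F where EF: "C = cylinder \<Lambda> I E" "D = cylinder \<Lambda> J F" "\<And>i. circle_jordan (E i)" "\<And>i. circle_jordan (F i)"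
    using assms(1,2) by (auto simp: cylinders_def)
  define H where "H i = (if i \<in> I then E i else F i)" for i
  have H: "\<And>i. circle_jordan (H i)" by (simp add: H_def EF)
  have eq: "C \<inter> D = cylinder \<Lambda> (I \<union> J) H"
    using assms(3) by (auto simp: EF cylinder_def H_def)
  show "C \<inter> D \<in> cylinders \<Lambda> (I \<union> J)"
    unfolding eq using H by (auto simp: cylinders_def)
  have "freq (C \<inter> D) = (\<Prod>i\<in>I \<union> J. circle_measure (H i))"
    unfolding eq using assms by (intro cylinder_freq H) auto
  also have "\<dots> = (\<Prod>i\<in>I. circle_measure (H i)) * (\<Prod>i\<in>J. circle_measure (H i))"
    using assms by (intro prod.union_disjoint)
  also have "(\<Prod>i\<in>I. circle_measure (H i)) = freq C"
    using assms unfolding EF(1) cylinder_freq(2)[OF assms(4,6) EF(3)] by (simp add: H_def)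
  also have "(\<Prod>i\<in>J. circle_measure (H i)) = freq D"
    unfolding EF(2) cylinder_freq(2)[OF assms(5,7) EF(4)]
    using assms(3) by (intro prod.cong) (auto simp: H_def)
  finally show "freq (C \<inter> D) = freq C * freq D" .
qed

text \<open>The origin \<open>s\<close> of the grid will carry the translation of the
  window.\<close>

definition grid_cell :: "('i \<Rightarrow> real ^ 'n) \<Rightarrow> 'i set \<Rightarrow> ('i \<Rightarrow> real) \<Rightarrow> nat \<Rightarrow> ('i \<Rightarrow> int) \<Rightarrow> (int ^ 'n) set" where
  "grid_cell \<Lambda> I s K j = cylinder \<Lambda> I (\<lambda>i. circle_arc (s i + j i / K) (1 / K))"

lemma grid_cell_iff:
  "x \<in> grid_cell \<Lambda> I s K j \<longleftrightarrow> (\<exists>z::'i \<Rightarrow> int. \<forall>i\<in>I. s i + j i / K \<le> \<Lambda> i \<bullet> real_vec x - z i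
    \<and> \<Lambda> i \<bullet> real_vec x - z i < s i + j i / K + 1 / K)"
  by (simp add: grid_cell_def cylinder_def circle_arc_iff bchoice_iff)

lemma grid_cell_cylinders: "K \<ge> 1 \<Longrightarrow> grid_cell \<Lambda> I s K j \<in> cylinders \<Lambda> I"
  by (auto simp: grid_cell_def cylinders_def intro!: exI[of _ "\<lambda>i. circle_arc (s i + j i / K) (1 / K)"] circle_jordan_arc)

text \<open>Neither \<open>s\<close> nor \<open>j\<close> enters the value: this is the translation
  invariance behind the mixing formula.\<close>

lemma grid_cell_freq:
  assumes "finite I" "nonresonant I \<Lambda>" "K \<ge> 1"
  shows "freq (grid_cell \<Lambda> I s K j) = (1 / K) ^ card I"
  unfolding grid_cell_def using assms
  by (subst cylinder_freq) (auto intro!: circle_jordan_arc simp: circle_measure_arc)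

lemma grid_cell_disjoint:
  assumes "K \<ge> 1" "j \<in> PiE I (\<lambda>_. {0..<int K})" "j' \<in> PiE I (\<lambda>_. {0..<int K})" "j \<noteq> j'"
  shows "grid_cell \<Lambda> I s K j \<inter> grid_cell \<Lambda> I s K j' = {}"
proof (rule ccontr)
  assume "\<not> ?thesis"
  then obtain x where x: "x \<in> grid_cell \<Lambda> I s K j" "x \<in> grid_cell \<Lambda> I s K j'" by blast
  \<comment> \<open>The phase of \<open>x\<close> determines the index: a floor gives it up to a
    multiple of \<open>K\<close>, and indices lie in \<open>{0..<K}\<close>.\<close>
  have *: "h i = \<lfloor>K * (\<Lambda> i \<bullet> real_vec x - s i)\<rfloor> mod K"
    if h: "x \<in> grid_cell \<Lambda> I s K h" "h \<in> PiE I (\<lambda>_. {0..<int K})" and i: "i \<in> I" for h i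
  proof -
    obtain z :: int where z: "s i + h i / K \<le> \<Lambda> i \<bullet> real_vec x - z" "\<Lambda> i \<bullet> real_vec x - z < s i + h i / K + 1 / K"
      using h(1) i by (auto simp: grid_cell_iff)
    have "\<lfloor>K * (\<Lambda> i \<bullet> real_vec x - s i)\<rfloor> = h i + K * z"
      using z assms(1) by (intro floor_unique) (auto simp: field_simps)
    moreover have "0 \<le> h i" "h i < K" using h(2) i by auto
    ultimately show ?thesis by simp
  qed
  have "j i = j' i" for i
    using *[OF x(1) assms(2)] *[OF x(2) assms(3)] assms(2,3)
    by (cases "i \<in> I") (auto simp: PiE_def extensional_def)
  then show False using assms(4) by auto
qed

section \<open>Grid approximation of Jordan measurable sets\<close>

abbreviation real_product :: "'i set \<Rightarrow> ('i \<Rightarrow> real) topology" where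
  "real_product I \<equiv> product_topology (\<lambda>_. euclideanreal) I"

text \<open>The interval is the cell from \<open>j / K\<close> to \<open>(j + 1) / K\<close>,
  enlarged by one grid step on either side; \<open>near_cell\<close> describes the same
  enlargement.\<close>

definition cells_meeting :: "'i set \<Rightarrow> ('i \<Rightarrow> real) set \<Rightarrow> nat \<Rightarrow> ('i \<Rightarrow> int) set" where
  "cells_meeting I Z K = {j \<in> PiE I (\<lambda>_. UNIV).
     \<exists>p\<in>Z. \<forall>i\<in>I. (real_of_int (j i) - 1) / K \<le> p i \<and> p i \<le> (real_of_int (j i) + 2) / K}"

interpretation lborel_product: product_sigma_finite "\<lambda>_. lborel :: real measure"
  by standard

definition near_cell :: "'i set \<Rightarrow> nat \<Rightarrow> ('i \<Rightarrow> int) \<Rightarrow> ('i \<Rightarrow> real) \<Rightarrow> bool" where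
  "near_cell I K j u \<longleftrightarrow>
     (\<forall>i\<in>I. (real_of_int (j i) - 1) / K \<le> u i \<and> u i \<le> (real_of_int (j i) + 2) / K)"

lemma emeasure_half_open_cube:
  assumes "finite I" "K \<ge> 1"
  shows "emeasure (Pi\<^sub>M I (\<lambda>_. lborel)) (PiE I (\<lambda>i. {real_of_int (j i) / real K..<(real_of_int (j i) + 1) / K}))
    = ennreal ((1 / K) ^ card I)"
proof -
  have "emeasure (Pi\<^sub>M I (\<lambda>_. lborel)) (PiE I (\<lambda>i. {real_of_int (j i) / real K..<(real_of_int (j i) + 1) / K}))
      = (\<Prod>i\<in>I. emeasure lborel {real_of_int (j i) / real K..<(real_of_int (j i) + 1) / K})"
    using assms(1) by (rule lborel_product.emeasure_PiM) simp
  also have "\<dots> = (\<Prod>i\<in>I. ennreal (1 / K))"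
  proof (rule prod.cong[OF refl])
    fix i
    have "(real_of_int (j i) + 1) / K - j i / K = 1 / K" by (simp add: add_divide_distrib)
    then show "emeasure lborel {real_of_int (j i) / real K..<(real_of_int (j i) + 1) / K} = ennreal (1 / K)"
      using assms(2) by (subst emeasure_lborel_Ico) (auto intro!: divide_right_mono)
  qed
  also have "\<dots> = ennreal ((1 / K) ^ card I)"
    by (simp add: prod_constant ennreal_power)
  finally show ?thesis .
qed

lemma finite_cells_meeting:
  assumes "finite I" "K \<ge> 1" and bd: "\<forall>p\<in>Z. \<forall>i\<in>I. \<bar>p i\<bar> \<le> c"
  shows "finite (cells_meeting I Z K)"
proof (rule finite_subset)
  show "cells_meeting I Z K \<subseteq> PiE I (\<lambda>_. {- \<lceil>c * K\<rceil> - 2..\<lceil>c * K\<rceil> + 1})"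
  proof
    fix j assume j: "j \<in> cells_meeting I Z K"
    then obtain p where p: "p \<in> Z" "\<And>i. i \<in> I \<Longrightarrow> (real_of_int (j i) - 1) / K \<le> p i \<and> p i \<le> (real_of_int (j i) + 2) / K"
      by (auto simp: cells_meeting_def)
    have "j i \<in> {- \<lceil>c * K\<rceil> - 2..\<lceil>c * K\<rceil> + 1}" if i: "i \<in> I" for i
    proof -
      have "p i \<le> c" "- c \<le> p i" using bd[rule_format, OF p(1) i] by linarith+
      with p(2)[OF i] have "(real_of_int (j i) - 1) / K \<le> c" "- c \<le> (real_of_int (j i) + 2) / K" by linarith+
      then have "real_of_int (j i) - 1 \<le> c * K" "- (c * K) \<le> real_of_int (j i) + 2"
        using assms(2) by (simp_all add: field_simps)
      then show ?thesis by simp linarith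
    qed
    then show "j \<in> PiE I (\<lambda>_. {- \<lceil>c * K\<rceil> - 2..\<lceil>c * K\<rceil> + 1})"
      using j by (auto simp: cells_meeting_def PiE_def)
  qed
  show "finite (PiE I (\<lambda>_. {- \<lceil>c * K\<rceil> - 2..\<lceil>c * K\<rceil> + 1}))"
    using assms(1) by (intro finite_PiE) auto
qed

lemma half_open_cube_disjoint:
  assumes "K \<ge> 1" "j \<in> PiE I (\<lambda>_. UNIV)" "j' \<in> PiE I (\<lambda>_. UNIV)" "j \<noteq> j'"
  shows "PiE I (\<lambda>i. {real_of_int (j i) / real K..<(real_of_int (j i) + 1) / K})
    \<inter> PiE I (\<lambda>i. {real_of_int (j' i) / real K..<(real_of_int (j' i) + 1) / K}) = {}"
proof (rule ccontr)
  assume "\<not> ?thesis"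
  then obtain p where p: "p \<in> PiE I (\<lambda>i. {real_of_int (j i) / real K..<(real_of_int (j i) + 1) / K})"
    "p \<in> PiE I (\<lambda>i. {real_of_int (j' i) / real K..<(real_of_int (j' i) + 1) / K})" by blast
  have "h i = \<lfloor>p i * K\<rfloor>" if "p \<in> PiE I (\<lambda>i. {real_of_int (h i) / real K..<(real_of_int (h i) + 1) / K})" "i \<in> I" for h i
  proof (rule floor_unique[symmetric])
    have "real_of_int (h i) / real K \<le> p i" "p i < (real_of_int (h i) + 1) / K" using that by (auto simp: PiE_def Pi_def)
    then show "real_of_int (h i) \<le> p i * K" "p i * K < real_of_int (h i) + 1"
      using assms(1) by (simp_all add: field_simps)
  qed
  from this[OF p(1)] this[OF p(2)] have "j i = j' i" for i
    using assms(2,3) by (cases "i \<in> I") (auto simp: PiE_def extensional_def)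
  then show False using assms(4) by auto
qed

lemma not_in_closed_product:
  assumes I: "finite I" and Z: "closedin (real_product I) Z" and p: "p \<in> PiE I (\<lambda>_. UNIV)" "p \<notin> Z"
  obtains e where "e > 0" "\<And>z. z \<in> PiE I (\<lambda>_. UNIV) \<Longrightarrow> (\<And>i. i \<in> I \<Longrightarrow> \<bar>z i - p i\<bar> < e) \<Longrightarrow> z \<notin> Z"
proof -
  have "openin (real_product I) (topspace (real_product I) - Z)"
    using Z by (rule openin_diff[OF openin_topspace])
  then obtain U where U: "\<forall>i\<in>I. open (U i)" "p \<in> PiE I U" "PiE I U \<subseteq> topspace (real_product I) - Z"
    using p unfolding openin_product_topology_alt
    by (auto simp: topspace_product_topology) (metis (no_types, lifting) DiffI)
  have "\<forall>i\<in>I. \<exists>e>0. \<forall>y. dist y (p i) < e \<longrightarrow> y \<in> U i"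
    using U(1,2) by (auto simp: open_dist PiE_def Pi_def)
  then obtain e where e: "\<forall>i\<in>I. e i > 0 \<and> (\<forall>y. dist y (p i) < e i \<longrightarrow> y \<in> U i)"
    by (rule bchoice[THEN exE])
  show thesis
  \<comment> \<open>The 1 keeps the minimum defined when \<open>I\<close> is empty.\<close>
  proof (rule that[of "Min (insert 1 (e ` I))"])
    show "Min (insert 1 (e ` I)) > 0" using I e by simp
    fix z assume z: "z \<in> PiE I (\<lambda>_. UNIV)" "\<And>i. i \<in> I \<Longrightarrow> \<bar>z i - p i\<bar> < Min (insert 1 (e ` I))"
    have "z i \<in> U i" if i: "i \<in> I" for i
    proof -
      have "Min (insert 1 (e ` I)) \<le> e i" using I i by (intro Min_le) auto
      then have "dist (z i) (p i) < e i" using z(2)[OF i] by (simp add: dist_real_def)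
      then show ?thesis using e i by blast
    qed
    then have "z \<in> PiE I U" using z(1) by (auto simp: PiE_def)
    then show "z \<notin> Z" using U(3) by blast
  qed
qed

text \<open>The half-open cubes of the counted cells are disjoint, so their number is
  \<open>K ^ card I\<close> times the volume of their union \<open>U K\<close>. That union lies
  within \<open>2 / K\<close> of \<open>Z\<close> in each coordinate, so for large \<open>K\<close>
  it shrinks towards the closed null set \<open>Z\<close>, and continuity of the measure from above
  makes the volume small.\<close>

lemma card_cells_meeting_null:
  assumes I: "finite I"
    and Z: "closedin (real_product I) Z" "Z \<in> null_sets (Pi\<^sub>M I (\<lambda>_. lborel))"
    and bd: "\<forall>p\<in>Z. \<forall>i\<in>I. \<bar>p i\<bar> \<le> c"
    and e: "e > 0"
  shows "\<exists>K0\<ge>1. \<forall>K\<ge>K0. real (card (cells_meeting I Z K)) \<le> e * real K ^ card I"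
proof -
  let ?M = "Pi\<^sub>M I (\<lambda>_. lborel :: real measure)"
  define cube where "cube K j = PiE I (\<lambda>i. {real_of_int (j i) / real K..<(real_of_int (j i) + 1) / K})" for K :: nat and j
  define U where "U K = (\<Union>j\<in>cells_meeting I Z K. cube K j)" for K
  \<comment> \<open>The \<open>U K\<close> need not be nested, so tails are taken; starting at
    \<open>Suc n\<close> keeps \<open>K\<close> positive.\<close>
  define V where "V n = (\<Union>K\<in>{Suc n..}. U K)" for n
  have cube_sets: "cube K j \<in> sets ?M" for K j
    unfolding cube_def using I by (intro sets_PiM_I_finite) auto
  have U_sets: "U K \<in> sets ?M" if "K \<ge> 1" for K
    unfolding U_def using finite_cells_meeting[OF I that bd] by (intro sets.finite_UN cube_sets)
  have U_meas: "emeasure ?M (U K) = ennreal (card (cells_meeting I Z K) * (1 / K) ^ card I)" if K: "K \<ge> 1" for K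
  proof -
    have "emeasure ?M (U K) = (\<Sum>j\<in>cells_meeting I Z K. emeasure ?M (cube K j))"
      unfolding U_def
    proof (rule sum_emeasure[symmetric])
      show "disjoint_family_on (cube K) (cells_meeting I Z K)"
        unfolding disjoint_family_on_def cube_def cells_meeting_def
        using half_open_cube_disjoint[OF K] by blast
    qed (use cube_sets finite_cells_meeting[OF I K bd] in auto)
    also have "\<dots> = (\<Sum>j\<in>cells_meeting I Z K. ennreal ((1 / K) ^ card I))"
      unfolding cube_def emeasure_half_open_cube[OF I K] ..
    finally show ?thesis
      by (simp add: ennreal_mult ennreal_of_nat_eq_real_of_nat)
  qed
  have near: "\<bar>z i - p i\<bar> \<le> 2 / K"
    if "p \<in> cube K j" "\<forall>i\<in>I. (real_of_int (j i) - 1) / K \<le> z i \<and> z i \<le> (real_of_int (j i) + 2) / K" "i \<in> I" "K \<ge> 1" for p z j K i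
  proof -
    have "real_of_int (j i) / K \<le> p i" "p i < (real_of_int (j i) + 1) / K"
      using that by (auto simp: cube_def PiE_def Pi_def)
    moreover have "(real_of_int (j i) - 1) / K \<le> z i" "z i \<le> (real_of_int (j i) + 2) / K" using that by auto
    ultimately show ?thesis
      by (simp add: add_divide_distrib diff_divide_distrib abs_le_iff)
  qed
  have V_sets: "V n \<in> sets ?M" for n
    unfolding V_def by (rule sets.countable_UN') (auto intro!: U_sets)
  \<comment> \<open>The 2 bounds the distance \<open>2 / K\<close> from \<open>Z\<close>. Continuity
    from above requires the finite measure that follows.\<close>
  have V_bd: "V n \<subseteq> PiE I (\<lambda>_. {-(c + 2)..c + 2})" for n
  proof
    fix p assume "p \<in> V n"
    then obtain K j where K: "K \<ge> Suc n" and j: "j \<in> cells_meeting I Z K" "p \<in> cube K j" by (auto simp: V_def U_def)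
    then obtain z where z: "z \<in> Z" "\<forall>i\<in>I. (real_of_int (j i) - 1) / K \<le> z i \<and> z i \<le> (real_of_int (j i) + 2) / K"
      by (auto simp: cells_meeting_def)
    have "2 / real K \<le> 2" using K by (simp add: divide_le_eq)
    then have "-(c + 2) \<le> p i \<and> p i \<le> c + 2" if "i \<in> I" for i
      using near[OF j(2) z(2) that] bd[rule_format, OF z(1) that] K by linarith
    moreover have "p \<in> extensional I"
      using j(2) unfolding cube_def PiE_def by (rule IntD2)
    ultimately show "p \<in> PiE I (\<lambda>_. {-(c + 2)..c + 2})"
      unfolding PiE_def Pi_def atLeastAtMost_iff by blast
  qed
  have "emeasure ?M (PiE I (\<lambda>_. {-(c + 2)..c + 2})) = (\<Prod>i\<in>I. emeasure lborel {-(c + 2)..c + 2})"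
    by (rule lborel_product.emeasure_PiM[OF I]) simp
  then have fin: "emeasure ?M (PiE I (\<lambda>_. {-(c + 2)..c + 2})) \<noteq> \<infinity>"
    by (simp add: prod_constant emeasure_lborel_Icc_eq power_eq_top_ennreal)
  have V_fin: "emeasure ?M (V n) \<noteq> \<infinity>" for n
  proof -
    have "emeasure ?M (V n) \<le> emeasure ?M (PiE I (\<lambda>_. {-(c + 2)..c + 2}))"
      by (intro emeasure_mono V_bd sets_PiM_I_finite I) simp
    then show ?thesis using fin by (auto simp: top_unique)
  qed
  have V_dec: "decseq V"
    unfolding decseq_def V_def by (intro allI impI UN_mono) auto
  have V_lim: "(\<Inter>n. V n) \<subseteq> Z"
  proof
    fix p assume p: "p \<in> (\<Inter>n. V n)"
    show "p \<in> Z"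
    proof (rule ccontr)
      assume "p \<notin> Z"
      have "p \<in> V 0" using p by blast
      then have "p \<in> PiE I (\<lambda>_. UNIV)" using V_bd[of 0] by (auto simp: PiE_def)
      then obtain e where e: "e > 0" "\<And>z. z \<in> PiE I (\<lambda>_. UNIV) \<Longrightarrow> (\<And>i. i \<in> I \<Longrightarrow> \<bar>z i - p i\<bar> < e) \<Longrightarrow> z \<notin> Z"
        using not_in_closed_product[OF I Z(1) _ \<open>p \<notin> Z\<close>] by blast
      obtain n :: nat where n: "2 / e < n" using reals_Archimedean2 by blast
      have "p \<in> V n" using p by blast
      then obtain K j where K: "K \<ge> Suc n" and j: "j \<in> cells_meeting I Z K" "p \<in> cube K j" by (auto simp: V_def U_def)
      then obtain z where z: "z \<in> Z" "\<forall>i\<in>I. (real_of_int (j i) - 1) / K \<le> z i \<and> z i \<le> (real_of_int (j i) + 2) / K"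
        by (auto simp: cells_meeting_def)
      have "2 / e < K" using n K by linarith
      then have "2 / K < e" using e(1) K by (simp add: field_simps)
      then have "\<bar>z i - p i\<bar> < e" if "i \<in> I" for i
        using near[OF j(2) z(2) that] K by linarith
      moreover have "z \<in> PiE I (\<lambda>_. UNIV)"
        using closedin_subset[OF Z(1)] z(1) by (auto simp: topspace_product_topology)
      ultimately show False using e(2) z(1) by blast
    qed
  qed
  have "(\<lambda>n. emeasure ?M (V n)) \<longlonglongrightarrow> emeasure ?M (\<Inter>n. V n)"
    by (rule Lim_emeasure_decseq) (use V_sets V_dec V_fin in auto)
  moreover have "emeasure ?M (\<Inter>n. V n) = 0"
    using Z(2) V_lim by (metis emeasure_mono le_zero_eq null_setsD1 null_setsD2)
  ultimately have "\<forall>\<^sub>F n in sequentially. emeasure ?M (V n) < ennreal e"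
    using e by (intro order_tendstoD) auto
  then obtain n where n: "emeasure ?M (V n) < ennreal e" by (auto simp: eventually_sequentially)
  have "real (card (cells_meeting I Z K)) \<le> e * real K ^ card I" if K: "K \<ge> Suc n" for K
  proof -
    have "ennreal (card (cells_meeting I Z K) * (1 / K) ^ card I) \<le> emeasure ?M (V n)"
      using K by (subst U_meas[symmetric]) (auto simp: V_def intro!: emeasure_mono V_sets[unfolded V_def])
    then have "card (cells_meeting I Z K) * (1 / K) ^ card I < e"
      using n e by (metis ennreal_less_iff le_less_trans mult_nonneg_nonneg of_nat_0_le_iff zero_le_divide_1_iff zero_le_power)
    then show ?thesis using K by (simp add: field_simps)
  qed
  then show ?thesis by (intro exI[of _ "Suc n"]) auto
qed

text \<open>
  For a cell \<open>j\<close> kept in \<open>J\<close>, membership in the integer translates of \<open>V\<close> is constant not only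
  on the cell but on its enlargement by one grid step; this leaves room for perturbations.
\<close>

lemma jordan_grid:
  fixes V Z :: "('i \<Rightarrow> real) set"
  assumes I: "finite I"
    and Z: "closedin (real_product I) Z" "Z \<in> null_sets (Pi\<^sub>M I (\<lambda>_. lborel))"
    and bd: "\<forall>p\<in>Z. \<forall>i\<in>I. \<bar>p i\<bar> \<le> c"
    and VZ: "real_product I frontier_of V \<subseteq> Z"
    and e: "e > 0"
  shows "\<exists>K0\<ge>1. \<forall>K\<ge>K0. \<exists>J \<subseteq> PiE I (\<lambda>_. {0..<int K}). (1 - e) * real K ^ card I \<le> real (card J) \<and>
    (\<forall>j\<in>J. \<forall>z::'i \<Rightarrow> int. \<forall>(u :: 'i \<Rightarrow> real) (v :: 'i \<Rightarrow> real).
       near_cell I K j u \<longrightarrow>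
       near_cell I K j v \<longrightarrow>
       ((\<lambda>i\<in>I. u i - z i) \<in> V \<longleftrightarrow> (\<lambda>i\<in>I. v i - z i) \<in> V))"
proof -
  obtain K0 where K0: "K0 \<ge> 1" "\<And>K. K \<ge> K0 \<Longrightarrow> real (card (cells_meeting I Z K)) \<le> e * real K ^ card I"
    using card_cells_meeting_null[OF I Z bd e] by blast
  show ?thesis
  proof (intro exI[of _ K0] conjI allI impI K0(1))
    fix K assume K: "K0 \<le> K"
    then have K1: "K \<ge> 1" using K0(1) by simp
    \<comment> \<open>The discarded cells. Indices are reduced modulo \<open>K\<close> because a
      cell must go as soon as one of its integer translates comes near \<open>Z\<close>.\<close>
    define B where "B = (\<lambda>j. \<lambda>i\<in>I. j i mod int K) ` cells_meeting I Z K"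
    define J where "J = PiE I (\<lambda>_. {0..<int K}) - B"
    have "card (PiE I (\<lambda>_. {0..<int K})) = K ^ card I" using I by (simp add: card_PiE)
    moreover have "card B \<le> card (cells_meeting I Z K)"
      unfolding B_def by (rule card_image_le[OF finite_cells_meeting[OF I K1 bd]])
    moreover have "card (PiE I (\<lambda>_. {0..<int K})) - card B \<le> card J"
      unfolding J_def by (rule diff_card_le_card_Diff) (simp add: B_def finite_cells_meeting[OF I K1 bd])
    ultimately have card: "(1 - e) * real K ^ card I \<le> real (card J)"
      using K0(2)[OF K] by (simp add: left_diff_distrib flip: of_nat_power)
    have const: "(\<lambda>i\<in>I. u i - z i) \<in> V \<longleftrightarrow> (\<lambda>i\<in>I. v i - z i) \<in> V"
      if j: "j \<in> J" and u: "near_cell I K j u"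
        and v: "near_cell I K j v"
      for j and u :: "'i \<Rightarrow> real" and v :: "'i \<Rightarrow> real" and z :: "'i \<Rightarrow> int"
    proof (rule ccontr)
      assume neq: "\<not> ?thesis"
      \<comment> \<open>Index of the translated cell. Its enlargement \<open>S\<close> is connected
        and would contain points inside and outside \<open>V\<close>, hence a frontier point, so
        \<open>j\<close> would have been discarded.\<close>
      define h where "h = (\<lambda>i\<in>I. j i - K * z i)"
      define S where "S = PiE I (\<lambda>i. {(real_of_int (h i) - 1) / K..(real_of_int (h i) + 2) / K})"
      have S: "(\<lambda>i\<in>I. w i - z i) \<in> S"
        if w: "near_cell I K j w" for w :: "'i \<Rightarrow> real"
        using w K1 by (auto simp: S_def h_def near_cell_def field_simps)
      have "connectedin (real_product I) S"
        unfolding S_def connectedin_PiE by (simp add: connectedin_iff_connected)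
      then have "S \<inter> real_product I frontier_of V \<noteq> {}"
        using S[OF u] S[OF v] neq by (intro connectedin_Int_frontier_of) auto
      then obtain p where p: "p \<in> S" "p \<in> Z" using VZ by blast
      have "h \<in> cells_meeting I Z K"
        unfolding cells_meeting_def using p by (auto simp: S_def h_def PiE_def Pi_def intro!: bexI[of _ p])
      moreover have "j = (\<lambda>i\<in>I. h i mod int K)"
      proof
        fix i
        show "j i = (\<lambda>i\<in>I. h i mod int K) i"
          using j K1 by (cases "i \<in> I") (auto simp: h_def J_def PiE_def Pi_def extensional_def mod_diff_right_eq[symmetric])
      qed
      ultimately have "j \<in> B" unfolding B_def by blast
      then show False using j by (simp add: J_def)
    qed
    have sub: "J \<subseteq> PiE I (\<lambda>_. {0..<int K})" by (auto simp: J_def)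
    show "\<exists>J \<subseteq> PiE I (\<lambda>_. {0..<int K}). (1 - e) * real K ^ card I \<le> real (card J) \<and>
      (\<forall>j\<in>J. \<forall>z::'i \<Rightarrow> int. \<forall>(u :: 'i \<Rightarrow> real) (v :: 'i \<Rightarrow> real). near_cell I K j u \<longrightarrow> near_cell I K j v \<longrightarrow>
         ((\<lambda>i\<in>I. u i - z i) \<in> V \<longleftrightarrow> (\<lambda>i\<in>I. v i - z i) \<in> V))"
      by (intro exI[of _ J] conjI allI impI ballI sub card) (rule const)
  qed
qed

section \<open>Coordinates of Euclidean space\<close>

text \<open>Transfers the quantizer cell, a set in \<open>real ^ 'n\<close>, to functions indexed by
  the rows of a single time \<open>c\<close>, where the window lemmas apply.\<close>

definition coords_vec :: "('c \<times> 'n \<Rightarrow> real) \<Rightarrow> 'c \<Rightarrow> real ^ 'n" where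
  "coords_vec v c = (\<chi> i. v (c, i))"

lemma measurable_coords_vec:
  "(\<lambda>v. coords_vec v c) \<in> Pi\<^sub>M ({c} \<times> (UNIV :: 'n::finite set)) (\<lambda>_. lborel) \<rightarrow>\<^sub>M borel"
proof (rule borel_measurable_euclidean_space[THEN iffD2], rule ballI)
  fix b :: "real ^ 'n" assume "b \<in> Basis"
  then obtain i where b: "b = axis i 1" by (auto simp: Basis_vec_def)
  have "(\<lambda>v. v (c, i)) \<in> Pi\<^sub>M ({c} \<times> (UNIV :: 'n set)) (\<lambda>_. lborel) \<rightarrow>\<^sub>M (lborel :: real measure)"
    by (rule measurable_component_singleton) simp
  then show "(\<lambda>v. coords_vec v c \<bullet> b) \<in> borel_measurable (Pi\<^sub>M ({c} \<times> (UNIV :: 'n set)) (\<lambda>_. lborel))"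
    by (simp add: b coords_vec_def inner_axis)
qed

text \<open>Both measures give a box the product of its side lengths. It carries null sets of
  \<open>real ^ 'n\<close> over to the product measure.\<close>

lemma distr_coords_vec:
  "distr (Pi\<^sub>M ({c} \<times> UNIV) (\<lambda>_. lborel)) borel (\<lambda>v. coords_vec v c) = (lborel :: (real ^ 'n) measure)"
proof (rule lborel_eqI[symmetric])
  fix l u :: "real ^ 'n" assume lu: "\<And>b. b \<in> Basis \<Longrightarrow> l \<bullet> b \<le> u \<bullet> b"
  let ?M = "Pi\<^sub>M ({c} \<times> (UNIV :: 'n set)) (\<lambda>_. lborel :: real measure)"
  have Basis: "(Basis :: (real ^ 'n) set) = range (\<lambda>i. axis i 1)"
    by (auto simp: Basis_vec_def)
  have le: "l $ i \<le> u $ i" for i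
    using lu[of "axis i 1"] by (simp add: Basis inner_axis)
  have "emeasure (distr ?M borel (\<lambda>v. coords_vec v c)) (box l u) =
      emeasure ?M ((\<lambda>v. coords_vec v c) -` box l u \<inter> space ?M)"
    by (rule emeasure_distr[OF measurable_coords_vec]) simp
  also have "(\<lambda>v. coords_vec v c) -` box l u \<inter> space ?M = PiE ({c} \<times> UNIV) (\<lambda>p. {l $ snd p<..<u $ snd p})"
    by (auto simp: space_PiM PiE_def Pi_def coords_vec_def mem_box_cart)
  also have "emeasure ?M \<dots> = (\<Prod>p\<in>{c} \<times> UNIV. emeasure lborel {l $ snd p<..<u $ snd p})"
    by (rule lborel_product.emeasure_PiM) auto
  also have "\<dots> = (\<Prod>i\<in>UNIV. ennreal (u $ i - l $ i))"
    by (rule prod.reindex_bij_witness[of _ "\<lambda>i. (c, i)" snd]) (auto simp: le)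
  also have "\<dots> = ennreal (\<Prod>i\<in>UNIV. u $ i - l $ i)"
    by (rule prod_ennreal) (simp add: le)
  also have "(\<Prod>i\<in>UNIV. u $ i - l $ i) = (\<Prod>b\<in>Basis. (u - l) \<bullet> b)"
    unfolding Basis by (subst prod.reindex) (auto simp: inj_on_def axis_eq_axis inner_axis)
  finally show "emeasure (distr ?M borel (\<lambda>v. coords_vec v c)) (box l u) = ennreal (\<Prod>b\<in>Basis. (u - l) \<bullet> b)" .
qed simp

lemma continuous_map_coords_vec:
  "continuous_map (real_product ({c} \<times> UNIV)) euclidean (\<lambda>v. coords_vec v c :: real ^ 'n)"
proof -
  have "continuous_map (real_product ({c} \<times> UNIV)) euclideanreal (\<lambda>v. v (c, i))" for i :: 'n
    by (rule continuous_map_product_projection) simp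
  then show ?thesis
    unfolding coords_vec_def continuous_map_atin
    by (auto simp: limitin_canonical_iff intro!: vec_tendstoI)
qed

text \<open>By continuity the frontier of the preimage lies in the preimage \<open>Z\<close> of the
  frontier. This is why \<open>jordan_grid\<close> speaks of a closed null set containing the
  frontier.\<close>

lemma coords_vec_frontier:
  fixes V :: "(real ^ 'n) set" and c :: 'c
  assumes "jordan_measurable V"
  defines "I \<equiv> {c} \<times> (UNIV :: 'n set)"
  defines "Z \<equiv> {v \<in> PiE I (\<lambda>_. UNIV). coords_vec v c \<in> frontier V}"
  shows "closedin (real_product I) Z" "Z \<in> null_sets (Pi\<^sub>M I (\<lambda>_. lborel))"
    "\<exists>b. \<forall>p\<in>Z. \<forall>i\<in>I. \<bar>p i\<bar> \<le> b"
    "real_product I frontier_of {v \<in> PiE I (\<lambda>_. UNIV). coords_vec v c \<in> V} \<subseteq> Z"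
proof -
  let ?V = "{v \<in> PiE I (\<lambda>_. UNIV). coords_vec v c \<in> V}"
  have top: "topspace (real_product I) = PiE I (\<lambda>_. UNIV)" by (simp add: topspace_product_topology)
  note cont = continuous_map_coords_vec[of c, where 'n='n, folded I_def]
  show "closedin (real_product I) Z"
    using closedin_continuous_map_preimage[OF cont, of "frontier V"] by (simp add: Z_def top)
  show "Z \<in> null_sets (Pi\<^sub>M I (\<lambda>_. lborel))"
  proof -
    have meas: "(\<lambda>v. coords_vec v c) \<in> Pi\<^sub>M I (\<lambda>_. lborel) \<rightarrow>\<^sub>M borel" unfolding I_def by (rule measurable_coords_vec)
    have eq: "Z = (\<lambda>v. coords_vec v c) -` frontier V \<inter> space (Pi\<^sub>M I (\<lambda>_. lborel))"
      by (auto simp: Z_def space_PiM)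
    have "frontier V \<in> null_sets lborel"
      using assms(1) unfolding jordan_measurable_def negligible_iff_null_sets
      by (auto simp: null_sets_def emeasure_completion)
    then have "emeasure (distr (Pi\<^sub>M I (\<lambda>_. lborel)) borel (\<lambda>v. coords_vec v c)) (frontier V) = 0"
      unfolding I_def distr_coords_vec by (rule null_setsD1)
    then have "emeasure (Pi\<^sub>M I (\<lambda>_. lborel)) Z = 0"
      unfolding eq by (subst (asm) emeasure_distr[OF meas]) auto
    moreover have "Z \<in> sets (Pi\<^sub>M I (\<lambda>_. lborel))"
      unfolding eq by (rule measurable_sets[OF meas]) auto
    ultimately show ?thesis by (rule null_setsI)
  qed
  have "bounded (frontier V)" using assms(1) unfolding jordan_measurable_def frontier_def
    by (blast intro: bounded_subset bounded_closure)
  then obtain b where b: "\<And>x. x \<in> frontier V \<Longrightarrow> norm x \<le> b" by (auto simp: bounded_iff)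
  have "\<bar>p (c, i)\<bar> \<le> b" if "p \<in> Z" for p i
    using b[of "coords_vec p c"] that component_le_norm_cart[of "coords_vec p c" i]
    by (simp add: Z_def coords_vec_def)
  then show "\<exists>b. \<forall>p\<in>Z. \<forall>i\<in>I. \<bar>p i\<bar> \<le> b" unfolding I_def by auto
  show "real_product I frontier_of ?V \<subseteq> Z"
  proof -
    have "real_product I closure_of ?V \<subseteq> {v \<in> PiE I (\<lambda>_. UNIV). coords_vec v c \<in> closure V}"
      using closedin_continuous_map_preimage[OF cont, of "closure V"] closure_subset[of V]
      by (intro closure_of_minimal) (auto simp: top)
    moreover have "{v \<in> PiE I (\<lambda>_. UNIV). coords_vec v c \<in> interior V} \<subseteq> real_product I interior_of ?V"
      using openin_continuous_map_preimage[OF cont, of "interior V"] interior_subset[of V]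
      by (intro interior_of_maximal) (auto simp: top)
    ultimately show ?thesis
      unfolding Z_def frontier_of_def frontier_def by blast
  qed
qed

text \<open>For the error estimates below: typically a main part and two exceptional sets of small
  frequency.\<close>

lemma freq_le_cover:
  assumes "freq_measurable X" "freq_measurable A" "freq_measurable B" "freq_measurable C" "X \<subseteq> A \<union> B \<union> C"
  shows "freq X \<le> freq A + freq B + freq C"
proof (rule tendsto_le[OF box_filter_neq_bot])
  show "((\<lambda>P. box_density A P + box_density B P + box_density C P) \<longlongrightarrow> freq A + freq B + freq C) box_filter"
    by (intro tendsto_add tendsto_freq assms)
  show "(box_density X \<longlongrightarrow> freq X) box_filter" by (rule tendsto_freq[OF assms(1)])
  show "\<forall>\<^sub>F P in box_filter. box_density X P \<le> box_density A P + box_density B P + box_density C P"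
    using eventually_finite_box
  proof eventually_elim
    case (elim P)
    have "card (X \<inter> P) \<le> card ((A \<inter> P) \<union> (B \<inter> P) \<union> (C \<inter> P))"
      using elim assms(5) by (intro card_mono) auto
    also have "\<dots> \<le> card (A \<inter> P) + card (B \<inter> P) + card (C \<inter> P)"
      by (meson add_mono_thms_linordered_semiring(3) card_Un_le order_trans)
    finally have "real (card (X \<inter> P)) \<le> card (A \<inter> P) + card (B \<inter> P) + card (C \<inter> P)" by linarith
    then show ?case
      unfolding box_density_def add_divide_distrib[symmetric] by (intro divide_right_mono) simp_all
  qed
qed

section \<open>Orbits of the discretization\<close>

lemma mat_pow_mult_vec: "mat_pow L m *v v = ((*v) L ^^ m) v"
  unfolding mat_pow_def by (induction m) (simp_all flip: matrix_vector_mul_assoc)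

lemma stacked_powers_inner:
  fixes L :: "real ^ 'n ^ 'n"
  shows "stacked_powers L (int m, i) \<bullet> v = ((*v) L ^^ m) v $ i"
proof -
  have "row i M \<bullet> v = (M *v v) $ i" for M :: "real ^ 'n ^ 'n" and i
    by (simp add: row_def matrix_vector_mult_def inner_vec_def)
  then show ?thesis
    by (simp add: stacked_powers_def mat_powi_def mat_pow_mult_vec)
qed

lemma real_vec_add: "real_vec (x + y) = real_vec x + real_vec y"
  by (simp add: real_vec_def vec_eq_iff)

text \<open>The rows of the powers \<open>a + 1\<close> to \<open>b\<close>; with the left end
  excluded, consecutive blocks are disjoint and unite to a block.\<close>

definition power_block :: "nat \<Rightarrow> nat \<Rightarrow> (int \<times> 'n) set" where
  "power_block a b = {int a<..int b} \<times> UNIV"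

lemma finite_power_block [simp]: "finite (power_block a b :: (int \<times> 'n::finite) set)"
  by (simp add: power_block_def)

lemma power_block_disjoint: "power_block a b \<inter> power_block b c = {}"
  by (auto simp: power_block_def)

lemma power_block_Un: "a \<le> b \<Longrightarrow> b \<le> c \<Longrightarrow> power_block a b \<union> power_block b c = power_block a c"
  by (auto simp: power_block_def)

lemma power_block_mono: "b \<le> c \<Longrightarrow> power_block a b \<subseteq> power_block a c"
  by (auto simp: power_block_def)

lemma power_block_cases:
  assumes "p \<in> power_block k (k + N)"
  obtains a i where "p = (int (k + a), i)" "1 \<le> a" "a \<le> N"
proof -
  have "int k < fst p" "fst p \<le> int k + int N" using assms by (auto simp: power_block_def)
  then have "fst p = int (k + nat (fst p - int k))" "1 \<le> nat (fst p - int k)" "nat (fst p - int k) \<le> N"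
    by linarith+
  then show thesis by (metis prod.collapse that)
qed

locale nonresonant_iteration =
  fixes L :: "real ^ 'n ^ 'n"
  assumes nonres: "iteratively_nonresonant L"
begin

abbreviation "\<Lambda> \<equiv> stacked_powers L"

abbreviation pow :: "nat \<Rightarrow> real ^ 'n \<Rightarrow> real ^ 'n" where
  "pow m \<equiv> (*v) L ^^ m"

lemma linear_pow: "linear (pow m)"
proof (induction m)
  case (Suc m)
  then show ?case using linear_compose[OF Suc matrix_vector_mul_linear[of L]] by (simp add: o_def)
qed (simp add: linear_id[unfolded id_def] id_def)

lemma nonresonant_power_block: "nonresonant (power_block a b) \<Lambda>"
proof -
  have sub: "power_block a b \<subseteq> (- {0}) \<times> (UNIV :: 'n set)"
    unfolding power_block_def by (rule Sigma_mono) auto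
  have "\<forall>I. finite I \<and> I \<subseteq> (- {0}) \<times> UNIV \<longrightarrow> nonresonant I \<Lambda>"
    using nonres unfolding iteratively_nonresonant_def by (rule conjunct2)
  from this[rule_format, OF conjI[OF finite_power_block sub]] show ?thesis .
qed

abbreviation cyls :: "nat \<Rightarrow> nat \<Rightarrow> (int ^ 'n) set set" where
  "cyls a b \<equiv> cylinders \<Lambda> (power_block a b)"

lemma cyls_freq_measurable: "C \<in> cyls a b \<Longrightarrow> freq_measurable C"
  by (rule cylinders_freq_measurable[OF finite_power_block nonresonant_power_block])

lemma cyls_independent:
  assumes "a \<le> b" "b \<le> c" "C \<in> cyls a b" "D \<in> cyls b c"
  shows "C \<inter> D \<in> cyls a c" "freq (C \<inter> D) = freq C * freq D"
  using cylinders_independent[OF assms(3,4) power_block_disjoint finite_power_block finite_power_block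
      nonresonant_power_block nonresonant_power_block]
  by (simp_all add: power_block_Un assms(1,2) nonresonant_power_block)

lemma freq_Union_cyls:
  assumes "finite \<C>" "\<C> \<subseteq> cyls a b" "disjoint \<C>"
  shows "freq_measurable (\<Union>\<C>)" "freq (\<Union>\<C>) = (\<Sum>C\<in>\<C>. freq C)"
proof -
  have "disjoint_family_on (\<lambda>C. C) \<C>"
    using assms(3) by (auto simp: disjoint_family_on_def disjoint_def)
  then have "freq_measurable (\<Union>C\<in>\<C>. C) \<and> freq (\<Union>C\<in>\<C>. C) = (\<Sum>C\<in>\<C>. freq C)"
    using assms(1,2) by (intro freq_UN_disjoint) (auto intro: cyls_freq_measurable)
  then show "freq_measurable (\<Union>\<C>)" "freq (\<Union>\<C>) = (\<Sum>C\<in>\<C>. freq C)" by simp_all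
qed

section \<open>Disjoint families of cells of equal frequency\<close>

definition cell_family :: "nat \<Rightarrow> nat \<Rightarrow> 'j set \<Rightarrow> real \<Rightarrow> ('j \<Rightarrow> (int ^ 'n) set) \<Rightarrow> bool" where
  "cell_family k m J \<rho> D \<longleftrightarrow> (\<forall>j\<in>J. D j \<in> cyls k m \<and> freq (D j) = \<rho>) \<and> disjoint_family_on D J"

text \<open>Equal frequencies turn measuring into counting cells.\<close>

lemma freq_cell_family:
  fixes \<rho> :: real
  assumes "finite J" "cell_family k m J \<rho> D" "S \<subseteq> J"
  shows "freq_measurable (\<Union>j\<in>S. D j)" "freq (\<Union>j\<in>S. D j) = card S * \<rho>"
proof -
  have "freq_measurable (\<Union>j\<in>S. D j) \<and> freq (\<Union>j\<in>S. D j) = (\<Sum>j\<in>S. freq (D j))"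
    using assms by (intro freq_UN_disjoint)
      (auto simp: cell_family_def intro: finite_subset cyls_freq_measurable disjoint_family_on_mono)
  moreover have "(\<Sum>j\<in>S. freq (D j)) = (\<Sum>j\<in>S. \<rho>)"
    using assms by (intro sum.cong) (auto simp: cell_family_def)
  ultimately show "freq_measurable (\<Union>j\<in>S. D j)" "freq (\<Union>j\<in>S. D j) = card S * \<rho>" by simp_all
qed

text \<open>The family on the new block may differ from one past cylinder \<open>C\<close> to the
  next, as the translation does. Independence still multiplies frequencies, because the total
  \<open>card J * \<rho>\<close> is the same for every \<open>C\<close>.\<close>

lemma cell_family_refine:
  fixes \<rho> :: real
  assumes \<C>: "finite \<C>" "\<C> \<subseteq> cyls 0 k" "disjoint \<C>" and km: "k \<le> m" and J: "finite J"
    and D: "\<forall>C\<in>\<C>. cell_family k m J \<rho> (D C)"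
  defines "\<E> \<equiv> (\<lambda>(C, j). C \<inter> D C j) ` (\<C> \<times> J)"
  shows "finite \<E>" "\<E> \<subseteq> cyls 0 m" "disjoint \<E>" "freq (\<Union>\<E>) = freq (\<Union>\<C>) * (card J * \<rho>)"
proof -
  show fin: "finite \<E>" using \<C> J by (simp add: \<E>_def)
  show sub: "\<E> \<subseteq> cyls 0 m"
    using \<C> D cyls_independent(1)[of 0 k m] km by (fastforce simp: \<E>_def cell_family_def)
  have dj: "disjoint_family_on (\<lambda>(C, j). C \<inter> D C j) (\<C> \<times> J)"
    unfolding disjoint_family_on_def
  proof clarsimp
    fix C j C' j' assume *: "C \<in> \<C>" "j \<in> J" "C' \<in> \<C>" "j' \<in> J" "C = C' \<longrightarrow> j \<noteq> j'"
    show "C \<inter> D C j \<inter> (C' \<inter> D C' j') = {}"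
    proof (cases "C = C'")
      case True
      then show ?thesis using * D[rule_format, of C] by (auto simp: cell_family_def disjoint_family_on_def)
    next
      case False
      then show ?thesis using * \<C>(3) by (auto simp: disjoint_def)
    qed
  qed
  then show "disjoint \<E>"
    unfolding \<E>_def by (rule disjoint_family_on_disjoint_image)
  have "freq (\<Union>p\<in>\<C> \<times> J. (\<lambda>(C, j). C \<inter> D C j) p) = (\<Sum>p\<in>\<C> \<times> J. freq ((\<lambda>(C, j). C \<inter> D C j) p))"
    using sub \<C> J by (intro conjunct2[OF freq_UN_disjoint] dj)
      (auto simp: \<E>_def intro!: cyls_freq_measurable)
  also have "\<dots> = (\<Sum>p\<in>\<C> \<times> J. freq (fst p) * \<rho>)"
    using \<C> D km by (intro sum.cong refl) (auto simp: cell_family_def cyls_independent(2)[of 0 k m])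
  also have "\<dots> = (\<Sum>C\<in>\<C>. \<Sum>j\<in>J. freq C * \<rho>)"
    by (subst sum.cartesian_product) (simp add: case_prod_beta)
  also have "\<dots> = freq (\<Union>\<C>) * (card J * \<rho>)"
    unfolding freq_Union_cyls[OF \<C>] by (simp add: sum_distrib_right sum_distrib_left mult_ac)
  finally show "freq (\<Union>\<E>) = freq (\<Union>\<C>) * (card J * \<rho>)" by (simp add: \<E>_def)
qed

text \<open>Turns the grid of \<open>jordan_grid\<close> into cylinders at any time
  \<open>k\<close>, such that the phases of every \<open>y\<close> near \<open>L^k x - w\<close>
  fall into the enlarged cell \<open>j\<close>. The quantities \<open>K\<close>,
  \<open>\<delta>\<close> and \<open>J\<close> are chosen before \<open>k\<close> and
  \<open>w\<close>. The bound \<open>h\<close> on the mesh is for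
  \<open>quantizer_window\<close>.\<close>

lemma window_cells:
  fixes V :: "(int \<times> 'n \<Rightarrow> real) set"
  assumes Z: "closedin (real_product (power_block 0 N)) Z"
      "Z \<in> null_sets (Pi\<^sub>M (power_block 0 N) (\<lambda>_. lborel))"
    and bd: "\<forall>p\<in>Z. \<forall>i\<in>power_block 0 N. \<bar>p i\<bar> \<le> c"
    and VZ: "real_product (power_block 0 N) frontier_of V \<subseteq> Z"
    and e: "e > 0" and h: "h > 0"
  shows "\<exists>K \<delta> J. K \<ge> 1 \<and> 1 / real K \<le> h \<and> \<delta> > 0 \<and> finite J \<and>
    1 - e \<le> card J * (1 / real K) ^ card (power_block 0 N :: (int \<times> 'n) set) \<and>
    (\<forall>j\<in>J. \<forall>z::int \<times> 'n \<Rightarrow> int. \<forall>(u :: int \<times> 'n \<Rightarrow> real) (v :: int \<times> 'n \<Rightarrow> real). near_cell (power_block 0 N) K j u \<longrightarrow> near_cell (power_block 0 N) K j v \<longrightarrow>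
       ((\<lambda>i\<in>power_block 0 N. u i - z i) \<in> V \<longleftrightarrow> (\<lambda>i\<in>power_block 0 N. v i - z i) \<in> V)) \<and>
    (\<forall>k w. \<exists>D. cell_family k (k + N) J ((1 / real K) ^ card (power_block 0 N :: (int \<times> 'n) set)) D \<and>
      (\<forall>j\<in>J. \<forall>x\<in>D j. \<exists>z::int \<times> 'n \<Rightarrow> int. \<forall>y. norm (y - (pow k (real_vec x) - w)) \<le> \<delta> \<longrightarrow>
        near_cell (power_block 0 N) K j (\<lambda>(a, i). pow (nat a) y $ i - z (a, i))))"
proof -
  let ?I = "power_block 0 N :: (int \<times> 'n) set"
  obtain K0 where K0: "K0 \<ge> 1" "\<And>K. K \<ge> K0 \<Longrightarrow> \<exists>J \<subseteq> PiE ?I (\<lambda>_. {0..<int K}). (1 - e) * real K ^ card ?I \<le> real (card J) \<and>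
    (\<forall>j\<in>J. \<forall>z::int \<times> 'n \<Rightarrow> int. \<forall>(u :: int \<times> 'n \<Rightarrow> real) (v :: int \<times> 'n \<Rightarrow> real). near_cell ?I K j u \<longrightarrow> near_cell ?I K j v \<longrightarrow>
       ((\<lambda>i\<in>?I. u i - z i) \<in> V \<longleftrightarrow> (\<lambda>i\<in>?I. v i - z i) \<in> V))"
    using jordan_grid[OF finite_power_block Z bd VZ e] by blast
  obtain K1 :: nat where K1: "1 / h < K1" using reals_Archimedean2 by blast
  define K where "K = max K0 K1"
  have K: "K \<ge> K0" "K \<ge> 1" using K0(1) by (auto simp: K_def)
  have "1 / h < K" using K1 by (simp add: K_def)
  then have Kh: "1 / K \<le> h" using h K by (simp add: field_simps)
  obtain J where J: "J \<subseteq> PiE ?I (\<lambda>_. {0..<int K})" "(1 - e) * real K ^ card ?I \<le> real (card J)"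
    "\<forall>j\<in>J. \<forall>z::int \<times> 'n \<Rightarrow> int. \<forall>(u :: int \<times> 'n \<Rightarrow> real) (v :: int \<times> 'n \<Rightarrow> real). near_cell ?I K j u \<longrightarrow> near_cell ?I K j v \<longrightarrow>
       ((\<lambda>i\<in>?I. u i - z i) \<in> V \<longleftrightarrow> (\<lambda>i\<in>?I. v i - z i) \<in> V)"
    using K0(2)[OF K(1)] by blast
  have finJ: "finite J" using J(1) by (rule finite_subset) (auto intro: finite_PiE)
  have card_J: "1 - e \<le> card J * (1 / real K) ^ card ?I"
    using J(2) K(2) by (simp add: field_simps)
  have "\<forall>a. \<exists>b>0. \<forall>v. norm (pow a v) \<le> b * norm v"
    using linear_bounded_pos[OF linear_pow] by blast
  then obtain b where b: "\<And>a. b a > 0" "\<And>a v. norm (pow a v) \<le> b a * norm v" by metis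
  define B where "B = (\<Sum>a\<in>{..N}. b a)"
  have bB: "b a \<le> B" if "a \<le> N" for a
    unfolding B_def using that b(1) by (intro member_le_sum) (auto simp: less_imp_le)
  have B: "B > 0" using bB[of 0] b(1)[of 0] by simp
  \<comment> \<open>Powers of \<open>L\<close> up to \<open>N\<close> enlarge an error of
    \<open>\<delta>\<close> to at most one grid step, exactly the room that \<open>near_cell\<close>
    leaves.\<close>
  define \<delta> where "\<delta> = 1 / (K * B)"
  have \<delta>: "\<delta> > 0" "B * \<delta> = 1 / K" using B K(2) by (auto simp: \<delta>_def)
  have cells: "\<exists>D. cell_family k (k + N) J ((1 / real K) ^ card ?I) D \<and>
      (\<forall>j\<in>J. \<forall>x\<in>D j. \<exists>z::int \<times> 'n \<Rightarrow> int. \<forall>y. norm (y - (pow k (real_vec x) - w)) \<le> \<delta> \<longrightarrow>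
        near_cell ?I K j (\<lambda>(a, i). pow (nat a) y $ i - z (a, i)))" for k w
  proof -
    let ?I' = "power_block k (k + N) :: (int \<times> 'n) set"
    define \<sigma> :: "int \<times> 'n \<Rightarrow> int \<times> 'n" where "\<sigma> = (\<lambda>(a, i). (a - int k, i))"
    \<comment> \<open>At time \<open>k + a\<close> the phase of \<open>x\<close> exceeds
      \<open>L^a (L^k x - w)\<close> by \<open>L^a w\<close>; the origin of the grid absorbs this
      shift.\<close>
    define s :: "int \<times> 'n \<Rightarrow> real" where "s = (\<lambda>(a, i). pow (nat a - k) w $ i)"
    define ext where "ext j = (\<lambda>p\<in>?I'. j (\<sigma> p))" for j :: "int \<times> 'n \<Rightarrow> int"
    define D where "D j = grid_cell \<Lambda> ?I' s K (ext j)" for j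
    have bij: "bij_betw \<sigma> ?I' ?I"
      by (rule bij_betwI[where g = "\<lambda>(a, i). (a + int k, i)"]) (auto simp: \<sigma>_def power_block_def)
    have card: "card ?I' = card ?I" by (rule bij_betw_same_card[OF bij])
    have ext: "ext j \<in> PiE ?I' (\<lambda>_. {0..<int K})" if "j \<in> J" for j
    proof -
      have jP: "j \<in> PiE ?I (\<lambda>_. {0..<int K})" using that J(1) by blast
      have "j (\<sigma> p) \<in> {0..<int K}" if "p \<in> ?I'" for p
        by (rule PiE_mem[OF jP bij_betwE[OF bij, rule_format, OF that]])
      then show ?thesis unfolding ext_def restrict_PiE_iff by blast
    qed
    have inj: "j = j'" if j: "j \<in> J" "j' \<in> J" "ext j = ext j'" for j j'
    proof
      fix q
      show "j q = j' q"
      proof (cases "q \<in> ?I")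
        case True
        then obtain p where "p \<in> ?I'" "q = \<sigma> p"
          using bij unfolding bij_betw_def by (metis imageE)
        then show ?thesis using fun_cong[OF j(3), of p] by (simp add: ext_def)
      next
        case False
        moreover have "j \<in> PiE ?I (\<lambda>_. {0..<int K})" "j' \<in> PiE ?I (\<lambda>_. {0..<int K})"
          using j(1,2) J(1) by blast+
        ultimately show ?thesis by (metis PiE_arb)
      qed
    qed
    have "cell_family k (k + N) J ((1 / real K) ^ card ?I) D"
      unfolding cell_family_def disjoint_family_on_def
    proof (intro conjI ballI impI)
      fix j assume "j \<in> J"
      show "D j \<in> cyls k (k + N)" unfolding D_def by (rule grid_cell_cylinders[OF K(2)])
      show "freq (D j) = (1 / real K) ^ card ?I"
        unfolding D_def card[symmetric]
        by (rule grid_cell_freq[OF finite_power_block nonresonant_power_block K(2)])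
    next
      fix j j' assume j: "j \<in> J" "j' \<in> J" "j \<noteq> j'"
      then have "ext j \<noteq> ext j'" using inj by blast
      then show "D j \<inter> D j' = {}"
        unfolding D_def by (rule grid_cell_disjoint[OF K(2) ext[OF j(1)] ext[OF j(2)]])
    qed
    moreover have "\<exists>z::int \<times> 'n \<Rightarrow> int. \<forall>y. norm (y - (pow k (real_vec x) - w)) \<le> \<delta> \<longrightarrow>
        near_cell ?I K j (\<lambda>(a, i). pow (nat a) y $ i - z (a, i))" if j: "j \<in> J" and x: "x \<in> D j" for j x
    proof -
      obtain z :: "int \<times> 'n \<Rightarrow> int" where z: "\<And>p. p \<in> ?I' \<Longrightarrow> s p + ext j p / K \<le> \<Lambda> p \<bullet> real_vec x - z p"
        "\<And>p. p \<in> ?I' \<Longrightarrow> \<Lambda> p \<bullet> real_vec x - z p < s p + ext j p / K + 1 / K"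
        using x unfolding D_def grid_cell_iff by blast
      show ?thesis
      proof (intro exI[of _ "\<lambda>(a, i). z (a + int k, i)"] allI impI)
        fix y assume y: "norm (y - (pow k (real_vec x) - w)) \<le> \<delta>"
        have "(j (int a, i) - 1) / K \<le> pow a y $ i - z (int a + int k, i) \<and>
            pow a y $ i - z (int a + int k, i) \<le> (j (int a, i) + 2) / K"
          if a: "1 \<le> a" "a \<le> N" for a i
        proof -
          let ?p = "(int (a + k), i)"
          have p: "?p \<in> ?I'" using a by (auto simp: power_block_def)
          have e1: "ext j ?p = j (int a, i)" using p by (simp add: ext_def \<sigma>_def)
          have e2: "s ?p = pow a w $ i" by (simp add: s_def nat_add_distrib)
          have e3: "\<Lambda> ?p \<bullet> real_vec x = pow a (pow k (real_vec x)) $ i"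
            unfolding stacked_powers_inner by (simp add: funpow_add)
          define d where "d = pow a y $ i - (pow a (pow k (real_vec x)) $ i - pow a w $ i)"
          have "d = pow a (y - (pow k (real_vec x) - w)) $ i"
            by (simp add: d_def linear_diff[OF linear_pow])
          then have "\<bar>d\<bar> \<le> norm (pow a (y - (pow k (real_vec x) - w)))"
            using component_le_norm_cart by metis
          also have "\<dots> \<le> b a * norm (y - (pow k (real_vec x) - w))" by (rule b)
          also have "\<dots> \<le> B * \<delta>"
            using y bB[OF a(2)] b(1)[of a] by (intro mult_mono) (auto simp: B less_imp_le)
          finally have "\<bar>d\<bar> \<le> 1 / K" by (simp add: \<delta>)
          then have d: "d \<le> 1 / K" "- d \<le> 1 / K" by (auto simp: abs_le_iff)
          have "j (int a, i) / K \<le> pow a y $ i - d - z (int a + int k, i)"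
            "pow a y $ i - d - z (int a + int k, i) < j (int a, i) / K + 1 / K"
            using z[OF p, unfolded e1 e2 e3] unfolding d_def of_nat_add by (simp_all add: algebra_simps)
          then show ?thesis
            using d by (simp add: add_divide_distrib diff_divide_distrib)
        qed
        moreover have "\<exists>a i. p = (int a, i) \<and> 1 \<le> a \<and> a \<le> N" if "p \<in> ?I" for p
          using power_block_cases[of p 0 N] that by (metis add_0)
        ultimately show "near_cell ?I K j (\<lambda>(a, i). pow (nat a) y $ i - (case (a, i) of (a, i) \<Rightarrow> z (a + int k, i)))"
          unfolding near_cell_def by fastforce
      qed
    qed
    ultimately show ?thesis by blast
  qed
  show ?thesis
    by (intro exI[of _ K] exI[of _ \<delta>] exI[of _ J] conjI K(2) Kh \<delta>(1) finJ card_J J(3) allI cells)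
qed


text \<open>
  The index set \<open>J\<close>, the inner cells \<open>S\<close> and the tolerance \<open>\<delta>\<close> must not depend on the time \<open>k\<close> and
  the translation \<open>w\<close>; only the cells \<open>D\<close> do.
\<close>

definition window_partition ::
    "nat \<Rightarrow> (int ^ 'n) set \<Rightarrow> real \<Rightarrow> real \<Rightarrow> (int \<times> 'n \<Rightarrow> int) set \<Rightarrow> (int \<times> 'n \<Rightarrow> int) set \<Rightarrow> real \<Rightarrow> bool" where
  "window_partition N A e \<delta> J S \<rho> \<longleftrightarrow>
     finite J \<and> S \<subseteq> J \<and> 1 - e \<le> real (card J) * \<rho> \<and>
     (\<forall>k w. \<exists>D. cell_family k (k + N) J \<rho> D \<and>
       (\<forall>j\<in>J. \<forall>x\<in>D j. \<forall>y. norm (real_vec y - (pow k (real_vec x) - w)) \<le> \<delta> \<longrightarrow> (y \<in> A \<longleftrightarrow> j \<in> S)))"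

text \<open>This is what the mixing argument uses of \<open>A\<close>. It passes to complements by
  exchanging \<open>S\<close> for \<open>J - S\<close>.\<close>

definition window_set :: "nat \<Rightarrow> (int ^ 'n) set \<Rightarrow> bool" where
  "window_set N A \<longleftrightarrow> (\<forall>e>0. \<exists>\<delta>>0. \<exists>J S \<rho>. window_partition N A e \<delta> J S \<rho>)"

lemma window_setD: "window_set N A \<Longrightarrow> 0 < e \<Longrightarrow> \<exists>\<delta>>0. \<exists>J S \<rho>. window_partition N A e \<delta> J S \<rho>"
  by (simp add: window_set_def)

lemma window_partition_compl:
  assumes "window_partition N A e \<delta> J S \<rho>"
  shows "window_partition N (- A) e \<delta> J (J - S) \<rho>"
proof -
  have "\<exists>D. cell_family k (k + N) J \<rho> D \<and>
       (\<forall>j\<in>J. \<forall>x\<in>D j. \<forall>y. norm (real_vec y - (pow k (real_vec x) - w)) \<le> \<delta> \<longrightarrow> (y \<in> - A \<longleftrightarrow> j \<in> J - S))" for k w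
  proof -
    obtain D where D: "cell_family k (k + N) J \<rho> D"
       "\<forall>j\<in>J. \<forall>x\<in>D j. \<forall>y. norm (real_vec y - (pow k (real_vec x) - w)) \<le> \<delta> \<longrightarrow> (y \<in> A \<longleftrightarrow> j \<in> S)"
      using assms unfolding window_partition_def by blast
    show ?thesis by (rule exI[of _ D]) (use D in simp)
  qed
  then show ?thesis
    using assms unfolding window_partition_def by blast
qed

lemma window_set_compl: "window_set N A \<Longrightarrow> window_set N (- A)"
  unfolding window_set_def using window_partition_compl by meson

text \<open>\<open>window_cells\<close> applies with \<open>V = G\<close> and with the frontier of
  \<open>G\<close> as \<open>Z\<close>, which is bounded because \<open>G\<close> lies in the unit
  cube.\<close>

lemma window_set_quasiperiodic:
  assumes "A \<in> quasiperiodic_sets (power_block 0 N) \<Lambda>"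
  shows "window_set N A"
proof -
  let ?I = "power_block 0 N :: (int \<times> 'n) set"
  obtain G where G: "G \<subseteq> PiE ?I (\<lambda>_. {0..<1})" "jordan_measurable_on ?I G" and A: "A = quasiperiodic_set ?I G \<Lambda>"
    using assms unfolding quasiperiodic_sets_def by blast
  have null: "real_product ?I frontier_of G \<in> null_sets (Pi\<^sub>M ?I (\<lambda>_. lborel))"
    using G(2) unfolding jordan_measurable_on_def by blast
  have "real_product ?I closure_of G \<subseteq> PiE ?I (\<lambda>_. {0..1})"
  proof (rule closure_of_minimal)
    show "G \<subseteq> PiE ?I (\<lambda>_. {0..1})" using G(1) by (rule order_trans) (intro PiE_mono, auto)
    show "closedin (real_product ?I) (PiE ?I (\<lambda>_. {0..1}))"
      by (simp add: closedin_product_topology)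
  qed
  then have "real_product ?I frontier_of G \<subseteq> PiE ?I (\<lambda>_. {0..1})"
    unfolding frontier_of_def by blast
  then have bd: "\<forall>p\<in>real_product ?I frontier_of G. \<forall>i\<in>?I. \<bar>p i\<bar> \<le> 1"
    by (fastforce simp: PiE_def Pi_def)
  \<comment> \<open>The functions are restricted to \<open>?I\<close> because the members of
    \<open>G\<close> are extensional.\<close>
  have mem: "y \<in> A \<longleftrightarrow> (\<exists>z :: int \<times> 'n \<Rightarrow> int. (\<lambda>p\<in>?I. pow (nat (fst p)) (real_vec y) $ snd p - z p) \<in> G)" for y
  proof -
    have inner: "\<Lambda> p \<bullet> v = pow (nat (fst p)) v $ snd p" if "p \<in> ?I" for p v
    proof -
      have "p = (int (nat (fst p)), snd p)" using that by (auto simp: power_block_def)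
      then show ?thesis using stacked_powers_inner[of L "nat (fst p)" "snd p" v] by simp
    qed
    have "(\<forall>p\<in>?I. \<Lambda> p \<bullet> real_vec y = g p + real_of_int (z p)) \<longleftrightarrow>
        (\<lambda>p\<in>?I. pow (nat (fst p)) (real_vec y) $ snd p - z p) = g" if "g \<in> G" for g z
    proof -
      have ext: "g \<in> extensional ?I" using G(1) that by (auto simp: PiE_def)
      show ?thesis
      proof
        assume *: "\<forall>p\<in>?I. \<Lambda> p \<bullet> real_vec y = g p + real_of_int (z p)"
        show "(\<lambda>p\<in>?I. pow (nat (fst p)) (real_vec y) $ snd p - z p) = g"
          by (rule extensionalityI[OF restrict_extensional ext]) (use * inner in force)
      next
        assume eq: "(\<lambda>p\<in>?I. pow (nat (fst p)) (real_vec y) $ snd p - z p) = g"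
        show "\<forall>p\<in>?I. \<Lambda> p \<bullet> real_vec y = g p + real_of_int (z p)"
        proof
          fix p assume "p \<in> ?I"
          then show "\<Lambda> p \<bullet> real_vec y = g p + real_of_int (z p)"
            using fun_cong[OF eq, of p] by (simp add: inner)
        qed
      qed
    qed
    then have "y \<in> A \<longleftrightarrow> (\<exists>g\<in>G. \<exists>z :: int \<times> 'n \<Rightarrow> int.
        (\<lambda>p\<in>?I. pow (nat (fst p)) (real_vec y) $ snd p - z p) = g)"
      unfolding A quasiperiodic_set_def mem_Collect_eq by (simp cong: bex_cong)
    then show ?thesis by blast
  qed
  show ?thesis
    unfolding window_set_def
  proof (intro allI impI)
    fix e :: real assume e: "e > 0"
    obtain K \<delta> J where K: "K \<ge> 1" "\<delta> > 0" "finite J"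
      "1 - e \<le> card J * (1 / real K) ^ card ?I"
      "\<forall>j\<in>J. \<forall>z::int \<times> 'n \<Rightarrow> int. \<forall>(u :: int \<times> 'n \<Rightarrow> real) (v :: int \<times> 'n \<Rightarrow> real). near_cell ?I K j u \<longrightarrow> near_cell ?I K j v \<longrightarrow>
         ((\<lambda>i\<in>?I. u i - z i) \<in> G \<longleftrightarrow> (\<lambda>i\<in>?I. v i - z i) \<in> G)"
      "\<forall>k w. \<exists>D. cell_family k (k + N) J ((1 / real K) ^ card ?I) D \<and>
        (\<forall>j\<in>J. \<forall>x\<in>D j. \<exists>z::int \<times> 'n \<Rightarrow> int. \<forall>y. norm (y - (pow k (real_vec x) - w)) \<le> \<delta> \<longrightarrow>
          near_cell ?I K j (\<lambda>(a, i). pow (nat a) y $ i - z (a, i)))"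
      using window_cells[OF closedin_frontier_of null bd order_refl e zero_less_one] by blast
    \<comment> \<open>By the choice of \<open>J\<close>, a single point of the enlarged cell in an
      integer translate of \<open>G\<close> decides for all its points.\<close>
    define S where "S = {j \<in> J. \<exists>u (z :: int \<times> 'n \<Rightarrow> int). near_cell ?I K j u \<and> (\<lambda>p\<in>?I. u p - z p) \<in> G}"
    have "\<exists>D. cell_family k (k + N) J ((1 / real K) ^ card ?I) D \<and>
       (\<forall>j\<in>J. \<forall>x\<in>D j. \<forall>y. norm (real_vec y - (pow k (real_vec x) - w)) \<le> \<delta> \<longrightarrow> (y \<in> A \<longleftrightarrow> j \<in> S))" for k w
    proof -
      obtain D where D: "cell_family k (k + N) J ((1 / real K) ^ card ?I) D"
        "\<And>j x. j \<in> J \<Longrightarrow> x \<in> D j \<Longrightarrow> \<exists>z::int \<times> 'n \<Rightarrow> int. \<forall>y. norm (y - (pow k (real_vec x) - w)) \<le> \<delta> \<longrightarrow>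
          near_cell ?I K j (\<lambda>(a, i). pow (nat a) y $ i - z (a, i))"
        using K(6)[rule_format, of k w] by blast
      have "y \<in> A \<longleftrightarrow> j \<in> S"
        if j: "j \<in> J" "x \<in> D j" and y: "norm (real_vec y - (pow k (real_vec x) - w)) \<le> \<delta>" for j x y
      proof -
        obtain z :: "int \<times> 'n \<Rightarrow> int" where z: "near_cell ?I K j (\<lambda>(a, i). pow (nat a) (real_vec y) $ i - z (a, i))"
          using D(2)[OF j] y by blast
        define v where "v p = pow (nat (fst p)) (real_vec y) $ snd p - z p" for p
        have v: "near_cell ?I K j v"
          using z unfolding v_def by (simp add: case_prod_unfold)
        show ?thesis
        proof
          assume "y \<in> A"
          then obtain z' :: "int \<times> 'n \<Rightarrow> int" where
            "(\<lambda>p\<in>?I. pow (nat (fst p)) (real_vec y) $ snd p - z' p) \<in> G" using mem by blast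
          then have "(\<lambda>p\<in>?I. v p - (z' p - z p)) \<in> G"
            by (simp add: v_def)
          then show "j \<in> S" unfolding S_def using v j(1) of_int_diff
            by (intro CollectI conjI exI[of _ v] exI[of _ "\<lambda>p. z' p - z p"]) simp_all
        next
          assume "j \<in> S"
          then obtain u and z' :: "int \<times> 'n \<Rightarrow> int" where u: "near_cell ?I K j u" "(\<lambda>p\<in>?I. u p - z' p) \<in> G"
            by (auto simp: S_def)
          then have "(\<lambda>p\<in>?I. v p - z' p) \<in> G" using K(5)[rule_format, OF j(1) u(1) v, of z'] by blast
          then have "(\<lambda>p\<in>?I. pow (nat (fst p)) (real_vec y) $ snd p - (z p + z' p)) \<in> G"
            by (simp add: v_def diff_diff_eq)
          then show "y \<in> A"
            unfolding mem by (intro exI[of _ "\<lambda>p. z p + z' p"]) simp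
        qed
      qed
      then show ?thesis using D(1) by blast
    qed
    then have "window_partition N A e \<delta> J S ((1 / real K) ^ card ?I)"
      unfolding window_partition_def using K(3,4) by (intro conjI allI) (auto simp: S_def)
    then show "\<exists>\<delta>>0. \<exists>J S \<rho>. window_partition N A e \<delta> J S \<rho>" using K(2) by blast
  qed
qed

text \<open>On a kept cell with corner \<open>u0 = j / K\<close>, the vector \<open>L y\<close>
  minus a suitable integer vector stays near \<open>u0\<close>, and there \<open>R\<close> has the
  constant value \<open>z0\<close>. So \<open>T y\<close> is \<open>L y - (u0 - z0)\<close> up to
  the mesh, and the new translation is \<open>L w + u0 - z0\<close>.\<close>

lemma quantizer_window:
  fixes R :: "real ^ 'n \<Rightarrow> int ^ 'n"
  assumes R: "quantizer R" and e: "e > 0" and h: "h > 0"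
  shows "\<exists>\<delta>>0. \<exists>(J :: (int \<times> 'n \<Rightarrow> int) set) \<rho>::real.
     finite J \<and> 1 - e \<le> real (card J) * \<rho> \<and>
     (\<forall>k w. \<exists>D. cell_family k (Suc k) J \<rho> D \<and>
       (\<forall>j\<in>J. \<exists>w'. \<forall>x\<in>D j. \<forall>y. norm (real_vec y - (pow k (real_vec x) - w)) \<le> \<delta> \<longrightarrow>
         norm (real_vec (discretization R L y) - (pow (Suc k) (real_vec x) - w')) \<le> h))"
proof -
  let ?I = "power_block 0 1 :: (int \<times> 'n) set"
  have I: "?I = {1} \<times> UNIV" by (auto simp: power_block_def)
  define V where "V = {v \<in> PiE ?I (\<lambda>_. UNIV). R (coords_vec v 1) = 0}"
  define Z where "Z = {v \<in> PiE ?I (\<lambda>_. UNIV). coords_vec v 1 \<in> frontier (R -` {0})}"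
  have "jordan_measurable (R -` {0})" using R by (simp add: quantizer_def)
  note fr = coords_vec_frontier[OF this, where c = "1::int", folded I, folded Z_def]
  have VZ: "real_product ?I frontier_of V \<subseteq> Z" using fr(4) by (simp add: V_def)
  obtain c where c: "\<forall>p\<in>Z. \<forall>i\<in>?I. \<bar>p i\<bar> \<le> c" using fr(3) by blast
  define n where "n = real CARD('n)"
  have n: "n > 0" by (simp add: n_def)
  \<comment> \<open>The distance from the corner is at most \<open>2 / K\<close> in each of the
    \<open>n\<close> coordinates, so a mesh of at most \<open>h'\<close> makes it at most
    \<open>h / 2\<close> in norm. The other half of \<open>h\<close> is left for \<open>L\<close>
    applied to the error of \<open>y\<close>, see \<open>d\<close>.\<close>
  define h' where "h' = h / (4 * n)"
  have h': "h' > 0" "n * (2 * h') = h / 2" using h n by (auto simp: h'_def)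
  obtain K \<delta> J where K: "K \<ge> 1" "1 / real K \<le> h'" "\<delta> > 0" "finite J"
    "1 - e \<le> card J * (1 / real K) ^ card ?I"
    "\<forall>j\<in>J. \<forall>z::int \<times> 'n \<Rightarrow> int. \<forall>(u :: int \<times> 'n \<Rightarrow> real) (v :: int \<times> 'n \<Rightarrow> real). near_cell ?I K j u \<longrightarrow> near_cell ?I K j v \<longrightarrow>
       ((\<lambda>i\<in>?I. u i - z i) \<in> V \<longleftrightarrow> (\<lambda>i\<in>?I. v i - z i) \<in> V)"
    "\<forall>k w. \<exists>D. cell_family k (k + 1) J ((1 / real K) ^ card ?I) D \<and>
      (\<forall>j\<in>J. \<forall>x\<in>D j. \<exists>z::int \<times> 'n \<Rightarrow> int. \<forall>y. norm (y - (pow k (real_vec x) - w)) \<le> \<delta> \<longrightarrow>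
        near_cell ?I K j (\<lambda>(a, i). pow (nat a) y $ i - z (a, i)))"
    using window_cells[OF fr(1,2) c VZ e h'(1)] by blast
  obtain B where B: "B > 0" "\<And>v. norm (L *v v) \<le> B * norm v"
    using linear_bounded_pos[OF matrix_vector_mul_linear[of L]] by blast
  define d where "d = min \<delta> (h / (2 * B))"
  have d: "d > 0" "d \<le> \<delta>" "B * d \<le> h / 2"
    using K(3) h B by (auto simp: d_def min_def field_simps)
  have R_shift: "R (u + real_vec z) = R u + z" for u z using R by (simp add: quantizer_def)
  have R_unique: "R u = z \<longleftrightarrow> R (u - real_vec z) = 0" for u z
    using R_shift[of "u - real_vec z" z] by auto
  have "\<exists>D. cell_family k (Suc k) J ((1 / real K) ^ card ?I) D \<and>
      (\<forall>j\<in>J. \<exists>w'. \<forall>x\<in>D j. \<forall>y. norm (real_vec y - (pow k (real_vec x) - w)) \<le> d \<longrightarrow>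
         norm (real_vec (discretization R L y) - (pow (Suc k) (real_vec x) - w')) \<le> h)" for k w
  proof -
    obtain D where D: "cell_family k (Suc k) J ((1 / real K) ^ card ?I) D"
      "\<And>j x. j \<in> J \<Longrightarrow> x \<in> D j \<Longrightarrow> \<exists>z::int \<times> 'n \<Rightarrow> int. \<forall>y. norm (y - (pow k (real_vec x) - w)) \<le> \<delta> \<longrightarrow>
        near_cell ?I K j (\<lambda>(a, i). pow (nat a) y $ i - z (a, i))"
      using K(7)[rule_format, of k w] by auto
    have "\<exists>w'. \<forall>x\<in>D j. \<forall>y. norm (real_vec y - (pow k (real_vec x) - w)) \<le> d \<longrightarrow>
         norm (real_vec (discretization R L y) - (pow (Suc k) (real_vec x) - w')) \<le> h" if j: "j \<in> J" for j
    proof -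
      define v0 :: "int \<times> 'n \<Rightarrow> real" where "v0 p = j p / K" for p
      have v0: "near_cell ?I K j v0" by (auto simp: near_cell_def v0_def intro!: divide_right_mono)
      define u0 :: "real ^ 'n" where "u0 = coords_vec v0 1"
      define z0 where "z0 = R u0"
      show ?thesis
      proof (intro exI[of _ "L *v w + u0 - real_vec z0"] ballI allI impI)
        fix x y assume x: "x \<in> D j" and y: "norm (real_vec y - (pow k (real_vec x) - w)) \<le> d"
        obtain z :: "int \<times> 'n \<Rightarrow> int" where z: "near_cell ?I K j (\<lambda>(a, i). pow (nat a) (real_vec y) $ i - z (a, i))"
          using D(2)[OF j x] y d(2) by (meson order_trans)
        define v where "v = (\<lambda>(a, i). pow (nat a) (real_vec y) $ i - z (a, i))"
        have v: "near_cell ?I K j v" using z by (simp add: v_def)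
        define zv :: "int ^ 'n" where "zv = (\<chi> i. z (1, i))"
        have u: "coords_vec v 1 = L *v real_vec y - real_vec zv"
          by (simp add: coords_vec_def v_def zv_def real_vec_def vec_eq_iff)
        have coords: "coords_vec (\<lambda>p\<in>?I. s p - z0 $ snd p) 1 = coords_vec s 1 - real_vec z0"
          for s :: "int \<times> 'n \<Rightarrow> real"
          by (simp add: coords_vec_def real_vec_def vec_eq_iff power_block_def)
        have memV: "(\<lambda>p\<in>?I. s p - z0 $ snd p) \<in> V \<longleftrightarrow> R (coords_vec s 1) = z0"
          for s :: "int \<times> 'n \<Rightarrow> real"
          unfolding V_def mem_Collect_eq coords R_unique[of "coords_vec s 1" z0] by simp
        have "R (coords_vec v 1) = z0"
          using K(6)[rule_format, OF j v0 v, of "\<lambda>p. z0 $ snd p"] unfolding memV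
          by (simp add: z0_def u0_def)
        then have "R (L *v real_vec y) = z0 + zv"
          using R_shift[of "coords_vec v 1" zv] by (simp add: u)
        then have T: "real_vec (discretization R L y) = real_vec z0 + real_vec zv"
          by (simp add: discretization_def real_vec_add)
        have "norm (u0 - coords_vec v 1) \<le> (\<Sum>i\<in>UNIV. \<bar>(u0 - coords_vec v 1) $ i\<bar>)"
          by (rule norm_le_l1_cart)
        also have "\<dots> \<le> of_nat (card (UNIV :: 'n set)) * (2 * h')"
        proof (rule sum_bounded_above)
          fix i
          have "(real_of_int (j (1, i)) - 1) / K \<le> v (1, i)" "v (1, i) \<le> (real_of_int (j (1, i)) + 2) / K"
            using v by (auto simp: near_cell_def power_block_def)
          then have "\<bar>v0 (1, i) - v (1, i)\<bar> \<le> 2 * (1 / K)"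
            by (simp add: v0_def abs_le_iff add_divide_distrib diff_divide_distrib)
          also have "\<dots> \<le> 2 * h'" using K(2) by simp
          finally show "\<bar>(u0 - coords_vec v 1) $ i\<bar> \<le> 2 * h'"
            by (simp add: u0_def coords_vec_def)
        qed
        finally have 1: "norm (u0 - coords_vec v 1) \<le> h / 2" using h' by (simp add: n_def)
        have "norm (L *v (real_vec y - (pow k (real_vec x) - w))) \<le> B * d"
          using B y by (meson mult_left_mono less_imp_le order_trans)
        then have 2: "norm (L *v (real_vec y - (pow k (real_vec x) - w))) \<le> h / 2" using d(3) by simp
        have "real_vec (discretization R L y) - (pow (Suc k) (real_vec x) - (L *v w + u0 - real_vec z0))
            = L *v (real_vec y - (pow k (real_vec x) - w)) + (u0 - coords_vec v 1)"
          unfolding T u by (simp add: matrix_vector_mult_diff_distrib matrix_vector_right_distrib)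
        also have "norm \<dots> \<le> h / 2 + h / 2"
          by (rule norm_triangle_mono[OF 2 1])
        finally show "norm (real_vec (discretization R L y) - (pow (Suc k) (real_vec x) - (L *v w + u0 - real_vec z0))) \<le> h"
          by simp
      qed
    qed
    then show ?thesis using D(1) by blast
  qed
  then show ?thesis
    using d(1) K(4,5) by (intro exI[of _ d] exI[of _ J] exI[of _ "(1 / real K) ^ card ?I"] conjI allI) auto
qed


section \<open>Approximation of orbits on cylinder sets\<close>

definition partial_partition :: "nat \<Rightarrow> real \<Rightarrow> (int ^ 'n) set set \<Rightarrow> bool" where
  "partial_partition k e \<C> \<longleftrightarrow>
     finite \<C> \<and> \<C> \<subseteq> cyls 0 k \<and> disjoint \<C> \<and> 1 - e \<le> freq (\<Union>\<C>)"

definition orbit_affine_on :: "(int ^ 'n \<Rightarrow> int ^ 'n) \<Rightarrow> nat \<Rightarrow> real \<Rightarrow> (int ^ 'n) set \<Rightarrow> real ^ 'n \<Rightarrow> bool" where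
  "orbit_affine_on T k h C w \<longleftrightarrow> (\<forall>x\<in>C. norm (real_vec ((T ^^ k) x) - (pow k (real_vec x) - w)) \<le> h)"

lemma partial_partition_freq: "partial_partition k e \<C> \<Longrightarrow> freq_measurable (\<Union>\<C>)"
  unfolding partial_partition_def using freq_Union_cyls(1) by blast

lemma UNIV_partial_partition: "e > 0 \<Longrightarrow> partial_partition 0 e {UNIV}"
  using UNIV_in_cylinders[of \<Lambda>] by (simp add: partial_partition_def power_block_def freq_UNIV)

lemma partial_partition_refine:
  fixes \<rho> :: real
  assumes "partial_partition k e \<C>" "k \<le> m" "finite J" "1 - e \<le> card J * \<rho>" "0 < e" "e \<le> 1"
    and D: "\<forall>C\<in>\<C>. cell_family k m J \<rho> (D C)"
  shows "partial_partition m (2 * e) ((\<lambda>(C, j). C \<inter> D C j) ` (\<C> \<times> J))"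
proof -
  have \<C>: "finite \<C>" "\<C> \<subseteq> cyls 0 k" "disjoint \<C>" "1 - e \<le> freq (\<Union>\<C>)"
    using assms(1) by (auto simp: partial_partition_def)
  note ref = cell_family_refine[OF \<C>(1-3) assms(2,3) D]
  have "(1 - e) * (1 - e) \<le> freq (\<Union>\<C>) * (card J * \<rho>)"
    using \<C>(4) assms(4,6) by (intro mult_mono) auto
  moreover have "1 - 2 * e \<le> (1 - e) * (1 - e)" by (simp add: algebra_simps)
  ultimately show ?thesis
    unfolding partial_partition_def using ref by simp
qed

text \<open>For the wanted accuracy \<open>h\<close>, the quantizer step prescribes a tolerance
  \<open>\<delta>\<close> one step earlier, and the induction hypothesis is used with that
  \<open>\<delta>\<close>; hence the induction with arbitrary \<open>e\<close> and
  \<open>h\<close>.\<close>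

lemma orbit_approximation:
  fixes R :: "real ^ 'n \<Rightarrow> int ^ 'n"
  assumes R: "quantizer R" and T: "T = discretization R L"
  shows "0 < e \<Longrightarrow> 0 < h \<Longrightarrow> \<exists>\<C>. partial_partition k e \<C> \<and> (\<forall>C\<in>\<C>. \<exists>w. orbit_affine_on T k h C w)"
proof (induction k arbitrary: e h)
  case 0
  have "orbit_affine_on T 0 h UNIV 0" using 0 by (simp add: orbit_affine_on_def)
  then show ?case using UNIV_partial_partition[OF 0(1)] by blast
next
  case (Suc k)
  \<comment> \<open>A refinement doubles the uncovered part; the bound 1 keeps the factors in the
    estimate of \<open>partial_partition_refine\<close> nonnegative.\<close>
  define e' where "e' = min 1 (e / 2)"
  have e': "0 < e'" "e' \<le> 1" "2 * e' \<le> e" using Suc.prems by (auto simp: e'_def)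
  obtain \<delta> \<rho> and J :: "(int \<times> 'n \<Rightarrow> int) set" where \<delta>: "\<delta> > 0" "finite J" "1 - e' \<le> real (card J) * \<rho>"
    "\<forall>k w. \<exists>D. cell_family k (Suc k) J \<rho> D \<and>
       (\<forall>j\<in>J. \<exists>w'. \<forall>x\<in>D j. \<forall>y. norm (real_vec y - (pow k (real_vec x) - w)) \<le> \<delta> \<longrightarrow>
         norm (real_vec (discretization R L y) - (pow (Suc k) (real_vec x) - w')) \<le> h)"
    using quantizer_window[OF R e'(1) Suc.prems(2)] by blast
  obtain \<C> where \<C>: "partial_partition k e' \<C>" "\<forall>C\<in>\<C>. \<exists>w. orbit_affine_on T k \<delta> C w"
    using Suc.IH[OF e'(1) \<delta>(1)] by blast
  obtain w where w: "\<forall>C\<in>\<C>. orbit_affine_on T k \<delta> C (w C)"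
    using bchoice[OF \<C>(2)] by blast
  have "\<forall>C. \<exists>D. cell_family k (Suc k) J \<rho> D \<and>
       (\<forall>j\<in>J. \<exists>w'. \<forall>x\<in>D j. \<forall>y. norm (real_vec y - (pow k (real_vec x) - w C)) \<le> \<delta> \<longrightarrow>
         norm (real_vec (discretization R L y) - (pow (Suc k) (real_vec x) - w')) \<le> h)"
    using \<delta>(4) by blast
  from choice[OF this] obtain D where D: "\<forall>C. cell_family k (Suc k) J \<rho> (D C) \<and>
       (\<forall>j\<in>J. \<exists>w'. \<forall>x\<in>D C j. \<forall>y. norm (real_vec y - (pow k (real_vec x) - w C)) \<le> \<delta> \<longrightarrow>
         norm (real_vec (discretization R L y) - (pow (Suc k) (real_vec x) - w')) \<le> h)" ..
  define \<E> where "\<E> = (\<lambda>(C, j). C \<inter> D C j) ` (\<C> \<times> J)"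
  have "partial_partition (Suc k) (2 * e') \<E>"
    unfolding \<E>_def using \<C>(1) \<delta>(2,3) e' D by (intro partial_partition_refine) auto
  then have "partial_partition (Suc k) e \<E>"
    using e'(3) by (auto simp: partial_partition_def)
  moreover have "\<exists>w'. orbit_affine_on T (Suc k) h E w'" if "E \<in> \<E>" for E
  proof -
    obtain C j where E: "C \<in> \<C>" "j \<in> J" "E = C \<inter> D C j" using \<open>E \<in> \<E>\<close> by (auto simp: \<E>_def)
    obtain w' where w': "\<And>x y. x \<in> D C j \<Longrightarrow> norm (real_vec y - (pow k (real_vec x) - w C)) \<le> \<delta> \<Longrightarrow>
         norm (real_vec (discretization R L y) - (pow (Suc k) (real_vec x) - w')) \<le> h"
      using D E(2) by blast
    have "orbit_affine_on T (Suc k) h E w'"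
      unfolding orbit_affine_on_def
    proof
      fix x assume "x \<in> E"
      then have x: "x \<in> C" "x \<in> D C j" by (auto simp: E)
      have "norm (real_vec ((T ^^ k) x) - (pow k (real_vec x) - w C)) \<le> \<delta>"
        using w E(1) x(1) by (auto simp: orbit_affine_on_def)
      from w'[OF x(2) this] show "norm (real_vec ((T ^^ Suc k) x) - (pow (Suc k) (real_vec x) - w')) \<le> h"
        by (simp add: T)
    qed
    then show ?thesis by blast
  qed
  ultimately show ?case by blast
qed

section \<open>Tame sets\<close>

text \<open>A Jordan condition relative to frequency: the phases at times 1 to \<open>k\<close>
  decide membership up to arbitrarily small frequency.\<close>

definition tame :: "nat \<Rightarrow> (int ^ 'n) set \<Rightarrow> bool" where
  "tame k X \<longleftrightarrow> (\<forall>e>0. \<exists>\<C>. partial_partition k e \<C> \<and> (\<forall>C\<in>\<C>. C \<subseteq> X \<or> C \<inter> X = {}))"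

lemma tameD: "tame k X \<Longrightarrow> 0 < e \<Longrightarrow> \<exists>\<C>. partial_partition k e \<C> \<and> (\<forall>C\<in>\<C>. C \<subseteq> X \<or> C \<inter> X = {})"
  by (simp add: tame_def)

lemma tame_mono: "tame k X \<Longrightarrow> k \<le> m \<Longrightarrow> tame m X"
proof -
  assume "tame k X" "k \<le> m"
  moreover from \<open>k \<le> m\<close> have "cyls 0 k \<subseteq> cyls 0 m" by (intro cylinders_mono power_block_mono)
  ultimately show ?thesis unfolding tame_def partial_partition_def by (meson order_trans)
qed

lemma Union_Int_image: "\<Union>((\<lambda>(C, D). C \<inter> D) ` (\<C> \<times> \<D>)) = \<Union>\<C> \<inter> \<Union>\<D>"
  by auto

lemma disjoint_Int_image:
  assumes "disjoint \<C>" "disjoint \<D>"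
  shows "disjoint ((\<lambda>(C, D). C \<inter> D) ` (\<C> \<times> \<D>))"
  unfolding disjoint_def
proof (intro ballI impI)
  fix a b assume "a \<in> (\<lambda>(C, D). C \<inter> D) ` (\<C> \<times> \<D>)" "b \<in> (\<lambda>(C, D). C \<inter> D) ` (\<C> \<times> \<D>)" "a \<noteq> b"
  then obtain C D C' D' where *: "C \<in> \<C>" "D \<in> \<D>" "a = C \<inter> D" "C' \<in> \<C>" "D' \<in> \<D>" "b = C' \<inter> D'" by auto
  then have "C \<noteq> C' \<or> D \<noteq> D'" using \<open>a \<noteq> b\<close> by blast
  then have "C \<inter> C' = {} \<or> D \<inter> D' = {}"
    using disjointD[OF assms(1) *(1,4)] disjointD[OF assms(2) *(2,5)] by blast
  then show "a \<inter> b = {}" using * by blast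
qed

lemma partial_partition_Int:
  assumes "partial_partition k e \<C>" "partial_partition k e' \<D>"
  shows "partial_partition k (e + e') ((\<lambda>(C, D). C \<inter> D) ` (\<C> \<times> \<D>))"
proof -
  let ?E = "(\<lambda>(C, D). C \<inter> D) ` (\<C> \<times> \<D>)"
  have fin: "finite ?E" using assms by (simp add: partial_partition_def)
  have sub: "?E \<subseteq> cyls 0 k" using assms by (auto simp: partial_partition_def intro!: cylinders_Int)
  have dis: "disjoint ?E" using assms by (intro disjoint_Int_image) (auto simp: partial_partition_def)
  note meas = assms[THEN partial_partition_freq]
  have "freq (UNIV :: (int ^ 'n) set) \<le> freq (\<Union>?E) + freq (- \<Union>\<C>) + freq (- \<Union>\<D>)"
    by (rule freq_le_cover) (auto intro: freq_UNIV freq_Compl meas freq_Union_cyls(1)[OF fin sub dis])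
  then have "1 - (e + e') \<le> freq (\<Union>?E)"
    using assms freq_Compl(2)[OF meas(1)] freq_Compl(2)[OF meas(2)] by (auto simp: freq_UNIV partial_partition_def)
  then show ?thesis unfolding partial_partition_def using fin sub dis by blast
qed

lemma tame_Int:
  assumes "tame k X" "tame k Y"
  shows "tame k (X \<inter> Y)"
  unfolding tame_def
proof (intro allI impI)
  fix e :: real assume "e > 0"
  then have e: "e / 2 > 0" by simp
  obtain \<C> where \<C>: "partial_partition k (e / 2) \<C>" "\<forall>C\<in>\<C>. C \<subseteq> X \<or> C \<inter> X = {}"
    using tameD[OF assms(1) e] by blast
  obtain \<D> where \<D>: "partial_partition k (e / 2) \<D>" "\<forall>C\<in>\<D>. C \<subseteq> Y \<or> C \<inter> Y = {}"
    using tameD[OF assms(2) e] by blast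
  have "partial_partition k e ((\<lambda>(C, D). C \<inter> D) ` (\<C> \<times> \<D>))"
    using partial_partition_Int[OF \<C>(1) \<D>(1)] by simp
  moreover have "\<forall>E\<in>(\<lambda>(C, D). C \<inter> D) ` (\<C> \<times> \<D>). E \<subseteq> X \<inter> Y \<or> E \<inter> (X \<inter> Y) = {}"
    using \<C>(2) \<D>(2) by fastforce
  ultimately show "\<exists>\<C>. partial_partition k e \<C> \<and> (\<forall>C\<in>\<C>. C \<subseteq> X \<inter> Y \<or> C \<inter> (X \<inter> Y) = {})" by blast
qed

text \<open>Cells inside \<open>X\<close> bound its density from below, cells outside it from above.
  The uncovered part costs \<open>e / 3\<close>, and each of the two limits another
  \<open>e / 3\<close>.\<close>

lemma tame_freq_measurable:
  assumes "tame k X"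
  shows "freq_measurable X"
proof (rule freq_measurable_if_between)
  fix e :: real assume e: "e > 0"
  then have e3: "e / 3 > 0" by simp
  obtain \<C> where \<C>: "partial_partition k (e / 3) \<C>" "\<forall>C\<in>\<C>. C \<subseteq> X \<or> C \<inter> X = {}"
    using tameD[OF assms e3] by blast
  define U where "U = \<Union>{C \<in> \<C>. C \<subseteq> X}"
  define V where "V = \<Union>{C \<in> \<C>. \<not> C \<subseteq> X}"
  have meas: "freq_measurable (\<Union>\<D>)" if "\<D> \<subseteq> \<C>" for \<D>
    using \<C>(1) that unfolding partial_partition_def
    by (intro freq_Union_cyls) (auto intro: finite_subset pairwise_subset)
  have U: "freq_measurable U" and V: "freq_measurable V" unfolding U_def V_def by (intro meas; auto)+
  have UV: "\<Union>\<C> = U \<union> V" "U \<subseteq> X" "V \<inter> X = {}" using \<C>(2) by (auto simp: U_def V_def)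
  have "freq (\<Union>\<C>) = freq U + freq V"
    unfolding UV(1) using UV by (intro freq_Un U V) blast
  then have fr: "1 - e / 3 \<le> freq U + freq V" using \<C>(1) by (simp add: partial_partition_def)
  have "\<forall>\<^sub>F P in box_filter. freq U - e / 3 < box_density U P"
    using e by (intro order_tendstoD(1)[OF tendsto_freq[OF U]]) simp
  then have 1: "\<forall>\<^sub>F P in box_filter. freq U - e / 3 \<le> box_density X P"
    using eventually_finite_box
  proof eventually_elim
    case (elim P)
    then show ?case using box_density_mono[OF elim(2) UV(2)] by linarith
  qed
  have "\<forall>\<^sub>F P in box_filter. freq V - e / 3 < box_density V P"
    using e by (intro order_tendstoD(1)[OF tendsto_freq[OF V]]) simp
  then have 2: "\<forall>\<^sub>F P in box_filter. box_density X P \<le> 1 - freq V + e / 3"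
    using eventually_finite_box
  proof eventually_elim
    case (elim P)
    have "box_density (V \<union> X) P = box_density V P + box_density X P"
      by (rule box_density_Un[OF elim(2) UV(3)])
    then show ?case using elim(1) box_density_le_1[of "V \<union> X" P] by linarith
  qed
  have "1 - freq V + e / 3 \<le> (freq U - e / 3) + e" using fr by linarith
  then show "\<exists>a b. b \<le> a + e \<and> (\<forall>\<^sub>F P in box_filter. a \<le> box_density X P) \<and>
      (\<forall>\<^sub>F P in box_filter. box_density X P \<le> b)"
    using 1 2 by blast
qed

section \<open>Independence and mixing\<close>

text \<open>On each cylinder \<open>C\<close> the orbit is \<open>L^k x - w\<close> up to
  \<open>\<delta>\<close>; the window cells for this \<open>k\<close> and \<open>w\<close> then
  decide whether \<open>T^k x\<close> lies in \<open>A\<close>. They constrain only the times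
  \<open>k + 1\<close> to \<open>k + N\<close>, so they are independent of \<open>C\<close>.\<close>

lemma tame_vimage:
  fixes R :: "real ^ 'n \<Rightarrow> int ^ 'n"
  assumes R: "quantizer R" and T: "T = discretization R L" and A: "window_set N A"
  shows "tame (k + N) ((T ^^ k) -` A)"
  unfolding tame_def
proof (intro allI impI)
  fix e :: real assume "e > 0"
  define e' where "e' = min 1 (e / 2)"
  have e': "0 < e'" "e' \<le> 1" "2 * e' \<le> e" using \<open>e > 0\<close> by (auto simp: e'_def)
  obtain \<delta> J S \<rho> where \<delta>: "\<delta> > 0" "window_partition N A e' \<delta> J S \<rho>"
    using window_setD[OF A e'(1)] by blast
  then have J: "finite J" "1 - e' \<le> real (card J) * \<rho>"
    "\<And>k w. \<exists>D. cell_family k (k + N) J \<rho> D \<and>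
       (\<forall>j\<in>J. \<forall>x\<in>D j. \<forall>y. norm (real_vec y - (pow k (real_vec x) - w)) \<le> \<delta> \<longrightarrow> (y \<in> A \<longleftrightarrow> j \<in> S))"
    unfolding window_partition_def by blast+
  obtain \<C> where \<C>: "partial_partition k e' \<C>" "\<forall>C\<in>\<C>. \<exists>w. orbit_affine_on T k \<delta> C w"
    using orbit_approximation[OF R T e'(1) \<delta>(1)] by blast
  obtain w where w: "\<forall>C\<in>\<C>. orbit_affine_on T k \<delta> C (w C)"
    using bchoice[OF \<C>(2)] by blast
  have "\<forall>C. \<exists>D. cell_family k (k + N) J \<rho> D \<and>
       (\<forall>j\<in>J. \<forall>x\<in>D j. \<forall>y. norm (real_vec y - (pow k (real_vec x) - w C)) \<le> \<delta> \<longrightarrow> (y \<in> A \<longleftrightarrow> j \<in> S))"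
    using J(3) by blast
  from choice[OF this] obtain D where D: "\<forall>C. cell_family k (k + N) J \<rho> (D C) \<and>
       (\<forall>j\<in>J. \<forall>x\<in>D C j. \<forall>y. norm (real_vec y - (pow k (real_vec x) - w C)) \<le> \<delta> \<longrightarrow> (y \<in> A \<longleftrightarrow> j \<in> S))" ..
  define \<E> where "\<E> = (\<lambda>(C, j). C \<inter> D C j) ` (\<C> \<times> J)"
  have "partial_partition (k + N) (2 * e') \<E>"
    unfolding \<E>_def using \<C>(1) J(1,2) e' D by (intro partial_partition_refine) auto
  then have "partial_partition (k + N) e \<E>"
    using e'(3) by (auto simp: partial_partition_def)
  moreover have "E \<subseteq> (T ^^ k) -` A \<or> E \<inter> (T ^^ k) -` A = {}" if "E \<in> \<E>" for E
  proof -
    obtain C j where E: "C \<in> \<C>" "j \<in> J" "E = C \<inter> D C j" using \<open>E \<in> \<E>\<close> by (auto simp: \<E>_def)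
    have "(T ^^ k) x \<in> A \<longleftrightarrow> j \<in> S" if "x \<in> E" for x
      using D w E that unfolding orbit_affine_on_def by blast
    then show ?thesis by blast
  qed
  ultimately show "\<exists>\<C>. partial_partition (k + N) e \<C> \<and> (\<forall>C\<in>\<C>. C \<subseteq> (T ^^ k) -` A \<or> C \<inter> (T ^^ k) -` A = {})"
    by blast
qed

lemma window_set_tame:
  assumes "quantizer (R :: real ^ 'n \<Rightarrow> int ^ 'n)" "window_set N A"
  shows "tame N A"
  using tame_vimage[OF assms(1) refl assms(2), of 0] by (simp add: vimage_def)

text \<open>Inside every cylinder of \<open>X\<close> on which the orbit is controlled, the cells in
  \<open>S\<close> form the same share \<open>b = card S * \<rho>\<close> and are sent into
  \<open>A\<close>. It remains to compare \<open>b\<close> with \<open>freq A\<close>.\<close>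

lemma freq_Int_vimage_ge:
  fixes R :: "real ^ 'n \<Rightarrow> int ^ 'n"
  assumes R: "quantizer R" and T: "T = discretization R L" and A: "window_set N A" and X: "tame k X"
  shows "freq X * freq A \<le> freq (X \<inter> (T ^^ k) -` A)"
proof (rule field_le_epsilon)
  fix e :: real assume "e > 0"
  \<comment> \<open>One third is for \<open>freq A\<close> against \<open>b\<close>, the other two
    for the parts of \<open>X\<close> that \<open>\<C>\<close> and \<open>\<D>\<close> leave
    uncovered.\<close>
  define e' where "e' = e / 3"
  have e': "e' > 0" using \<open>e > 0\<close> by (simp add: e'_def)
  have mA: "freq_measurable A" by (rule tame_freq_measurable[OF window_set_tame[OF R A]])
  have mX: "freq_measurable X" by (rule tame_freq_measurable[OF X])
  have "tame (k + N) (X \<inter> (T ^^ k) -` A)"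
    by (intro tame_Int tame_vimage[OF R T A] tame_mono[OF X]) simp
  then have mXA: "freq_measurable (X \<inter> (T ^^ k) -` A)" by (rule tame_freq_measurable)
  obtain \<delta> J S \<rho> where \<delta>: "\<delta> > 0" "window_partition N A e' \<delta> J S \<rho>"
    using window_setD[OF A e'(1)] by blast
  then have J: "finite J" "S \<subseteq> J" "1 - e' \<le> real (card J) * \<rho>"
    "\<And>k w. \<exists>D. cell_family k (k + N) J \<rho> D \<and>
       (\<forall>j\<in>J. \<forall>x\<in>D j. \<forall>y. norm (real_vec y - (pow k (real_vec x) - w)) \<le> \<delta> \<longrightarrow> (y \<in> A \<longleftrightarrow> j \<in> S))"
    unfolding window_partition_def by blast+
  define b where "b = card S * \<rho>"
  \<comment> \<open>At time 0 without translation, the same \<open>J\<close>, \<open>S\<close> and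
    \<open>\<rho>\<close> describe \<open>A\<close> itself. Their uniformity in \<open>k\<close> and
    \<open>w\<close> is what links \<open>b\<close> to \<open>freq A\<close>.\<close>
  obtain D0 where D0: "cell_family 0 (0 + N) J \<rho> D0"
      "\<forall>j\<in>J. \<forall>x\<in>D0 j. \<forall>y. norm (real_vec y - (pow 0 (real_vec x) - 0)) \<le> \<delta> \<longrightarrow> (y \<in> A \<longleftrightarrow> j \<in> S)"
    using J(4)[of 0 0] by (elim exE conjE) (rule that)
  note S0 = freq_cell_family[OF J(1) D0(1) J(2)] and J0 = freq_cell_family[OF J(1) D0(1) order_refl]
  have b: "freq A \<le> b + e'" "0 \<le> b" "b \<le> 1"
  proof -
    have "A \<subseteq> (\<Union>j\<in>S. D0 j) \<union> - (\<Union>j\<in>J. D0 j) \<union> {}"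
    proof
      fix y assume y: "y \<in> A"
      have "j \<in> S" if "j \<in> J" "y \<in> D0 j" for j
        using D0(2)[rule_format, OF that, of y] \<delta>(1) y by simp
      then show "y \<in> (\<Union>j\<in>S. D0 j) \<union> - (\<Union>j\<in>J. D0 j) \<union> {}" by blast
    qed
    then have "freq A \<le> freq (\<Union>j\<in>S. D0 j) + freq (- (\<Union>j\<in>J. D0 j)) + freq ({} :: (int ^ 'n) set)"
      by (intro freq_le_cover mA S0 freq_Compl J0 freq_empty)
    then show "freq A \<le> b + e'"
      using J(3) unfolding freq_Compl(2)[OF J0(1)] J0(2) S0(2) b_def freq_empty(2) by simp
    show "0 \<le> b" "b \<le> 1"
      using freq_ge_0[OF S0(1)] freq_le_1[OF S0(1)] by (simp_all add: S0 b_def)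
  qed
  obtain \<C> where \<C>: "partial_partition k e' \<C>" "\<forall>C\<in>\<C>. \<exists>w. orbit_affine_on T k \<delta> C w"
    using orbit_approximation[OF R T e'(1) \<delta>(1)] by blast
  obtain \<D> where \<D>: "partial_partition k e' \<D>" "\<forall>C\<in>\<D>. C \<subseteq> X \<or> C \<inter> X = {}"
    using tameD[OF X e'] by blast
  define \<D>' where "\<D>' = {C \<in> \<D>. C \<subseteq> X}"
  define \<E> where "\<E> = (\<lambda>(C, D). C \<inter> D) ` (\<C> \<times> \<D>')"
  have \<D>': "\<D>' \<subseteq> \<D>" by (auto simp: \<D>'_def)
  have \<E>: "finite \<E>" "\<E> \<subseteq> cyls 0 k" "disjoint \<E>"
  proof -
    show "finite \<E>" unfolding \<E>_def using \<C>(1) \<D>(1) finite_subset[OF \<D>'] by (simp add: partial_partition_def)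
    show "\<E> \<subseteq> cyls 0 k"
      unfolding \<E>_def using \<C>(1) \<D>(1) \<D>' by (auto simp: partial_partition_def intro!: cylinders_Int)
    show "disjoint \<E>"
      unfolding \<E>_def using \<C>(1) \<D>(1) pairwise_subset[OF _ \<D>']
      by (intro disjoint_Int_image) (auto simp: partial_partition_def)
  qed
  have "\<forall>E\<in>\<E>. \<exists>w. orbit_affine_on T k \<delta> E w"
  proof
    fix E assume "E \<in> \<E>"
    then obtain C where "C \<in> \<C>" "E \<subseteq> C" by (auto simp: \<E>_def)
    then show "\<exists>w. orbit_affine_on T k \<delta> E w"
      using \<C>(2) unfolding orbit_affine_on_def by (meson subsetD)
  qed
  from bchoice[OF this] obtain w where w: "\<forall>E\<in>\<E>. orbit_affine_on T k \<delta> E (w E)" ..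
  have "\<forall>E. \<exists>D. cell_family k (k + N) J \<rho> D \<and>
       (\<forall>j\<in>J. \<forall>x\<in>D j. \<forall>y. norm (real_vec y - (pow k (real_vec x) - w E)) \<le> \<delta> \<longrightarrow> (y \<in> A \<longleftrightarrow> j \<in> S))"
    using J(4) by blast
  from choice[OF this] obtain D where D: "\<forall>E. cell_family k (k + N) J \<rho> (D E) \<and>
       (\<forall>j\<in>J. \<forall>x\<in>D E j. \<forall>y. norm (real_vec y - (pow k (real_vec x) - w E)) \<le> \<delta> \<longrightarrow> (y \<in> A \<longleftrightarrow> j \<in> S))" ..
  \<comment> \<open>Only cells whose points certainly reach \<open>A\<close> are kept, as a lower
    bound requires.\<close>
  have D': "\<forall>E\<in>\<E>. cell_family k (k + N) S \<rho> (D E)"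
    using D J(2) unfolding cell_family_def by (meson disjoint_family_on_mono subsetD)
  define \<F> where "\<F> = (\<lambda>(E, j). E \<inter> D E j) ` (\<E> \<times> S)"
  note ref = cell_family_refine[OF \<E> le_add1 finite_subset[OF J(2,1)] D', folded \<F>_def]
  have "F \<subseteq> X \<inter> (T ^^ k) -` A" if "F \<in> \<F>" for F
  proof
    fix x assume "x \<in> F"
    with that obtain E j where E: "E \<in> \<E>" "j \<in> S" "x \<in> E" "x \<in> D E j" by (auto simp: \<F>_def)
    then have "(T ^^ k) x \<in> A"
      using D w J(2) unfolding orbit_affine_on_def by blast
    moreover have "x \<in> X" using E(1,3) by (auto simp: \<E>_def \<D>'_def)
    ultimately show "x \<in> X \<inter> (T ^^ k) -` A" by blast
  qed
  then have "\<Union>\<F> \<subseteq> X \<inter> (T ^^ k) -` A" by blast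
  then have "freq (\<Union>\<F>) \<le> freq (X \<inter> (T ^^ k) -` A)"
    using ref by (intro freq_mono mXA freq_Union_cyls(1)[of \<F> 0 "k + N"]) auto
  moreover have "freq (\<Union>\<F>) = freq (\<Union>\<E>) * b" using ref(4) by (simp add: b_def)
  moreover have "freq X - 2 * e' \<le> freq (\<Union>\<E>)"
  proof -
    note mC = partial_partition_freq[OF \<C>(1)] and mD = partial_partition_freq[OF \<D>(1)]
    have "X \<subseteq> \<Union>\<E> \<union> - \<Union>\<C> \<union> - \<Union>\<D>"
      unfolding \<E>_def Union_Int_image \<D>'_def using \<D>(2) by blast
    then have "freq X \<le> freq (\<Union>\<E>) + freq (- \<Union>\<C>) + freq (- \<Union>\<D>)"
      by (intro freq_le_cover mX freq_Compl mC mD freq_Union_cyls(1)[OF \<E>])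
    then show ?thesis
      using \<C>(1) \<D>(1) by (simp add: freq_Compl mC mD partial_partition_def)
  qed
  moreover have "freq X * freq A \<le> freq (\<Union>\<E>) * b + e" if "freq X - 2 * e' \<le> freq (\<Union>\<E>)"
  proof -
    have "freq X * (freq A - b) \<le> 1 * e'"
    proof -
      have "freq X * (freq A - b) \<le> freq X * e'"
        using b(1) freq_ge_0[OF mX] by (intro mult_left_mono) auto
      also have "\<dots> \<le> 1 * e'"
        using freq_le_1[OF mX] e' by (intro mult_right_mono) auto
      finally show ?thesis .
    qed
    moreover have "(freq X - freq (\<Union>\<E>)) * b \<le> 2 * e'"
    proof -
      have "(freq X - freq (\<Union>\<E>)) * b \<le> (2 * e') * b"
        using that b(2) by (intro mult_right_mono) auto
      also have "\<dots> \<le> (2 * e') * 1"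
        using b(3) e' by (intro mult_left_mono) auto
      finally show ?thesis by simp
    qed
    ultimately show ?thesis by (simp add: e'_def algebra_simps)
  qed
  ultimately show "freq X * freq A \<le> freq (X \<inter> (T ^^ k) -` A) + e" by linarith
qed

text \<open>The lower bound, applied to \<open>A\<close> and to its complement, forces equality.\<close>

lemma freq_Int_vimage:
  fixes R :: "real ^ 'n \<Rightarrow> int ^ 'n"
  assumes R: "quantizer R" and T: "T = discretization R L" and A: "window_set N A" and X: "tame k X"
  shows "freq (X \<inter> (T ^^ k) -` A) = freq X * freq A"
proof (rule antisym)
  have mA: "freq_measurable A" by (rule tame_freq_measurable[OF window_set_tame[OF R A]])
  have m: "freq_measurable (X \<inter> (T ^^ k) -` B)" if "window_set N B" for B
    by (rule tame_freq_measurable, rule tame_Int[OF tame_mono[OF X] tame_vimage[OF R T that]]) simp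
  note A' = window_set_compl[OF A]
  have "X = (X \<inter> (T ^^ k) -` A) \<union> (X \<inter> (T ^^ k) -` (- A))" by auto
  then have "freq X = freq (X \<inter> (T ^^ k) -` A) + freq (X \<inter> (T ^^ k) -` (- A))"
    using freq_Un(2)[OF m[OF A] m[OF A']] by auto
  moreover have "freq X * (1 - freq A) \<le> freq (X \<inter> (T ^^ k) -` (- A))"
    using freq_Int_vimage_ge[OF R T A' X] by (simp add: freq_Compl mA)
  ultimately show "freq (X \<inter> (T ^^ k) -` A) \<le> freq X * freq A" by (simp add: algebra_simps)
qed (rule freq_Int_vimage_ge[OF assms])

end

lemma forward_algebraE:
  fixes L :: "real ^ 'n ^ 'n"
  assumes "A \<in> forward_algebra L"
  obtains N where "A \<in> quasiperiodic_sets (power_block 0 N) (stacked_powers L)"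
proof -
  obtain N where N: "A \<in> quasiperiodic_sets ({1..int N} \<times> UNIV) (stacked_powers L)"
    using assms unfolding forward_algebra_def by blast
  have "power_block 0 N = {1..int N} \<times> (UNIV :: 'n set)"
    by (auto simp: power_block_def)
  then show thesis using N by (intro that[of N]) simp
qed

text \<open>Measurability is asserted along with the limit because \<open>freq\<close> is defined as
  the lower frequency and is the frequency only for measurable sets.\<close>

theorem theorem11:
  fixes R :: "real ^ 'n \<Rightarrow> int ^ 'n"
    and L :: "real ^ 'n ^ 'n"
    and T :: "int ^ 'n \<Rightarrow> int ^ 'n"
    and A B :: "(int ^ 'n) set"
  assumes "quantizer R"
    and "invertible L"
    and "T = discretization R L"
    and "iteratively_nonresonant L"
    and "A \<in> forward_algebra L"
    and "B \<in> forward_algebra L"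
  shows "freq_measurable A \<and> freq_measurable B \<and>
    (\<forall>k. freq_measurable ((T ^^ k) -` A \<inter> B)) \<and>
    ((\<lambda>k. freq ((T ^^ k) -` A \<inter> B)) \<longlonglongrightarrow> freq A * freq B)"
proof -
  interpret nonresonant_iteration L by standard (rule assms(4))
  obtain N where A: "window_set N A"
    using forward_algebraE[OF assms(5)] window_set_quasiperiodic by metis
  obtain M where B: "window_set M B"
    using forward_algebraE[OF assms(6)] window_set_quasiperiodic by metis
  note tA = window_set_tame[OF assms(1) A] and tB = window_set_tame[OF assms(1) B]
  have "tame (k + N + M) ((T ^^ k) -` A \<inter> B)" for k
    by (intro tame_Int tame_mono[OF tame_vimage[OF assms(1,3) A]] tame_mono[OF tB]) auto
  then have "freq_measurable ((T ^^ k) -` A \<inter> B)" for k by (rule tame_freq_measurable)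
  \<comment> \<open>For \<open>M \<le> k\<close> the set \<open>B\<close> is also tame at level
    \<open>k\<close>, so it can serve as \<open>X\<close>; its cells then precede the block that
    decides \<open>T^k x \<in> A\<close>.\<close>
  moreover have "freq ((T ^^ k) -` A \<inter> B) = freq A * freq B" if "M \<le> k" for k
    using freq_Int_vimage[OF assms(1,3) A tame_mono[OF tB that]] by (simp add: Int_commute mult.commute)
  then have "(\<lambda>k. freq ((T ^^ k) -` A \<inter> B)) \<longlonglongrightarrow> freq A * freq B"
    by (intro tendsto_eventually) (auto simp: eventually_sequentially)
  ultimately show ?thesis
    using tame_freq_measurable[OF tA] tame_freq_measurable[OF tB] by blast
qed

end
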